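(* Let $G \subset GL(n,\mathbb{R})$ be a real algebraic group and let $H, L$ be real algebraic subgroups of $G$. Let $M = G^{\mathbb{C}}/H^{\mathbb{C}}$ and let $\xi_0 = eH^{\mathbb{C}} \in M$ be the base point. Then $L$ has a closed orbit in $G\xi_0$; that is, there exists $g \in G$ such that the orbit $Lg\xi_0$ is a closed subset of $G\xi_0$ (in the classical topology).
   Context: A real algebraic group is a closed connected subgroup $G$ of $GL(n,\mathbb{R})$ such that the connected subgroup $G^{\mathbb{C}}$ of $GL(n,\mathbb{C})$ with Lie algebra $\mathrm{Lie}(G) + i\,\mathrm{Lie}(G) \subset \mathfrak{gl}(n,\mathbb{C})$ is an affine algebraic subgroup of $GL(n,\mathbb{C})$; here $\mathrm{Lie}(G)$ is the Lie algebra of $G$. A real algebraic subgroup of $G$ is a subgroup of $G$ that is itself a real algebraic group in this sense (as a subgroup of the same $GL(n,\mathbb{R})$); $H^{\mathbb{C}}$ is defined from $H$ in the same way as $G^{\mathbb{C}}$ from $G$. The group $G^{\mathbb{C}}$, and hence its subgroups $G$ and $L$, acts on $M = G^{\mathbb{C}}/H^{\mathbb{C}}$ by left translation, and $G\xi_0 \subset M$ is the $G$-orbit of $\xi_0$. The classical topology on $M$ is its topology as a complex manifold, and $G\xi_0$ carries the subspace topology. *)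

theory Defs
  imports
    "HOL-Analysis.Analysis"
    "HOL-Algebra.Generated_Groups"
    "HOL-Algebra.Left_Coset"
    "HOL-Algebra.Group_Action"
begin

definition GL :: "('a::field ^ 'n ^ 'n) monoid" where
  "GL = \<lparr>carrier = {A. invertible A}, mult = (**), one = mat 1\<rparr>"

text \<open>On matrices the type class operations \<open>*\<close>, \<open>^\<close> and \<open>1\<close> are entrywise, so the library
  function \<open>exp\<close> is not the matrix exponential.\<close>

definition matrix_power :: "'a::semiring_1 ^ 'n ^ 'n \<Rightarrow> nat \<Rightarrow> 'a ^ 'n ^ 'n" where
  "matrix_power A k = (((**) A) ^^ k) (mat 1)"

definition matrix_exp :: "'a::real_normed_field ^ 'n ^ 'n \<Rightarrow> 'a ^ 'n ^ 'n" where
  "matrix_exp A = (\<Sum>k. (1 / fact k) *\<^sub>R matrix_power A k)"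

text \<open>The Lie algebra of a closed subgroup of \<open>GL(n,\<real>)\<close>.\<close>

definition Lie :: "(real ^ 'n ^ 'n) set \<Rightarrow> (real ^ 'n ^ 'n) set" where
  "Lie G = {X. \<forall>t::real. matrix_exp (t *\<^sub>R X) \<in> G}"

abbreviation cmat :: "real ^ 'n ^ 'n \<Rightarrow> complex ^ 'n ^ 'n" where
  "cmat \<equiv> map_matrix complex_of_real"

definition complexified_Lie :: "(real ^ 'n ^ 'n) set \<Rightarrow> (complex ^ 'n ^ 'n) set" where
  "complexified_Lie G = {cmat X + mat \<i> ** cmat Y | X Y. X \<in> Lie G \<and> Y \<in> Lie G}"

text \<open>The connected Lie subgroup of \<open>GL(n,\<complex>)\<close> with a given Lie algebra is the subgroup generated by
  the exponentials of the elements of that Lie algebra.\<close>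

definition connected_Lie_subgroup :: "(complex ^ 'n ^ 'n) set \<Rightarrow> (complex ^ 'n ^ 'n) set" where
  "connected_Lie_subgroup \<gg> = generate GL (matrix_exp ` \<gg>)"

definition complexification :: "(real ^ 'n ^ 'n) set \<Rightarrow> (complex ^ 'n ^ 'n) set" where
  "complexification G = connected_Lie_subgroup (complexified_Lie G)"

inductive polynomial_in_entries :: "(complex ^ 'n ^ 'n \<Rightarrow> complex) \<Rightarrow> bool" where
  const: "polynomial_in_entries (\<lambda>A. c)"
| entry: "polynomial_in_entries (\<lambda>A. A $ i $ j)"
| add: "\<lbrakk>polynomial_in_entries p; polynomial_in_entries q\<rbrakk> \<Longrightarrow> polynomial_in_entries (\<lambda>A. p A + q A)"
| mult: "\<lbrakk>polynomial_in_entries p; polynomial_in_entries q\<rbrakk> \<Longrightarrow> polynomial_in_entries (\<lambda>A. p A * q A)"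

text \<open>Allowing \<open>1 / det A\<close> as a further coordinate would not change the zero sets in
  \<open>GL(n,\<complex>)\<close>, because denominators can be cleared.\<close>

definition affine_algebraic_subgroup :: "(complex ^ 'n ^ 'n) set \<Rightarrow> bool" where
  "affine_algebraic_subgroup K \<longleftrightarrow> subgroup K GL \<and>
     (\<exists>P. (\<forall>p\<in>P. polynomial_in_entries p) \<and> K = {A \<in> carrier GL. \<forall>p\<in>P. p A = 0})"

definition real_algebraic_group :: "(real ^ 'n ^ 'n) set \<Rightarrow> bool" where
  "real_algebraic_group G \<longleftrightarrow>
     subgroup G GL \<and> closedin (top_of_set (carrier GL)) G \<and> connected G \<and>
     affine_algebraic_subgroup (complexification G)"

definition real_algebraic_subgroup :: "(real ^ 'n ^ 'n) set \<Rightarrow> (real ^ 'n ^ 'n) set \<Rightarrow> bool" where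
  "real_algebraic_subgroup H G \<longleftrightarrow> real_algebraic_group H \<and> H \<subseteq> G"

definition homogeneous_space ::
    "(complex ^ 'n ^ 'n) set \<Rightarrow> (complex ^ 'n ^ 'n) set \<Rightarrow> (complex ^ 'n ^ 'n) set set" where
  "homogeneous_space K N = lcosets\<^bsub>GL\<lparr>carrier := K\<rparr>\<^esub> N"

text \<open>The classical topology on \<open>K/N\<close> is the quotient topology. For an algebraic (hence closed)
  subgroup \<open>K\<close> of \<open>GL(n,\<complex>)\<close>, the Lie group topology on \<open>K\<close> is the subspace topology.\<close>

definition classical_topology ::
    "(complex ^ 'n ^ 'n) set \<Rightarrow> (complex ^ 'n ^ 'n) set \<Rightarrow> (complex ^ 'n ^ 'n) set topology" where
  "classical_topology K N = topology (\<lambda>U. U \<subseteq> homogeneous_space K N \<and>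
     openin (top_of_set K) {k \<in> K. k <#\<^bsub>GL\<^esub> N \<in> U})"

text \<open>The orbit of a coset under left translation by (the image in \<open>GL(n,\<complex>)\<close> of) a real matrix
  group.\<close>

definition translation_orbit ::
    "(real ^ 'n ^ 'n) set \<Rightarrow> (complex ^ 'n ^ 'n) set \<Rightarrow> (complex ^ 'n ^ 'n) set set" where
  "translation_orbit S \<xi> = orbit (GL\<lparr>carrier := cmat ` S\<rparr>) (\<lambda>g \<eta>. g <#\<^bsub>GL\<^esub> \<eta>) \<xi>"

lemma group_GL: "group (GL :: ('a::field ^ 'n ^ 'n) monoid)"
proof (rule groupI)
  fix A :: "'a ^ 'n ^ 'n" assume "A \<in> carrier GL"
  then obtain B where "A ** B = mat 1" "B ** A = mat 1"
    by (auto simp: GL_def invertible_def)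
  then show "\<exists>B\<in>carrier GL. B \<otimes>\<^bsub>GL\<^esub> A = \<one>\<^bsub>GL\<^esub>"
    by (auto simp: GL_def invertible_def)
qed (auto simp: GL_def invertible_mult matrix_mul_assoc, auto simp: invertible_def)

lemma istopology_classical:
  "istopology (\<lambda>U. U \<subseteq> homogeneous_space K N \<and>
     openin (top_of_set K) {k \<in> K. k <#\<^bsub>GL\<^esub> N \<in> U})"
proof -
  have 1: "{k \<in> K. k <#\<^bsub>GL\<^esub> N \<in> S \<inter> T} =
      {k \<in> K. k <#\<^bsub>GL\<^esub> N \<in> S} \<inter> {k \<in> K. k <#\<^bsub>GL\<^esub> N \<in> T}" for S T by auto
  have 2: "{k \<in> K. k <#\<^bsub>GL\<^esub> N \<in> \<Union>\<K>} = (\<Union>S\<in>\<K>. {k \<in> K. k <#\<^bsub>GL\<^esub> N \<in> S})" for \<K> by auto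
  show ?thesis unfolding istopology_def 1 2 by blast
qed

lemma openin_classical_topology:
  "openin (classical_topology K N) U \<longleftrightarrow> U \<subseteq> homogeneous_space K N \<and>
     openin (top_of_set K) {k \<in> K. k <#\<^bsub>GL\<^esub> N \<in> U}"
  using istopology_classical[of K N] by (simp add: classical_topology_def)

lemma quotient_map_classical_topology:
  "quotient_map (top_of_set K) (classical_topology K N) (\<lambda>k. k <#\<^bsub>GL\<^esub> N)"
proof -
  have img: "(\<lambda>k. k <#\<^bsub>GL\<^esub> N) ` K = homogeneous_space K N"
    by (auto simp: homogeneous_space_def LCOSETS_def l_coset_def)
  have "{k \<in> K. k <#\<^bsub>GL\<^esub> N \<in> homogeneous_space K N} = K"
    using img by blast
  then have "openin (classical_topology K N) (homogeneous_space K N)"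
    by (simp add: openin_classical_topology)
  then have "topspace (classical_topology K N) = homogeneous_space K N"
    by (metis openin_classical_topology openin_subset openin_topspace subset_antisym)
  then show ?thesis
    by (auto simp: quotient_map_def openin_classical_topology img)
qed

end

(* Among the points g of G choose one for which the tangent space Lie(L) g + g Lie(H^C) of the double
   orbit L g H^C has minimal dimension. A point g' of G in the closure of L g H^C then has a tangent
   space that is at least as large as that of every point of the orbit, so if g' is not in the orbit,
   the orbit meets a slice through g' transversally, and in infinitely many points. Lift these points to
   L x H^C. Elementary dimension counting of polynomials of bounded degree gives a nontrivial polynomial
   relation that allows only boundedly many points, a contradiction. Algebraicity enters in that the
   real Zariski closures of L and H^C are no larger than these groups infinitesimally; for L this
   follows from the algebraicity of L^C and Lie(L^C) = Lie(L) + i Lie(L). *)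

theory Submission
  imports Defs
begin

section \<open>The matrix exponential\<close>

text \<open>Minimal dimension alone does not make an orbit closed: lines of irrational slope on a
  torus all have the same dimension, yet none is closed. Algebraicity has to bound the number of
  sheets of the orbit near a point. But \<open>L\<close> need not be a zero set: the positive reals
  are an admissible \<open>L\<close> in \<open>GL(1,R)\<close>, and their Zariski closure contains
  the negative reals. Only the Lie algebra survives the passage to the Zariski closure, so
  polynomial equations cut out the groups infinitesimally, and points are moved by exponentials,
  which stay in the group itself. The count rests on N + 1 functions of degree at most D in N real
  variables. They have s ^ (N + 1) monomials with exponents below s, more than the dimension of the
  polynomials of the resulting degree once s is large, hence they satisfy a relation of degree below
  s in each function. How large s must be depends on D and N, not on the last function
  \<open>t\<close>; so s points of the slice are fixed first and \<open>t\<close> is chosen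
  afterwards to separate them, without moving the bound that they violate.\<close>

lemma norm_matrix_mult_le:
  fixes A :: "'a::real_normed_field ^ 'n ^ 'm" and B :: "'a ^ 'p ^ 'n"
  shows "norm (A ** B) \<le> norm A * norm B"
proof -
  have sq: "(norm M)\<^sup>2 = (\<Sum>i\<in>UNIV. \<Sum>j\<in>UNIV. (norm (M $ i $ j))\<^sup>2)" for M :: "'a ^ 'u::finite ^ 'v::finite"
    by (simp add: norm_vec_def L2_set_def sum_nonneg)
  \<comment> \<open>The norm of nested vectors is the Frobenius norm, so Cauchy-Schwarz for a row of
    \<open>A\<close> and a column of \<open>B\<close> is all that is needed.\<close>
  have entry: "(norm ((A ** B) $ i $ j))\<^sup>2 \<le> (\<Sum>k\<in>UNIV. (norm (A $ i $ k))\<^sup>2) * (\<Sum>k\<in>UNIV. (norm (B $ k $ j))\<^sup>2)" for i j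
  proof -
    have "norm ((A ** B) $ i $ j) \<le> (\<Sum>k\<in>UNIV. \<bar>norm (A $ i $ k)\<bar> * \<bar>norm (B $ k $ j)\<bar>)"
      by (simp add: matrix_matrix_mult_def) (rule order_trans[OF norm_sum], simp add: norm_mult)
    also have "\<dots> \<le> L2_set (\<lambda>k. norm (A $ i $ k)) UNIV * L2_set (\<lambda>k. norm (B $ k $ j)) UNIV"
      by (rule L2_set_mult_ineq)
    finally have "(norm ((A ** B) $ i $ j))\<^sup>2
        \<le> (L2_set (\<lambda>k. norm (A $ i $ k)) UNIV * L2_set (\<lambda>k. norm (B $ k $ j)) UNIV)\<^sup>2"
      by (rule power_mono) simp
    then show ?thesis
      by (simp add: power_mult_distrib L2_set_def sum_nonneg)
  qed
  have "(norm (A ** B))\<^sup>2 \<le> (\<Sum>i\<in>UNIV. \<Sum>j\<in>UNIV. (\<Sum>k\<in>UNIV. (norm (A $ i $ k))\<^sup>2) * (\<Sum>k\<in>UNIV. (norm (B $ k $ j))\<^sup>2))"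
    unfolding sq by (intro sum_mono entry)
  also have "\<dots> = (\<Sum>i\<in>UNIV. \<Sum>k\<in>UNIV. (norm (A $ i $ k))\<^sup>2) * (\<Sum>j\<in>UNIV. \<Sum>k\<in>UNIV. (norm (B $ k $ j))\<^sup>2)"
    by (simp only: sum_product)
  also have "(\<Sum>j\<in>UNIV. \<Sum>k\<in>UNIV. (norm (B $ k $ j))\<^sup>2) = (norm B)\<^sup>2"
    unfolding sq by (rule sum.swap)
  also have "(\<Sum>i\<in>UNIV. \<Sum>k\<in>UNIV. (norm (A $ i $ k))\<^sup>2) * (norm B)\<^sup>2 = (norm A * norm B)\<^sup>2"
    by (simp only: power_mult_distrib sq)
  finally show ?thesis
    by (rule power2_le_imp_le) simp
qed

lemma bounded_bilinear_matrix_mult: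
  "bounded_bilinear ((**) :: 'a::real_normed_field ^ 'n ^ 'm \<Rightarrow> 'a ^ 'p ^ 'n \<Rightarrow> 'a ^ 'p ^ 'm)"
proof
  fix A A' :: "'a ^ 'n ^ 'm" and B B' :: "'a ^ 'p ^ 'n" and r :: real
  show "(A + A') ** B = A ** B + A' ** B"
    by (simp add: matrix_matrix_mult_def vec_eq_iff sum.distrib distrib_right)
  show "A ** (B + B') = A ** B + A ** B'"
    by (rule matrix_add_ldistrib)
  show "r *\<^sub>R A ** B = r *\<^sub>R (A ** B)" "A ** r *\<^sub>R B = r *\<^sub>R (A ** B)"
    by (simp_all add: vec_eq_iff matrix_matrix_mult_def scaleR_sum_right)
  show "\<exists>K. \<forall>(A :: 'a ^ 'n ^ 'm) (B :: 'a ^ 'p ^ 'n). norm (A ** B) \<le> norm A * norm B * K"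
    by (rule exI[of _ 1]) (simp add: norm_matrix_mult_le)
qed

text \<open>Since \<open>**\<close> is not the multiplication of a type class, bilinearity stands in
  for the ring rules in all matrix calculations below.\<close>

lemmas matrix_mult_simps =
  bounded_bilinear.scaleR_left[OF bounded_bilinear_matrix_mult]
  bounded_bilinear.scaleR_right[OF bounded_bilinear_matrix_mult]
  bounded_bilinear.zero_left[OF bounded_bilinear_matrix_mult]
  bounded_bilinear.zero_right[OF bounded_bilinear_matrix_mult]
  bounded_bilinear.minus_left[OF bounded_bilinear_matrix_mult]
  bounded_bilinear.minus_right[OF bounded_bilinear_matrix_mult]
  bounded_bilinear.diff_left[OF bounded_bilinear_matrix_mult]
  bounded_bilinear.diff_right[OF bounded_bilinear_matrix_mult]
  bounded_bilinear.add_left[OF bounded_bilinear_matrix_mult]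
  bounded_bilinear.add_right[OF bounded_bilinear_matrix_mult]

lemmas continuous_on_matrix_mult [continuous_intros] =
  bounded_bilinear.continuous_on[OF bounded_bilinear_matrix_mult]

lemmas has_derivative_matrix_mult =
  bounded_bilinear.FDERIV[OF bounded_bilinear_matrix_mult]

lemma has_vector_derivative_matrix_mult:
  fixes f :: "real \<Rightarrow> 'a::real_normed_field ^ 'n ^ 'm" and g :: "real \<Rightarrow> 'a ^ 'p ^ 'n"
  assumes "(f has_vector_derivative f') (at t within S)" "(g has_vector_derivative g') (at t within S)"
  shows "((\<lambda>t. f t ** g t) has_vector_derivative (f t ** g' + f' ** g t)) (at t within S)"
  using bounded_bilinear.has_vector_derivative[OF bounded_bilinear_matrix_mult assms] .

section \<open>Matrix powers and the exponential series\<close>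

lemma matrix_power_0 [simp]: "matrix_power A 0 = mat 1"
  by (simp add: matrix_power_def)

lemma matrix_power_Suc: "matrix_power A (Suc k) = A ** matrix_power A k"
  by (simp add: matrix_power_def)

lemma matrix_power_Suc2: "matrix_power A (Suc k) = matrix_power A k ** A"
  by (induction k) (simp_all add: matrix_power_Suc matrix_mul_assoc)

lemma matrix_power_scaleR:
  fixes A :: "'a::real_normed_field ^ 'n ^ 'n"
  shows "matrix_power (t *\<^sub>R A) k = t ^ k *\<^sub>R matrix_power A k"
  by (induction k) (simp_all add: matrix_power_Suc matrix_mult_simps)

lemma norm_matrix_power_le:
  fixes A :: "'a::real_normed_field ^ 'n ^ 'n"
  shows "norm (matrix_power A k) \<le> norm (mat 1 :: 'a ^ 'n ^ 'n) * norm A ^ k"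
proof (induction k)
  case (Suc k)
  have "norm (matrix_power A (Suc k)) \<le> norm A * norm (matrix_power A k)"
    by (simp add: matrix_power_Suc norm_matrix_mult_le)
  also have "\<dots> \<le> norm A * (norm (mat 1 :: 'a ^ 'n ^ 'n) * norm A ^ k)"
    by (intro mult_left_mono Suc) simp
  finally show ?case by (simp add: mult_ac)
qed simp

lemma norm_matrix_exp_term_le:
  fixes A :: "'a::real_normed_field ^ 'n ^ 'n"
  assumes "norm A \<le> R"
  shows "norm ((1 / fact k) *\<^sub>R matrix_power A k) \<le> norm (mat 1 :: 'a ^ 'n ^ 'n) * (R ^ k /\<^sub>R fact k)"
proof -
  have "norm ((1 / fact k) *\<^sub>R matrix_power A k) \<le> (1 / fact k) * (norm (mat 1 :: 'a ^ 'n ^ 'n) * norm A ^ k)"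
    using norm_matrix_power_le[of A k] by (simp add: divide_right_mono)
  also have "\<dots> \<le> (1 / fact k) * (norm (mat 1 :: 'a ^ 'n ^ 'n) * R ^ k)"
    by (intro mult_left_mono power_mono assms) auto
  finally show ?thesis by (simp add: field_simps)
qed

lemma summable_matrix_exp_bound:
  "summable (\<lambda>k. norm (mat 1 :: 'a::real_normed_field ^ 'n ^ 'n) * (R ^ k /\<^sub>R fact k :: real))"
  by (intro summable_mult summable_exp_generic)

lemma summable_norm_matrix_exp:
  fixes A :: "'a::real_normed_field ^ 'n ^ 'n"
  shows "summable (\<lambda>k. norm ((1 / fact k) *\<^sub>R matrix_power A k))"
proof (rule summable_comparison_test'[OF summable_matrix_exp_bound[where 'a='a and 'n='n and R="norm A"]])
  show "norm (norm ((1 / fact n) *\<^sub>R matrix_power A n))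
      \<le> norm (mat 1 :: 'a ^ 'n ^ 'n) * (norm A ^ n /\<^sub>R fact n)" for n
    using norm_matrix_exp_term_le[OF order_refl[of "norm A"]] by simp
qed

lemma matrix_exp_sums:
  fixes A :: "'a::{real_normed_field,banach} ^ 'n ^ 'n"
  shows "(\<lambda>k. (1 / fact k) *\<^sub>R matrix_power A k) sums matrix_exp A"
  unfolding matrix_exp_def by (rule summable_sums[OF summable_norm_cancel[OF summable_norm_matrix_exp]])

lemma matrix_exp_0 [simp]: "matrix_exp (0 :: 'a::{real_normed_field,banach} ^ 'n ^ 'n) = mat 1"
proof -
  have "matrix_power (0 :: 'a ^ 'n ^ 'n) k = 0" if "k \<noteq> 0" for k
    using that by (cases k) (auto simp: matrix_power_Suc matrix_mult_simps)
  then have "(\<lambda>k. (1 / fact k) *\<^sub>R matrix_power (0 :: 'a ^ 'n ^ 'n) k) sums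
      (\<Sum>k\<in>{0}. (1 / fact k) *\<^sub>R matrix_power (0 :: 'a ^ 'n ^ 'n) k)"
    by (intro sums_finite) auto
  from sums_unique2[OF matrix_exp_sums this] show ?thesis
    by simp
qed

lemma matrix_exp_bounded_linear_sums:
  fixes A :: "'a::{real_normed_field,banach} ^ 'n ^ 'n"
  assumes "bounded_linear f"
  shows "(\<lambda>k. (1 / fact k) *\<^sub>R f (matrix_power A k)) sums f (matrix_exp A)"
  using bounded_linear.sums[OF assms matrix_exp_sums[of A]]
  by (simp add: linear_cmul[OF bounded_linear.linear[OF assms]])

text \<open>Intertwining passes to powers and then to the series. As \<open>P\<close> may be
  singular, this covers the commutation of \<open>A\<close> with its exponential and the conjugation
  rule, and later shows that stabiliser directions exponentiate into the stabiliser.\<close>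

lemma matrix_exp_intertwine:
  fixes A B P :: "'a::{real_normed_field,banach} ^ 'n ^ 'n"
  assumes "P ** A = B ** P"
  shows "P ** matrix_exp A = matrix_exp B ** P"
proof -
  have pow: "P ** matrix_power A k = matrix_power B k ** P" for k
  proof (induction k)
    case (Suc k)
    have "P ** matrix_power A (Suc k) = B ** (P ** matrix_power A k)"
      by (simp add: matrix_power_Suc matrix_mul_assoc assms)
    then show ?case
      by (simp add: Suc matrix_power_Suc matrix_mul_assoc)
  qed simp
  have "(\<lambda>k. (1 / fact k) *\<^sub>R (P ** matrix_power A k)) sums (P ** matrix_exp A)"
    by (intro matrix_exp_bounded_linear_sums bounded_bilinear.bounded_linear_right[OF bounded_bilinear_matrix_mult])
  moreover have "(\<lambda>k. (1 / fact k) *\<^sub>R (matrix_power B k ** P)) sums (matrix_exp B ** P)"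
    by (intro matrix_exp_bounded_linear_sums bounded_bilinear.bounded_linear_left[OF bounded_bilinear_matrix_mult])
  ultimately show ?thesis
    unfolding pow by (rule sums_unique2)
qed

lemma matrix_exp_scaleR_commute:
  fixes A :: "'a::{real_normed_field,banach} ^ 'n ^ 'n"
  shows "matrix_exp (t *\<^sub>R A) ** A = A ** matrix_exp (t *\<^sub>R A)"
proof -
  have "A ** (t *\<^sub>R A) = (t *\<^sub>R A) ** A"
    by (simp only: matrix_mult_simps)
  from matrix_exp_intertwine[OF this] show ?thesis
    by (rule sym)
qed

lemma cmat_matrix_exp: "cmat (matrix_exp A) = matrix_exp (cmat A)"
proof -
  have 1: "cmat (matrix_power A k) = matrix_power (cmat A) k" for k
    by (induction k) (simp_all add: matrix_power_Suc vec_eq_iff matrix_matrix_mult_def mat_def)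
  have "bounded_linear cmat"
    by (rule linear_conv_bounded_linear[THEN iffD1]) (auto intro!: linearI simp: vec_eq_iff, simp add: scaleR_conv_of_real)
  from matrix_exp_bounded_linear_sums[OF this, of A] matrix_exp_sums[of "cmat A"] show ?thesis
    unfolding 1 by (rule sums_unique2)
qed

text \<open>Each entry is a scalar power series in \<open>t\<close> that converges everywhere; it
  may be differentiated termwise, and the shift of coefficients by \<open>diffs\<close> is
  multiplication by \<open>A\<close>.\<close>

lemma matrix_exp_has_vector_derivative:
  fixes A :: "complex ^ 'n ^ 'n"
  shows "((\<lambda>t. matrix_exp (t *\<^sub>R A)) has_vector_derivative A ** matrix_exp (t *\<^sub>R A)) (at t within S)"
proof -
  have entry: "((\<lambda>t. matrix_exp (t *\<^sub>R A) $ i $ j) has_vector_derivative (A ** matrix_exp (t *\<^sub>R A)) $ i $ j) (at t within S)"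
    for i j
  proof -
    define c where "c k = matrix_power A k $ i $ j / fact k" for k
    have nth: "bounded_linear (\<lambda>M :: complex ^ 'n ^ 'n. M $ i $ j)"
      using bounded_linear_compose[OF bounded_linear_vec_nth bounded_linear_vec_nth] .
    have S1: "(\<lambda>k. c k * of_real x ^ k) sums (matrix_exp (x *\<^sub>R A) $ i $ j)" for x
      using bounded_linear.sums[OF nth matrix_exp_sums[of "x *\<^sub>R A"]]
      by (simp add: matrix_power_scaleR c_def scaleR_conv_of_real[where 'a=complex] field_simps)
    have S2: "(\<lambda>k. diffs c k * of_real x ^ k) sums ((A ** matrix_exp (x *\<^sub>R A)) $ i $ j)" for x
    proof -
      have "(\<lambda>k. (A ** ((1 / fact k) *\<^sub>R matrix_power (x *\<^sub>R A) k)) $ i $ j) sums ((A ** matrix_exp (x *\<^sub>R A)) $ i $ j)"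
        by (intro bounded_linear.sums[OF nth]
            bounded_linear.sums[OF bounded_bilinear.bounded_linear_right[OF bounded_bilinear_matrix_mult]] matrix_exp_sums)
      moreover have "(A ** ((1 / fact k) *\<^sub>R matrix_power (x *\<^sub>R A) k)) $ i $ j = diffs c k * of_real x ^ k" for k
        by (simp add: matrix_power_scaleR matrix_mult_simps c_def diffs_def matrix_power_Suc[symmetric]
            scaleR_conv_of_real[where 'a=complex] field_simps del: of_nat_Suc)
      ultimately show ?thesis by simp
    qed
    have sm: "summable (\<lambda>k. c k * y ^ k)" for y
    proof (rule summable_norm_cancel, rule summable_comparison_test')
      show "summable (\<lambda>k. norm (mat 1 :: complex ^ 'n ^ 'n) * ((norm A * norm y) ^ k /\<^sub>R fact k))"
        by (rule summable_matrix_exp_bound)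
      show "norm (norm (c k * y ^ k)) \<le> norm (mat 1 :: complex ^ 'n ^ 'n) * ((norm A * norm y) ^ k /\<^sub>R fact k)" for k
      proof -
        have "norm (matrix_power A k $ i $ j) \<le> norm (matrix_power A k)"
          by (meson Finite_Cartesian_Product.norm_nth_le order_trans)
        also have "\<dots> \<le> norm (mat 1 :: complex ^ 'n ^ 'n) * norm A ^ k"
          by (rule norm_matrix_power_le)
        finally have "norm (matrix_power A k $ i $ j) * norm y ^ k \<le> norm (mat 1 :: complex ^ 'n ^ 'n) * norm A ^ k * norm y ^ k"
          by (rule mult_right_mono) simp
        then show ?thesis
          by (simp add: c_def norm_mult norm_divide norm_power field_simps power_mult_distrib)
      qed
    qed
    have "((\<lambda>x. \<Sum>k. c k * x ^ k) has_field_derivative (\<Sum>k. diffs c k * of_real t ^ k)) (at (of_real t))"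
      by (rule termdiffs_strong_converges_everywhere[OF sm])
    then have "((\<lambda>t. \<Sum>k. c k * of_real t ^ k) has_vector_derivative (\<Sum>k. diffs c k * of_real t ^ k)) (at t)"
      by (rule has_vector_derivative_real_field)
    then show ?thesis
      using sums_unique[OF S1] sums_unique[OF S2] by (simp add: has_vector_derivative_at_within)
  qed
  show ?thesis
    unfolding has_vector_derivative_def
  proof (subst has_derivative_componentwise_within, intro ballI)
    fix b :: "complex ^ 'n ^ 'n" assume "b \<in> Basis"
    then obtain i j u where b: "b = axis i (axis j u)"
      by (auto simp: Basis_vec_def)
    have "((\<lambda>t. matrix_exp (t *\<^sub>R A) $ i $ j \<bullet> u) has_derivative (\<lambda>x. (x *\<^sub>R (A ** matrix_exp (t *\<^sub>R A)) $ i $ j) \<bullet> u)) (at t within S)"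
      using entry[of i j] unfolding has_vector_derivative_def by (intro has_derivative_inner_left)
    then show "((\<lambda>t. matrix_exp (t *\<^sub>R A) \<bullet> b) has_derivative (\<lambda>x. x *\<^sub>R (A ** matrix_exp (t *\<^sub>R A)) \<bullet> b)) (at t within S)"
      by (simp add: b inner_axis)
  qed
qed

section \<open>One-parameter groups of matrices\<close>

lemma has_vector_derivative_zero_imp_eq:
  fixes f :: "real \<Rightarrow> 'a::real_normed_vector"
  assumes "\<And>t. (f has_vector_derivative 0) (at t)"
  shows "f s = f t"
  using has_derivative_zero_unique[of UNIV f t s] assms by (simp add: has_vector_derivative_def)

text \<open>As a function of \<open>s\<close> the left side has derivative 0, because
  \<open>A\<close> commutes with its exponentials. Both the inverse of the exponential and the
  addition law come from this identity.\<close>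

lemma matrix_exp_minus_scaleR_mult:
  fixes A :: "complex ^ 'n ^ 'n"
  shows "matrix_exp (- (s *\<^sub>R A)) ** matrix_exp ((s + t) *\<^sub>R A) = matrix_exp (t *\<^sub>R A)"
proof -
  have d1: "((\<lambda>u. matrix_exp (- (u *\<^sub>R A))) has_vector_derivative - (matrix_exp (- (u *\<^sub>R A)) ** A)) (at u)" for u
    using matrix_exp_has_vector_derivative[of "- A" u UNIV] matrix_exp_scaleR_commute[of "- u" A]
    by (simp add: matrix_mult_simps)
  have d2: "((\<lambda>u. matrix_exp ((u + t) *\<^sub>R A)) has_vector_derivative A ** matrix_exp ((u + t) *\<^sub>R A)) (at u)" for u
  proof -
    have "((\<lambda>u. u + t) has_vector_derivative 1) (at u)"
      by (auto intro!: derivative_eq_intros)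
    from vector_diff_chain_at[OF this matrix_exp_has_vector_derivative[of A "u + t" UNIV]] show ?thesis
      by (simp add: o_def)
  qed
  have "((\<lambda>u. matrix_exp (- (u *\<^sub>R A)) ** matrix_exp ((u + t) *\<^sub>R A)) has_vector_derivative 0) (at u)" for u
    using has_vector_derivative_matrix_mult[OF d1 d2, of u]
    by (simp add: matrix_mult_simps matrix_mul_assoc)
  from has_vector_derivative_zero_imp_eq[OF this, of s 0] show ?thesis
    by simp
qed

lemma matrix_exp_minus_mult:
  fixes A :: "complex ^ 'n ^ 'n"
  shows "matrix_exp (- A) ** matrix_exp A = mat 1" "matrix_exp A ** matrix_exp (- A) = mat 1"
  using matrix_exp_minus_scaleR_mult[of 1 A 0] matrix_exp_minus_scaleR_mult[of 1 "- A" 0] by simp_all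

lemma matrix_exp_add_scaleR:
  fixes A :: "complex ^ 'n ^ 'n"
  shows "matrix_exp ((s + t) *\<^sub>R A) = matrix_exp (s *\<^sub>R A) ** matrix_exp (t *\<^sub>R A)"
  by (metis matrix_exp_minus_scaleR_mult matrix_exp_minus_mult(2) matrix_mul_assoc matrix_mul_lid)

lemma matrix_exp_of_nat_scaleR:
  fixes A :: "complex ^ 'n ^ 'n"
  shows "matrix_exp (of_nat k *\<^sub>R A) = matrix_power (matrix_exp A) k"
  by (induction k) (simp_all add: matrix_power_Suc matrix_exp_add_scaleR)

lemma matrix_exp_conj:
  fixes A P Q :: "complex ^ 'n ^ 'n"
  assumes "Q ** P = mat 1"
  shows "matrix_exp (P ** A ** Q) = P ** matrix_exp A ** Q"
proof -
  have "P ** A = (P ** A ** Q) ** P"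
    by (metis assms matrix_mul_assoc matrix_mul_rid)
  from matrix_exp_intertwine[OF this] have "P ** matrix_exp A ** Q = matrix_exp (P ** A ** Q) ** (P ** Q)"
    by (simp add: matrix_mul_assoc)
  then show ?thesis
    using assms by (simp add: matrix_left_right_inverse)
qed

lemma continuous_on_matrix_power:
  "continuous_on S (\<lambda>A :: 'a::real_normed_field ^ 'n ^ 'n. matrix_power A k)"
  by (induction k) (auto simp: matrix_power_Suc intro!: continuous_intros)

lemma continuous_on_matrix_exp: "continuous_on S (matrix_exp :: complex ^ 'n ^ 'n \<Rightarrow> _)"
proof -
  have "continuous (at A) matrix_exp" for A :: "complex ^ 'n ^ 'n"
  proof -
    have "uniform_limit (cball 0 (norm A + 1)) (\<lambda>m A. \<Sum>k<m. (1 / fact k) *\<^sub>R matrix_power A k)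
        (\<lambda>A :: complex ^ 'n ^ 'n. \<Sum>k. (1 / fact k) *\<^sub>R matrix_power A k) sequentially"
      by (rule Weierstrass_m_test[OF norm_matrix_exp_term_le summable_matrix_exp_bound]) simp
    then have "continuous_on (cball 0 (norm A + 1)) (\<lambda>A :: complex ^ 'n ^ 'n. \<Sum>k. (1 / fact k) *\<^sub>R matrix_power A k)"
      by (rule uniform_limit_theorem[rotated])
         (auto intro!: always_eventually continuous_intros continuous_on_matrix_power)
    then have "continuous_on (ball 0 (norm A + 1)) (matrix_exp :: complex ^ 'n ^ 'n \<Rightarrow> _)"
      unfolding matrix_exp_def by (rule continuous_on_subset) auto
    then show ?thesis
      by (simp add: continuous_on_eq_continuous_at)
  qed
  then show ?thesis
    by (simp add: continuous_at_imp_continuous_on)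
qed

lemma continuous_on_matrix_exp' [continuous_intros]:
  fixes f :: "'b::topological_space \<Rightarrow> complex ^ 'n ^ 'n"
  shows "continuous_on S f \<Longrightarrow> continuous_on S (\<lambda>x. matrix_exp (f x))"
  using continuous_on_compose2[OF continuous_on_matrix_exp] by blast

text \<open>From the quadratic term on, the series is dominated by \<open>(norm A)\<^sup>2\<close>
  times the exponential series, as \<open>fact (k + 2)\<close> is at least
  \<open>fact k\<close>.\<close>

lemma matrix_exp_first_order:
  fixes A :: "'a::{real_normed_field,banach} ^ 'n ^ 'n"
  shows "norm (matrix_exp A - mat 1 - A) \<le> norm (mat 1 :: 'a ^ 'n ^ 'n) * exp (norm A) * (norm A)\<^sup>2"
proof -
  let ?t = "\<lambda>k. (1 / fact k) *\<^sub>R matrix_power A k"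
  let ?n1 = "norm (mat 1 :: 'a ^ 'n ^ 'n)"
  have "(\<lambda>k. ?t (k + 2)) sums (matrix_exp A - (\<Sum>k<2. ?t k))"
    using matrix_exp_sums[of A] by (rule sums_split_initial_segment)
  then have 1: "(\<lambda>k. ?t (k + 2)) sums (matrix_exp A - mat 1 - A)"
    by (simp add: numeral_2_eq_2 matrix_power_Suc diff_diff_eq)
  have 2: "(\<lambda>k. ?n1 * (norm A)\<^sup>2 * (norm A ^ k /\<^sub>R fact k)) sums (?n1 * (norm A)\<^sup>2 * exp (norm A))"
    by (intro sums_mult exp_converges)
  have "norm (?t (k + 2)) \<le> ?n1 * (norm A)\<^sup>2 * (norm A ^ k /\<^sub>R fact k)" for k
  proof -
    have "norm (?t (k + 2)) \<le> ?n1 * (norm A ^ (k + 2) /\<^sub>R fact (k + 2))"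
      by (rule norm_matrix_exp_term_le) simp
    also have "\<dots> \<le> ?n1 * (norm A ^ (k + 2) /\<^sub>R fact k)"
    proof -
      have "fact k \<le> (fact (k + 2) :: real)"
        by (rule fact_mono) simp
      then have "norm A ^ (k + 2) / fact (k + 2) \<le> norm A ^ (k + 2) / fact k"
        by (intro divide_left_mono) auto
      then show ?thesis
        by (simp only: mult_left_mono norm_ge_zero divide_inverse real_scaleR_def mult.commute)
    qed
    finally show ?thesis by (simp add: power_add power2_eq_square mult_ac)
  qed
  then have "norm (matrix_exp A - mat 1 - A) \<le> ?n1 * (norm A)\<^sup>2 * exp (norm A)"
    using 1 2 by (metis (no_types, lifting) norm_sums_le)
  then show ?thesis by (simp add: mult_ac)
qed

lemma has_derivative_quadratic:
  fixes f :: "'a::real_normed_vector \<Rightarrow> 'b::real_normed_vector"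
  assumes lin: "bounded_linear f'" and r: "r > 0"
    and bnd: "\<And>x. norm (x - a) < r \<Longrightarrow> norm (f x - f a - f' (x - a)) \<le> C * (norm (x - a))\<^sup>2"
  shows "(f has_derivative f') (at a)"
  unfolding has_derivative_at2
proof (intro conjI lin)
  show "((\<lambda>y. (1 / norm (y - a)) *\<^sub>R (f y - (f a + f' (y - a)))) \<longlongrightarrow> 0) (at a)"
  proof (rule Lim_null_comparison)
    show "\<forall>\<^sub>F y in at a. norm ((1 / norm (y - a)) *\<^sub>R (f y - (f a + f' (y - a)))) \<le> C * norm (y - a)"
      using eventually_at_ball'[OF r, of a UNIV]
    proof eventually_elim
      case (elim y)
      then have "norm (f y - f a - f' (y - a)) \<le> C * (norm (y - a))\<^sup>2"
        by (intro bnd) (auto simp: dist_norm norm_minus_commute)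
      with elim show ?case
        by (simp add: power2_eq_square divide_simps diff_diff_eq mult_ac)
    qed
    show "((\<lambda>y. C * norm (y - a)) \<longlongrightarrow> 0) (at a)"
      by (auto intro!: tendsto_eq_intros)
  qed
qed

lemma matrix_exp_has_derivative_0:
  "((matrix_exp :: complex ^ 'n ^ 'n \<Rightarrow> _) has_derivative (\<lambda>v. v)) (at 0)"
proof (rule has_derivative_quadratic[where C = "norm (mat 1 :: complex ^ 'n ^ 'n) * exp 1" and r = 1])
  fix x :: "complex ^ 'n ^ 'n" assume "norm (x - 0) < 1"
  then have "exp (norm x) \<le> exp 1"
    by simp
  then have "norm (mat 1 :: complex ^ 'n ^ 'n) * exp (norm x) * (norm x)\<^sup>2
      \<le> norm (mat 1 :: complex ^ 'n ^ 'n) * exp 1 * (norm x)\<^sup>2"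
    by (meson mult_left_mono mult_right_mono norm_ge_zero zero_le_power2)
  with matrix_exp_first_order[of x]
  have "norm (matrix_exp x - mat 1 - x) \<le> norm (mat 1 :: complex ^ 'n ^ 'n) * exp 1 * (norm x)\<^sup>2"
    by (rule order_trans)
  then show "norm (matrix_exp x - matrix_exp 0 - (x - 0)) \<le> norm (mat 1 :: complex ^ 'n ^ 'n) * exp 1 * (norm (x - 0))\<^sup>2"
    by (simp only: diff_zero matrix_exp_0)
qed (simp_all add: bounded_linear_ident)

section \<open>Lie algebras of closed matrix groups\<close>

lemma GL_simps [simp]:
  "carrier GL = {A. invertible A}" "x \<otimes>\<^bsub>GL\<^esub> y = x ** y" "\<one>\<^bsub>GL\<^esub> = mat 1"
  by (simp_all add: GL_def)

lemma matrix_inv_mult: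
  fixes A :: "'a::field ^ 'n ^ 'n"
  assumes "invertible A"
  shows "A ** matrix_inv A = mat 1" "matrix_inv A ** A = mat 1"
  using assms by (auto simp: invertible_def matrix_inv_def intro: someI2_ex)

lemma matrix_inv_eqI:
  fixes A B :: "'a::field ^ 'n ^ 'n"
  assumes "A ** B = mat 1"
  shows "matrix_inv A = B"
proof -
  have "invertible A"
    using assms by (auto simp: invertible_right_inverse)
  then have "matrix_inv A ** A ** B = B"
    by (simp add: matrix_inv_mult)
  then show ?thesis
    using assms by (simp flip: matrix_mul_assoc)
qed

lemma inv_GL:
  fixes A :: "'a::field ^ 'n ^ 'n"
  assumes "invertible A"
  shows "inv\<^bsub>GL\<^esub> A = matrix_inv A"
proof (rule group.inv_equality[OF group_GL])
  show "matrix_inv A \<in> carrier GL"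
    using matrix_inv_mult[OF assms] by (auto simp: invertible_def)
qed (use assms matrix_inv_mult[OF assms] in simp_all)

lemma subgroup_GL_D:
  fixes \<Gamma> :: "('a::field ^ 'n ^ 'n) set"
  assumes "subgroup \<Gamma> GL"
  shows "mat 1 \<in> \<Gamma>" "\<And>x y. x \<in> \<Gamma> \<Longrightarrow> y \<in> \<Gamma> \<Longrightarrow> x ** y \<in> \<Gamma>"
    "\<And>x. x \<in> \<Gamma> \<Longrightarrow> invertible x" "\<And>x. x \<in> \<Gamma> \<Longrightarrow> matrix_inv x \<in> \<Gamma>"
proof -
  show "mat 1 \<in> \<Gamma>" "\<And>x y. x \<in> \<Gamma> \<Longrightarrow> y \<in> \<Gamma> \<Longrightarrow> x ** y \<in> \<Gamma>"
    using subgroup.one_closed[OF assms] subgroup.m_closed[OF assms] by auto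
  show *: "invertible x" if "x \<in> \<Gamma>" for x
    using subgroup.mem_carrier[OF assms that] by simp
  show "matrix_inv x \<in> \<Gamma>" if "x \<in> \<Gamma>" for x
    using subgroup.m_inv_closed[OF assms that] inv_GL[OF *[OF that]] by simp
qed

lemma invertible_matrix_exp: "invertible (matrix_exp A)" for A :: "complex ^ 'n ^ 'n"
  using matrix_exp_minus_mult[of A] by (auto simp: invertible_def)

text \<open>One-parameter subgroups with real parameter: a real Lie algebra, also for a complex
  group. The groups \<open>L\<close> and \<open>H^C\<close> can thus be treated alike, inside the
  complex matrices.\<close>

definition cLie :: "(complex ^ 'n ^ 'n) set \<Rightarrow> (complex ^ 'n ^ 'n) set" where
  "cLie \<Gamma> = {X. \<forall>t::real. matrix_exp (t *\<^sub>R X) \<in> \<Gamma>}"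

lemma cLie_exp: "X \<in> cLie \<Gamma> \<Longrightarrow> matrix_exp X \<in> \<Gamma>"
  unfolding cLie_def by (metis (mono_tags) mem_Collect_eq scaleR_one)

lemma cLie_scaleR: "X \<in> cLie \<Gamma> \<Longrightarrow> r *\<^sub>R X \<in> cLie \<Gamma>"
  by (simp add: cLie_def)

lemma norm_mult_near_1:
  fixes A M :: "'a::real_normed_field ^ 'n ^ 'n"
  assumes "norm (A - mat 1) \<le> r"
  shows "norm (A ** M) \<le> (1 + r) * norm M"
proof -
  have "A ** M = M + (A - mat 1) ** M"
    by (simp add: matrix_mult_simps)
  then have "norm (A ** M) \<le> norm M + norm ((A - mat 1) ** M)"
    by (metis norm_triangle_ineq)
  also have "\<dots> \<le> norm M + r * norm M"
    using norm_matrix_mult_le[of "A - mat 1" M] mult_right_mono[OF assms norm_ge_zero[of M]] by linarith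
  finally show ?thesis by (simp add: algebra_simps)
qed

lemma norm_matrix_power_near_1:
  fixes A :: "'a::real_normed_field ^ 'n ^ 'n"
  assumes "norm (A - mat 1) \<le> r"
  shows "norm (matrix_power A m) \<le> norm (mat 1 :: 'a ^ 'n ^ 'n) * (1 + r) ^ m"
proof (induction m)
  case (Suc m)
  have r: "0 \<le> r" using assms norm_ge_zero order_trans by blast
  have "norm (matrix_power A (Suc m)) \<le> (1 + r) * norm (matrix_power A m)"
    by (simp add: matrix_power_Suc norm_mult_near_1[OF assms])
  also have "\<dots> \<le> (1 + r) * (norm (mat 1 :: 'a ^ 'n ^ 'n) * (1 + r) ^ m)"
    using r by (intro mult_left_mono Suc) auto
  finally show ?case by (simp add: mult_ac)
qed simp

text \<open>The difference telescopes, one factor at a time. The bound is made for \<open>r\<close>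
  of order 1 / m, where \<open>(1 + r) ^ m\<close> stays bounded.\<close>

lemma norm_matrix_power_diff:
  fixes A B :: "'a::real_normed_field ^ 'n ^ 'n"
  assumes A: "norm (A - mat 1) \<le> r" and B: "norm (B - mat 1) \<le> r"
  shows "norm (matrix_power A m - matrix_power B m)
    \<le> of_nat m * norm (mat 1 :: 'a ^ 'n ^ 'n) * (1 + r) ^ m * norm (A - B)"
proof (induction m)
  case (Suc m)
  let ?n = "norm (mat 1 :: 'a ^ 'n ^ 'n)" and ?e = "norm (A - B)"
  have r: "0 \<le> r" using A norm_ge_zero order_trans by blast
  have "matrix_power A (Suc m) - matrix_power B (Suc m)
      = A ** (matrix_power A m - matrix_power B m) + (A - B) ** matrix_power B m"
    by (simp add: matrix_power_Suc matrix_mult_simps)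
  then have "norm (matrix_power A (Suc m) - matrix_power B (Suc m))
      \<le> norm (A ** (matrix_power A m - matrix_power B m)) + norm ((A - B) ** matrix_power B m)"
    by (metis norm_triangle_ineq)
  also have "\<dots> \<le> (1 + r) * norm (matrix_power A m - matrix_power B m) + ?e * norm (matrix_power B m)"
    by (intro add_mono norm_mult_near_1[OF A] norm_matrix_mult_le)
  also have "\<dots> \<le> (1 + r) * (of_nat m * ?n * (1 + r) ^ m * ?e) + ?e * (?n * (1 + r) ^ m)"
    using r by (intro add_mono mult_left_mono Suc norm_matrix_power_near_1[OF B]) auto
  also have "\<dots> \<le> (1 + r) * (of_nat m * ?n * (1 + r) ^ m * ?e) + (1 + r) * (?e * (?n * (1 + r) ^ m))"
    using r mult_right_mono[of 1 "1 + r" "?e * (?n * (1 + r) ^ m)"] by (intro add_mono) auto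
  finally show ?case by (simp add: algebra_simps)
qed simp

lemma matrix_exp_minus_1_div_tendsto:
  fixes Y :: "complex ^ 'n ^ 'n"
  assumes "\<epsilon> \<longlonglongrightarrow> (0::real)" "\<And>k. \<epsilon> k \<noteq> 0"
  shows "(\<lambda>k. (matrix_exp (\<epsilon> k *\<^sub>R Y) - mat 1) /\<^sub>R \<epsilon> k) \<longlonglongrightarrow> Y"
proof -
  have "((\<lambda>t. matrix_exp (t *\<^sub>R Y)) has_vector_derivative Y) (at 0)"
    using matrix_exp_has_vector_derivative[of Y 0 UNIV] by simp
  then have "((\<lambda>h. norm (matrix_exp (h *\<^sub>R Y) - mat 1 - h *\<^sub>R Y) / \<bar>h\<bar>) \<longlongrightarrow> 0) (at 0)"
    unfolding has_vector_derivative_def has_derivative_at by simp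
  then have "(\<lambda>k. norm (matrix_exp (\<epsilon> k *\<^sub>R Y) - mat 1 - \<epsilon> k *\<^sub>R Y) / \<bar>\<epsilon> k\<bar>) \<longlonglongrightarrow> 0"
    by (rule filterlim_compose) (use assms in \<open>auto simp: filterlim_at\<close>)
  moreover have "norm (matrix_exp (\<epsilon> k *\<^sub>R Y) - mat 1 - \<epsilon> k *\<^sub>R Y) / \<bar>\<epsilon> k\<bar>
      = norm ((matrix_exp (\<epsilon> k *\<^sub>R Y) - mat 1) /\<^sub>R \<epsilon> k - Y)" for k
  proof -
    have "(matrix_exp (\<epsilon> k *\<^sub>R Y) - mat 1) /\<^sub>R \<epsilon> k - Y = (matrix_exp (\<epsilon> k *\<^sub>R Y) - mat 1 - \<epsilon> k *\<^sub>R Y) /\<^sub>R \<epsilon> k"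
      using assms(2)[of k] by (simp add: scaleR_diff_right)
    then show ?thesis by (simp only: norm_scaleR) (simp add: divide_inverse)
  qed
  ultimately show ?thesis
    by (simp add: LIM_zero_iff tendsto_norm_zero_iff)
qed

text \<open>Up to o(\<epsilon> k), \<open>g k\<close> agrees with
  \<open>matrix_exp (\<epsilon> k *\<^sub>R Y)\<close>. Raised to the power of about t / \<epsilon>
  k, it converges to the exponential of \<open>t *\<^sub>R Y\<close>, and a relatively closed group
  contains the limit because it is invertible.\<close>

lemma cLie_if_tangent:
  fixes \<Gamma> :: "(complex ^ 'n ^ 'n) set"
  assumes \<Gamma>: "subgroup \<Gamma> GL" "closedin (top_of_set (carrier GL)) \<Gamma>"
    and g: "\<And>k. g k \<in> \<Gamma>"
    and \<epsilon>: "\<epsilon> \<longlonglongrightarrow> (0::real)" "\<And>k. \<epsilon> k > 0"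
    and lim: "(\<lambda>k. (g k - mat 1) /\<^sub>R \<epsilon> k) \<longlonglongrightarrow> Y"
  shows "Y \<in> cLie \<Gamma>"
proof -
  obtain C where C: "closed C" "\<Gamma> = {A. invertible A} \<inter> C"
    using \<Gamma>(2) by (auto simp: closedin_closed)
  let ?n = "norm (mat 1 :: complex ^ 'n ^ 'n)"
  have main: "matrix_exp (t *\<^sub>R Y) \<in> \<Gamma>" if t: "t \<ge> 0" for t
  proof -
    define m where "m k = nat \<lfloor>t / \<epsilon> k\<rfloor>" for k
    define h where "h k = matrix_exp (\<epsilon> k *\<^sub>R Y)" for k
    \<comment> \<open>The slack 1 makes the distance of \<open>g k\<close> and of \<open>h k\<close>
      from the identity at most \<open>c * \<epsilon> k\<close> from some index on.\<close>
    define c where "c = norm Y + 1"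
    have m_le: "of_nat (m k) * \<epsilon> k \<le> t" for k
    proof -
      have "real (m k) \<le> t / \<epsilon> k"
        using t \<epsilon>(2)[of k] by (simp add: m_def)
      then show ?thesis using \<epsilon>(2)[of k] by (simp add: field_simps)
    qed
    have m_ge: "t - \<epsilon> k \<le> of_nat (m k) * \<epsilon> k" for k
    proof -
      have "t / \<epsilon> k - 1 \<le> of_nat (m k)"
        unfolding m_def by linarith
      then have "(t / \<epsilon> k - 1) * \<epsilon> k \<le> of_nat (m k) * \<epsilon> k"
        using \<epsilon>(2)[of k] by (intro mult_right_mono) auto
      moreover have "(t / \<epsilon> k - 1) * \<epsilon> k = t - \<epsilon> k"
        using \<epsilon>(2)[of k] by (simp add: left_diff_distrib)
      ultimately show ?thesis by simp
    qed
    have m_lim: "(\<lambda>k. of_nat (m k) * \<epsilon> k) \<longlonglongrightarrow> t"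
    proof (rule tendsto_sandwich[of "\<lambda>k. t - \<epsilon> k" _ _ "\<lambda>k. t"])
      show "(\<lambda>k. t - \<epsilon> k) \<longlonglongrightarrow> t" using tendsto_diff[OF tendsto_const[of t] \<epsilon>(1)] by simp
    qed (auto simp: m_le m_ge)
    have h_lim: "(\<lambda>k. (h k - mat 1) /\<^sub>R \<epsilon> k) \<longlonglongrightarrow> Y"
      unfolding h_def using \<epsilon> by (intro matrix_exp_minus_1_div_tendsto) (auto, metis less_irrefl)
    have ev: "\<forall>\<^sub>F k in sequentially. norm (u k - mat 1) \<le> c * \<epsilon> k"
      if "(\<lambda>k. (u k - mat 1) /\<^sub>R \<epsilon> k) \<longlonglongrightarrow> Y" for u :: "nat \<Rightarrow> complex ^ 'n ^ 'n"
    proof -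
      have "\<forall>\<^sub>F k in sequentially. norm ((u k - mat 1) /\<^sub>R \<epsilon> k) < c"
        using order_tendstoD(2)[OF tendsto_norm[OF that], of c] by (simp add: c_def)
      then show ?thesis
      proof eventually_elim
        case (elim k)
        have "norm (u k - mat 1) = \<epsilon> k * norm ((u k - mat 1) /\<^sub>R \<epsilon> k)"
          using \<epsilon>(2)[of k] by simp
        also have "\<dots> \<le> \<epsilon> k * c"
          using elim \<epsilon>(2)[of k] by (intro mult_left_mono) auto
        finally show ?case by (simp add: mult.commute)
      qed
    qed
    have diff: "(\<lambda>k. (g k - h k) /\<^sub>R \<epsilon> k) \<longlonglongrightarrow> 0"
      using tendsto_diff[OF lim h_lim] by (simp flip: scaleR_diff_right)
    \<comment> \<open>The difference \<open>g k - h k\<close> is o(\<epsilon> k), which outweighs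
      the \<open>m k\<close> telescoping terms, and the growth factors stay below
      \<open>exp (c * t)\<close>.\<close>
    have d0: "(\<lambda>k. matrix_power (g k) (m k) - matrix_power (h k) (m k)) \<longlonglongrightarrow> 0"
    proof (rule Lim_null_comparison)
      show "\<forall>\<^sub>F k in sequentially. norm (matrix_power (g k) (m k) - matrix_power (h k) (m k))
          \<le> t * ?n * exp (c * t) * norm ((g k - h k) /\<^sub>R \<epsilon> k)"
        using ev[OF lim] ev[OF h_lim]
      proof eventually_elim
        case (elim k)
        have pos: "\<epsilon> k > 0" by (rule \<epsilon>)
        have "(1 + c * \<epsilon> k) ^ m k \<le> exp (c * \<epsilon> k) ^ m k"
          using pos by (intro power_mono) (auto simp: c_def exp_ge_add_one_self)
        also have "\<dots> = exp (c * (of_nat (m k) * \<epsilon> k))"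
          by (simp add: exp_of_nat_mult[symmetric] mult_ac)
        also have "\<dots> \<le> exp (c * t)"
          using m_le[of k] by (auto simp: c_def intro!: mult_left_mono)
        finally have e: "(1 + c * \<epsilon> k) ^ m k \<le> exp (c * t)" .
        have "norm (matrix_power (g k) (m k) - matrix_power (h k) (m k))
            \<le> of_nat (m k) * ?n * (1 + c * \<epsilon> k) ^ m k * norm (g k - h k)"
          by (rule norm_matrix_power_diff[OF elim])
        also have "\<dots> \<le> of_nat (m k) * ?n * exp (c * t) * norm (g k - h k)"
          using e by (intro mult_right_mono mult_left_mono) auto
        also have "\<dots> = (of_nat (m k) * \<epsilon> k) * (?n * exp (c * t) * norm ((g k - h k) /\<^sub>R \<epsilon> k))"
          using pos by simp
        also have "\<dots> \<le> t * (?n * exp (c * t) * norm ((g k - h k) /\<^sub>R \<epsilon> k))"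
          by (intro mult_right_mono m_le) auto
        finally show ?case by (simp add: mult_ac)
      qed
      show "(\<lambda>k. t * ?n * exp (c * t) * norm ((g k - h k) /\<^sub>R \<epsilon> k)) \<longlonglongrightarrow> 0"
        using tendsto_mult_right_zero[OF tendsto_norm_zero[OF diff]] .
    qed
    have d1: "(\<lambda>k. matrix_power (h k) (m k)) \<longlonglongrightarrow> matrix_exp (t *\<^sub>R Y)"
    proof -
      have "matrix_power (h k) (m k) = matrix_exp ((of_nat (m k) * \<epsilon> k) *\<^sub>R Y)" for k
        using matrix_exp_of_nat_scaleR[of "m k" "\<epsilon> k *\<^sub>R Y"] by (simp add: h_def)
      moreover have "(\<lambda>k. matrix_exp ((of_nat (m k) * \<epsilon> k) *\<^sub>R Y)) \<longlonglongrightarrow> matrix_exp (t *\<^sub>R Y)"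
        using m_lim continuous_on_matrix_exp[of UNIV]
        by (intro isCont_tendsto_compose[of _ matrix_exp] tendsto_scaleR tendsto_const) (auto simp: continuous_on_eq_continuous_at)
      ultimately show ?thesis by simp
    qed
    have "(\<lambda>k. matrix_power (g k) (m k)) \<longlonglongrightarrow> matrix_exp (t *\<^sub>R Y)"
      using tendsto_add[OF d0 d1] by simp
    moreover have "matrix_power (g k) j \<in> \<Gamma>" for j k
      by (induction j) (auto simp: matrix_power_Suc subgroup_GL_D[OF \<Gamma>(1)] g)
    then have "\<forall>k. matrix_power (g k) (m k) \<in> C"
      using C by auto
    ultimately have "matrix_exp (t *\<^sub>R Y) \<in> C"
      using closed_sequentially[OF C(1), of "\<lambda>k. matrix_power (g k) (m k)"] by simp
    then show ?thesis using C(2) invertible_matrix_exp by blast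
  qed
  have "matrix_exp (t *\<^sub>R Y) \<in> \<Gamma>" for t
  proof (cases "t \<ge> 0")
    case False
    then have *: "matrix_exp (- (t *\<^sub>R Y)) \<in> \<Gamma>"
      using main[of "- t"] by simp
    have "matrix_inv (matrix_exp (- (t *\<^sub>R Y))) = matrix_exp (t *\<^sub>R Y)"
      by (rule matrix_inv_eqI) (rule matrix_exp_minus_mult)
    with subgroup_GL_D(4)[OF \<Gamma>(1) *] show ?thesis by simp
  qed (rule main)
  then show ?thesis by (simp add: cLie_def)
qed

section \<open>Velocities of curves, projections, and the structure of \<open>cLie\<close>\<close>

lemma has_vector_derivative_sequentially:
  fixes f :: "real \<Rightarrow> 'a::real_normed_vector"
  assumes f: "(f has_vector_derivative f') (at t)"
    and \<epsilon>: "\<epsilon> \<longlonglongrightarrow> (0::real)" "\<And>k. \<epsilon> k \<noteq> 0"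
  shows "(\<lambda>k. (f (t + \<epsilon> k) - f t) /\<^sub>R \<epsilon> k) \<longlonglongrightarrow> f'"
proof -
  have "((\<lambda>h. norm (f (t + h) - f t - h *\<^sub>R f') / \<bar>h\<bar>) \<longlongrightarrow> 0) (at 0)"
    using f unfolding has_vector_derivative_def has_derivative_at by simp
  then have "(\<lambda>k. norm (f (t + \<epsilon> k) - f t - \<epsilon> k *\<^sub>R f') / \<bar>\<epsilon> k\<bar>) \<longlonglongrightarrow> 0"
    by (rule filterlim_compose) (use \<epsilon> in \<open>auto simp: filterlim_at\<close>)
  moreover have "norm (f (t + \<epsilon> k) - f t - \<epsilon> k *\<^sub>R f') / \<bar>\<epsilon> k\<bar> = norm ((f (t + \<epsilon> k) - f t) /\<^sub>R \<epsilon> k - f')" for k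
  proof -
    have "(f (t + \<epsilon> k) - f t) /\<^sub>R \<epsilon> k - f' = (f (t + \<epsilon> k) - f t - \<epsilon> k *\<^sub>R f') /\<^sub>R \<epsilon> k"
      using \<epsilon>(2)[of k] by (simp add: scaleR_diff_right)
    then show ?thesis by (simp only: norm_scaleR) (simp add: divide_inverse)
  qed
  ultimately show ?thesis
    by (simp add: LIM_zero_iff tendsto_norm_zero_iff)
qed

lemma subspace_vector_derivative:
  fixes f :: "real \<Rightarrow> 'a::euclidean_space"
  assumes "subspace S" "\<And>s. f s \<in> S" "(f has_vector_derivative f') (at t)"
  shows "f' \<in> S"
proof -
  have "(\<lambda>k. (f (t + inverse (real (Suc k))) - f t) /\<^sub>R inverse (real (Suc k))) \<longlonglongrightarrow> f'"
    using LIMSEQ_inverse_real_of_nat by (intro has_vector_derivative_sequentially[OF assms(3)]) auto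
  then show ?thesis
    by (rule closed_sequentially[OF closed_subspace[OF assms(1)], rotated])
       (use assms in \<open>auto intro!: subspace_scale subspace_diff\<close>)
qed

text \<open>Orthogonality is wanted for the last two conclusions: neither the projection nor its
  complement increases norms, which drives the Gronwall estimate and the construction of the
  chart.\<close>

lemma obtain_orthogonal_projection:
  fixes S :: "'a::euclidean_space set"
  assumes "subspace S"
  obtains B P where "finite B" "B \<subseteq> S" "\<And>x. P x = (\<Sum>b\<in>B. (x \<bullet> b) *\<^sub>R b)"
    "bounded_linear P" "\<And>x. P x \<in> S" "\<And>x. x \<in> S \<Longrightarrow> P x = x"
    "\<And>x. norm (P x) \<le> norm x" "\<And>x. norm (x - P x) \<le> norm x"
proof -
  obtain B where B: "B \<subseteq> S" "pairwise orthogonal B" "\<And>x. x \<in> B \<Longrightarrow> norm x = 1"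
    "independent B" "card B = dim S" "span B = S"
    using orthonormal_basis_subspace[OF assms] by metis
  have fin: "finite B" using B(4) independent_imp_finite by blast
  define P where "P x = (\<Sum>b\<in>B. (x \<bullet> b) *\<^sub>R b)" for x
  have bl: "bounded_linear P"
    unfolding P_def by (intro bounded_linear_sum bounded_linear_scaleR_left[THEN bounded_linear_compose] bounded_linear_inner_left)
  have in_S: "P x \<in> S" for x
  proof -
    have "P x \<in> span B"
      unfolding P_def by (intro span_sum span_scale span_base)
    then show ?thesis using B(6) by simp
  qed
  have orth: "(x - P x) \<bullet> b = 0" if "b \<in> B" for x b
  proof -
    have "P x \<bullet> b = (\<Sum>c\<in>B. if c = b then x \<bullet> b else 0)"
      unfolding P_def inner_sum_left
      by (rule sum.cong) (use B(2,3) that in \<open>auto simp: pairwise_def orthogonal_def norm_eq_1\<close>)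
    then show ?thesis using that fin by (simp add: inner_diff_left)
  qed
  have pyth: "(norm x)\<^sup>2 = (norm (P x))\<^sup>2 + (norm (x - P x))\<^sup>2" for x
  proof -
    have "(x - P x) \<bullet> P x = (\<Sum>b\<in>B. (x \<bullet> b) * ((x - P x) \<bullet> b))"
      by (subst (2) P_def) (simp only: inner_sum_right inner_scaleR_right)
    then have "(x - P x) \<bullet> P x = 0"
      using orth by simp
    then show ?thesis
      by (simp add: power2_norm_eq_inner inner_diff_left inner_diff_right inner_commute)
  qed
  show ?thesis
  proof (rule that[OF fin B(1) P_def bl in_S])
    show "P x = x" if "x \<in> S" for x
      unfolding P_def using orthonormal_basis_expand[of B x] B fin that
      by (simp add: inner_commute)
    show "norm (P x) \<le> norm x" for x
      by (rule power2_le_imp_le) (simp_all add: pyth[of x])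
    show "norm (x - P x) \<le> norm x" for x
      by (rule power2_le_imp_le) (simp_all add: pyth[of x])
  qed
qed

lemma obtain_projection:
  fixes S :: "'a::euclidean_space set"
  assumes "subspace S"
  obtains P where "bounded_linear P" "\<And>x. P x \<in> S" "\<And>x. x \<in> S \<Longrightarrow> P x = x"
  by (rule obtain_orthogonal_projection[OF assms]) (rule that; assumption)

lemma cLie_if_curve:
  fixes \<Gamma> :: "(complex ^ 'n ^ 'n) set"
  assumes \<Gamma>: "subgroup \<Gamma> GL" "closedin (top_of_set (carrier GL)) \<Gamma>"
    and f: "\<And>t. f t \<in> \<Gamma>" "f 0 = mat 1" "(f has_vector_derivative Y) (at 0)"
  shows "Y \<in> cLie \<Gamma>"
proof (rule cLie_if_tangent[OF \<Gamma>])
  show "(\<lambda>k. (f (inverse (real (Suc k))) - mat 1) /\<^sub>R inverse (real (Suc k))) \<longlonglongrightarrow> Y"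
    using has_vector_derivative_sequentially[OF f(3) LIMSEQ_inverse_real_of_nat] f(2) by simp
qed (use f LIMSEQ_inverse_real_of_nat in auto)

text \<open>For sums, the curve that multiplies the two one-parameter groups stays in the group and
  has velocity \<open>X + Y\<close> at 0. It is no one-parameter group, so the closedness of the
  group is used through \<open>cLie_if_curve\<close>.\<close>

lemma subspace_cLie:
  fixes \<Gamma> :: "(complex ^ 'n ^ 'n) set"
  assumes \<Gamma>: "subgroup \<Gamma> GL" "closedin (top_of_set (carrier GL)) \<Gamma>"
  shows "subspace (cLie \<Gamma>)"
proof (rule subspaceI)
  show "0 \<in> cLie \<Gamma>"
    by (simp add: cLie_def subgroup_GL_D[OF \<Gamma>(1)])
  fix X Y assume XY: "X \<in> cLie \<Gamma>" "Y \<in> cLie \<Gamma>"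
  show "X + Y \<in> cLie \<Gamma>"
  proof (rule cLie_if_curve[OF \<Gamma>])
    show "matrix_exp (t *\<^sub>R X) ** matrix_exp (t *\<^sub>R Y) \<in> \<Gamma>" for t
      using XY by (auto simp: cLie_def intro: subgroup_GL_D[OF \<Gamma>(1)])
    show "((\<lambda>t. matrix_exp (t *\<^sub>R X) ** matrix_exp (t *\<^sub>R Y)) has_vector_derivative X + Y) (at 0)"
      using has_vector_derivative_matrix_mult[OF matrix_exp_has_vector_derivative[of X 0 UNIV] matrix_exp_has_vector_derivative[of Y 0 UNIV]]
      by (simp add: add.commute)
  qed simp
qed (rule cLie_scaleR)

lemma cLie_Ad:
  fixes \<Gamma> :: "(complex ^ 'n ^ 'n) set"
  assumes \<Gamma>: "subgroup \<Gamma> GL" and g: "g \<in> \<Gamma>" "h \<in> \<Gamma>" "h ** g = mat 1" and X: "X \<in> cLie \<Gamma>"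
  shows "g ** X ** h \<in> cLie \<Gamma>"
proof -
  have "matrix_exp (t *\<^sub>R (g ** X ** h)) = g ** matrix_exp (t *\<^sub>R X) ** h" for t
    using matrix_exp_conj[OF g(3), of "t *\<^sub>R X"] by (simp add: matrix_mult_simps)
  then show ?thesis
    using g X subgroup_GL_D(2)[OF \<Gamma>] by (simp add: cLie_def)
qed

text \<open>The bracket is the velocity at 0 of the conjugates of \<open>Y\<close> by
  \<open>matrix_exp (t *\<^sub>R X)\<close>, a curve inside the subspace
  \<open>cLie \<Gamma>\<close>.\<close>

lemma cLie_bracket:
  fixes \<Gamma> :: "(complex ^ 'n ^ 'n) set"
  assumes \<Gamma>: "subgroup \<Gamma> GL" "closedin (top_of_set (carrier GL)) \<Gamma>"
    and X: "X \<in> cLie \<Gamma>" and Y: "Y \<in> cLie \<Gamma>"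
  shows "X ** Y - Y ** X \<in> cLie \<Gamma>"
proof (rule subspace_vector_derivative[OF subspace_cLie[OF \<Gamma>]])
  show "matrix_exp (t *\<^sub>R X) ** Y ** matrix_exp (t *\<^sub>R (- X)) \<in> cLie \<Gamma>" for t
    using X cLie_scaleR[OF X, of "-1"]
    by (intro cLie_Ad[OF \<Gamma>(1) _ _ _ Y]) (simp_all add: cLie_def matrix_exp_minus_mult)
  have "((\<lambda>t. matrix_exp (t *\<^sub>R X) ** Y) has_vector_derivative X ** Y) (at 0)"
    using has_vector_derivative_matrix_mult[OF matrix_exp_has_vector_derivative[of X 0 UNIV] has_vector_derivative_const[of Y]]
    by (simp add: matrix_mult_simps)
  from has_vector_derivative_matrix_mult[OF this matrix_exp_has_vector_derivative[of "- X" 0 UNIV]]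
  show "((\<lambda>t. matrix_exp (t *\<^sub>R X) ** Y ** matrix_exp (t *\<^sub>R (- X))) has_vector_derivative X ** Y - Y ** X) (at 0)"
    by (simp add: matrix_mult_simps)
qed

section \<open>Open maps and generation by exponentials\<close>

text \<open>Linear independence of the functionals \<open>D f\<close>, given by witnesses: the
  vectors \<open>v\<close> serve as directions in open mapping, perturbation and counting
  arguments.\<close>

definition dual_basis :: "('i \<Rightarrow> 'a::real_vector \<Rightarrow> real) \<Rightarrow> 'i set \<Rightarrow> ('i \<Rightarrow> 'a) \<Rightarrow> bool" where
  "dual_basis D A v \<longleftrightarrow> (\<forall>f\<in>A. \<forall>g\<in>A. D f (v g) = (if f = g then 1 else 0))"

text \<open>A submersion theorem for finitely many functions. Exchanging the linear part along the
  \<open>v i\<close> for the actual increments gives a map \<open>F\<close> of the space to itself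
  with derivative the identity at \<open>q\<close>, to which the open mapping theorem
  applies.\<close>

lemma open_map_family:
  fixes f :: "'i \<Rightarrow> 'a::euclidean_space \<Rightarrow> real"
  assumes A: "finite A" and U: "open U" "q \<in> U"
    and cont: "\<And>i. i \<in> A \<Longrightarrow> continuous_on U (f i)"
    and der: "\<And>i. i \<in> A \<Longrightarrow> (f i has_derivative f' i) (at q)"
    and v: "dual_basis f' A v" and \<epsilon>: "\<epsilon> > 0"
  shows "\<exists>\<delta>>0. \<forall>y. (\<forall>i\<in>A. \<bar>y i - f i q\<bar> < \<delta>) \<longrightarrow> (\<exists>x\<in>U. dist x q < \<epsilon> \<and> (\<forall>i\<in>A. f i x = y i))"
proof -
  have dual: "f' i (v j) = (if i = j then 1 else 0)" if "i \<in> A" "j \<in> A" for i j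
    using v that by (simp add: dual_basis_def)
  define F where "F x = x - (\<Sum>i\<in>A. f' i (x - q) *\<^sub>R v i) + (\<Sum>i\<in>A. (f i x - f i q) *\<^sub>R v i)" for x
  define T where "T = U \<inter> ball q \<epsilon>"
  have lin: "bounded_linear (f' i)" if "i \<in> A" for i
    using der[OF that] by (rule has_derivative_bounded_linear)
  have f'0: "f' i 0 = 0" if "i \<in> A" for i
    using linear_0[OF bounded_linear.linear[OF lin[OF that]]] .
  have Fq: "F q = q" by (simp add: F_def f'0)
  have contF: "continuous_on U F"
  proof -
    have "continuous_on U (\<lambda>x. f' i (x - q))" if "i \<in> A" for i
      by (rule bounded_linear.continuous_on[OF lin[OF that]]) (intro continuous_intros)
    then show ?thesis
      unfolding F_def by (intro continuous_intros cont) auto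
  qed
  have derF: "(F has_derivative (\<lambda>x. x)) (at q)"
  proof -
    have 1: "((\<lambda>x. f' i (x - q)) has_derivative f' i) (at q)" if "i \<in> A" for i
      by (rule has_derivative_eq_rhs[OF bounded_linear.has_derivative[OF lin[OF that]]])
         (auto intro!: derivative_eq_intros)
    have "(F has_derivative (\<lambda>x. x - (\<Sum>i\<in>A. f' i x *\<^sub>R v i) + (\<Sum>i\<in>A. (f' i x - 0) *\<^sub>R v i))) (at q)"
      unfolding F_def
      by (intro has_derivative_add has_derivative_diff has_derivative_ident has_derivative_sum
          has_derivative_scaleR_left has_derivative_const 1 der)
    then show ?thesis by simp
  qed
  have "F q \<in> interior (F ` T)"
  proof (rule sussmann_open_mapping[OF U(1) contF U(2) derF])
    show "q \<in> interior T"
      using U \<epsilon> by (simp add: T_def interior_open open_Int)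
  qed (auto simp: T_def o_def id_def bounded_linear_ident)
  then obtain d where d: "d > 0" "ball q d \<subseteq> F ` T"
    unfolding mem_interior Fq by blast
  \<comment> \<open>Scaled so that the target \<open>z\<close> stays within \<open>d\<close> of
    \<open>q\<close>; the summand 1 keeps the denominator positive also for empty
    \<open>A\<close>.\<close>
  define \<delta> where "\<delta> = d / (1 + (\<Sum>i\<in>A. norm (v i)))"
  have pos: "1 + (\<Sum>i\<in>A. norm (v i)) > 0"
    by (intro add_pos_nonneg sum_nonneg) auto
  show ?thesis
  proof (intro exI[of _ \<delta>] conjI allI impI)
    show "\<delta> > 0" using d pos by (simp add: \<delta>_def)
    fix y assume y: "\<forall>i\<in>A. \<bar>y i - f i q\<bar> < \<delta>"
    define z where "z = q + (\<Sum>i\<in>A. (y i - f i q) *\<^sub>R v i)"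
    have "norm (\<Sum>i\<in>A. (y i - f i q) *\<^sub>R v i) \<le> (\<Sum>i\<in>A. \<delta> * norm (v i))"
      by (intro sum_norm_le) (auto intro!: mult_right_mono less_imp_le[OF bspec[OF y]])
    also have "\<dots> < \<delta> * (1 + (\<Sum>i\<in>A. norm (v i)))"
      using \<open>\<delta> > 0\<close> by (simp add: sum_distrib_left algebra_simps)
    also have "\<dots> = d" using pos by (simp add: \<delta>_def)
    finally have "z \<in> ball q d" by (simp add: z_def dist_norm norm_minus_commute)
    then obtain x where x: "x \<in> T" "F x = z" using d(2) by auto
    have "f j x = y j" if j: "j \<in> A" for j
    proof -
      note l = bounded_linear.linear[OF lin[OF j]]
      have pick: "f' j (\<Sum>i\<in>A. c i *\<^sub>R v i) = c j" for c
        using j A by (simp add: linear_sum[OF l] linear_cmul[OF l] dual if_distrib cong: if_cong)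
      \<comment> \<open>By duality \<open>f' j\<close> picks the coefficients of \<open>v j\<close>:
        the linear terms cancel and the increment of \<open>f j\<close> remains.\<close>
      have "f' j (F x - q) = f' j (x - q) - f' j (x - q) + (f j x - f j q)"
      proof -
        have "F x - q = (x - q) - (\<Sum>i\<in>A. f' i (x - q) *\<^sub>R v i) + (\<Sum>i\<in>A. (f i x - f i q) *\<^sub>R v i)"
          by (simp add: F_def)
        then show ?thesis
          by (simp only: linear_add[OF l] linear_diff[OF l] pick)
      qed
      moreover have "f' j (z - q) = y j - f j q"
        by (simp add: z_def pick)
      ultimately show ?thesis using x by simp
    qed
    then show "\<exists>x\<in>U. dist x q < \<epsilon> \<and> (\<forall>i\<in>A. f i x = y i)"
      using x by (auto simp: T_def dist_commute)
  qed
qed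

section \<open>Subgroups generated by exponentials\<close>

lemma generate_exp_incl:
  fixes h :: "(complex ^ 'n ^ 'n) set"
  assumes "A \<in> h"
  shows "matrix_exp A \<in> generate GL (matrix_exp ` h)"
  using assms by (auto intro: generate.incl)

lemma subgroup_generate_exp: "subgroup (generate GL (matrix_exp ` h)) GL" for h :: "(complex ^ 'n ^ 'n) set"
  by (rule group.generate_is_subgroup[OF group_GL]) (auto simp: invertible_matrix_exp)

text \<open>A subgroup that contains a neighbourhood of the identity is open, and so are its cosets;
  hence its trace on the group is also closed, and connectedness applies.\<close>

lemma connected_subgroup_subset_if_nhd:
  fixes \<Gamma> N :: "(complex ^ 'n ^ 'n) set"
  assumes \<Gamma>: "subgroup \<Gamma> GL" and N: "subgroup N GL" and conn: "connected \<Gamma>"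
    and W: "open W" "mat 1 \<in> W" "W \<inter> \<Gamma> \<subseteq> N"
  shows "\<Gamma> \<subseteq> N"
proof -
  note G = subgroup_GL_D[OF \<Gamma>] and H = subgroup_GL_D[OF N]
  have nb: "\<exists>T. open T \<and> x \<in> T \<and> (\<forall>y\<in>T \<inter> \<Gamma>. matrix_inv x ** y \<in> N)" if x: "x \<in> \<Gamma>" for x
  proof (intro exI conjI ballI)
    let ?T = "(\<lambda>y. matrix_inv x ** y) -` W"
    show "open ?T"
      by (intro open_vimage W continuous_intros)
    show "x \<in> ?T" using W G(3)[OF x] by (simp add: matrix_inv_mult)
    fix y assume "y \<in> ?T \<inter> \<Gamma>"
    then show "matrix_inv x ** y \<in> N" using W G x by auto
  qed
  have o1: "openin (top_of_set \<Gamma>) (\<Gamma> \<inter> N)"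
    unfolding openin_subopen[of _ "\<Gamma> \<inter> N"]
  proof
    fix x assume x: "x \<in> \<Gamma> \<inter> N"
    then obtain T where T: "open T" "x \<in> T" "\<forall>y\<in>T \<inter> \<Gamma>. matrix_inv x ** y \<in> N" using nb by blast
    have "y \<in> N" if "y \<in> T \<inter> \<Gamma>" for y
    proof -
      have "x ** (matrix_inv x ** y) \<in> N" using T(3) that x H by blast
      then show ?thesis using x G(3) by (simp add: matrix_mul_assoc matrix_inv_mult)
    qed
    then show "\<exists>T. openin (top_of_set \<Gamma>) T \<and> x \<in> T \<and> T \<subseteq> \<Gamma> \<inter> N"
      using T x by (intro exI[of _ "\<Gamma> \<inter> T"]) (auto intro: openin_open_Int)
  qed
  have o2: "openin (top_of_set \<Gamma>) (\<Gamma> - \<Gamma> \<inter> N)"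
    unfolding openin_subopen[of _ "\<Gamma> - \<Gamma> \<inter> N"]
  proof
    fix x assume x: "x \<in> \<Gamma> - \<Gamma> \<inter> N"
    then obtain T where T: "open T" "x \<in> T" "\<forall>y\<in>T \<inter> \<Gamma>. matrix_inv x ** y \<in> N" using nb by blast
    have "y \<notin> N" if "y \<in> T \<inter> \<Gamma>" for y
    proof
      assume "y \<in> N"
      then have "y ** matrix_inv (matrix_inv x ** y) \<in> N" using T(3) that H by blast
      moreover have "matrix_inv (matrix_inv x ** y) = matrix_inv y ** x"
      proof (rule matrix_inv_eqI)
        have "matrix_inv x ** y ** (matrix_inv y ** x) = matrix_inv x ** (y ** matrix_inv y) ** x"
          by (simp add: matrix_mul_assoc)
        then show "matrix_inv x ** y ** (matrix_inv y ** x) = mat 1"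
          using that x G(3) by (simp add: matrix_inv_mult)
      qed
      ultimately show False using x that G(3) by (simp add: matrix_mul_assoc matrix_inv_mult)
    qed
    then show "\<exists>T. openin (top_of_set \<Gamma>) T \<and> x \<in> T \<and> T \<subseteq> \<Gamma> - \<Gamma> \<inter> N"
      using T x by (intro exI[of _ "\<Gamma> \<inter> T"]) (auto intro: openin_open_Int)
  qed
  have "closedin (top_of_set \<Gamma>) (\<Gamma> \<inter> N)"
    using o2 by (simp add: closedin_def)
  then have "\<Gamma> \<inter> N = {} \<or> \<Gamma> \<inter> N = \<Gamma>"
    using conn o1 by (auto simp: connected_clopen)
  then show ?thesis using G(1) H(1) by auto
qed

text \<open>In the chart that multiplies an exponential from \<open>cLie \<Gamma>\<close> by one
  from its complement, elements of the group near the identity that are not generated would give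
  nonzero complementary \<open>C n\<close> tending to 0 whose exponentials lie in the group. A limit
  of their directions is tangent to the group, hence fixed by \<open>P\<close>, but as a limit of
  complementary vectors it is killed by \<open>P\<close>, against norm 1.\<close>

lemma connected_subset_generate_exp:
  fixes \<Gamma> :: "(complex ^ 'n ^ 'n) set"
  assumes \<Gamma>: "subgroup \<Gamma> GL" "closedin (top_of_set (carrier GL)) \<Gamma>" and conn: "connected \<Gamma>"
  shows "\<Gamma> \<subseteq> generate GL (matrix_exp ` cLie \<Gamma>)"
proof -
  let ?N = "generate GL (matrix_exp ` cLie \<Gamma>)"
  note N = subgroup_generate_exp[of "cLie \<Gamma>"]
  note G = subgroup_GL_D[OF \<Gamma>(1)]
  obtain P where P: "bounded_linear P" "\<And>x. P x \<in> cLie \<Gamma>" "\<And>x. x \<in> cLie \<Gamma> \<Longrightarrow> P x = x"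
    using obtain_projection[OF subspace_cLie[OF \<Gamma>]] by metis
  note P_lin = bounded_linear.linear[OF P(1)]
  define \<phi> where "\<phi> v = matrix_exp (P v) ** matrix_exp (v - P v)" for v
  have P0: "P 0 = 0" using linear_0[OF P_lin] .
  have cont: "continuous_on UNIV \<phi>"
    unfolding \<phi>_def by (intro continuous_intros bounded_linear.continuous_on[OF P(1)])
  have der: "(\<phi> has_derivative (\<lambda>v. v)) (at 0)"
  proof -
    have dP: "(P has_derivative P) (at 0)" using bounded_linear.has_derivative[OF P(1) has_derivative_ident] .
    have e1: "((\<lambda>v. matrix_exp (P v)) has_derivative P) (at 0)"
      using has_derivative_compose[OF dP, of matrix_exp "\<lambda>v. v"] matrix_exp_has_derivative_0 P0 by simp
    have dQ: "((\<lambda>v. v - P v) has_derivative (\<lambda>v. v - P v)) (at 0)"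
      by (intro has_derivative_diff has_derivative_ident dP)
    have e2: "((\<lambda>v. matrix_exp (v - P v)) has_derivative (\<lambda>v. v - P v)) (at 0)"
      using has_derivative_compose[OF dQ, of matrix_exp "\<lambda>v. v"] matrix_exp_has_derivative_0 P0 by simp
    show ?thesis
      using has_derivative_matrix_mult[OF e1 e2] by (simp add: \<phi>_def[abs_def] P0)
  qed
  have "\<exists>n. \<forall>v. norm v < inverse (real (Suc n)) \<and> \<phi> v \<in> \<Gamma> \<longrightarrow> \<phi> v \<in> ?N"
  proof (rule ccontr)
    assume "\<not> ?thesis"
    then have "\<forall>n. \<exists>v. norm v < inverse (real (Suc n)) \<and> \<phi> v \<in> \<Gamma> \<and> \<phi> v \<notin> ?N" by blast
    then obtain v where v: "\<And>n. norm (v n) < inverse (real (Suc n))" "\<And>n. \<phi> (v n) \<in> \<Gamma>" "\<And>n. \<phi> (v n) \<notin> ?N"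
      by metis
    define C where "C n = v n - P (v n)" for n
    have expC: "matrix_exp (C n) \<in> \<Gamma>" for n
    proof -
      have "matrix_exp (- P (v n)) \<in> \<Gamma>"
        using cLie_exp[OF cLie_scaleR[OF P(2), of "-1"]] by simp
      then have "matrix_exp (- P (v n)) ** \<phi> (v n) \<in> \<Gamma>"
        using v G by blast
      then show ?thesis
        by (simp add: \<phi>_def C_def matrix_mul_assoc matrix_exp_minus_mult)
    qed
    have C0: "C n \<noteq> 0" for n
    proof
      assume "C n = 0"
      then have "\<phi> (v n) = matrix_exp (P (v n))" by (simp add: \<phi>_def C_def)
      then show False using v(3)[of n] generate_exp_incl[OF P(2)] by simp
    qed
    have v0: "v \<longlonglongrightarrow> 0"
      by (rule Lim_null_comparison[OF _ LIMSEQ_inverse_real_of_nat])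
         (use v(1) in \<open>auto intro!: always_eventually less_imp_le\<close>)
    have Clim: "C \<longlonglongrightarrow> 0"
    proof -
      have "(\<lambda>n. v n - P (v n)) \<longlonglongrightarrow> 0 - P 0"
        by (intro tendsto_diff v0 bounded_linear.tendsto[OF P(1)])
      then show ?thesis by (simp add: C_def[abs_def] P0)
    qed
    have "\<exists>l\<in>sphere 0 1. \<exists>r. strict_mono r \<and> ((\<lambda>n. C n /\<^sub>R norm (C n)) \<circ> r) \<longlonglongrightarrow> l"
      by (rule compact_sphere[of 0 1, unfolded compact_def, rule_format]) (auto simp: C0)
    then obtain l r where l: "norm l = 1" "strict_mono r" "(\<lambda>n. C (r n) /\<^sub>R norm (C (r n))) \<longlonglongrightarrow> l"
      by (auto simp: o_def)
    have Cr: "(\<lambda>n. C (r n)) \<longlonglongrightarrow> 0"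
      using LIMSEQ_subseq_LIMSEQ[OF Clim l(2)] by (simp add: o_def)
    have Crn: "(\<lambda>n. norm (C (r n))) \<longlonglongrightarrow> 0" using tendsto_norm_zero[OF Cr] .
    have "l \<in> cLie \<Gamma>"
    proof (rule cLie_if_tangent[OF \<Gamma> expC])
      show "(\<lambda>n. norm (C (r n))) \<longlonglongrightarrow> 0" by (rule Crn)
      show "norm (C (r n)) > 0" for n by (simp add: C0)
      have "(\<lambda>n. (matrix_exp (C (r n)) - mat 1 - C (r n)) /\<^sub>R norm (C (r n))) \<longlonglongrightarrow> 0"
      proof (rule Lim_null_comparison)
        let ?n1 = "norm (mat 1 :: complex ^ 'n ^ 'n)"
        show "\<forall>\<^sub>F n in sequentially. norm ((matrix_exp (C (r n)) - mat 1 - C (r n)) /\<^sub>R norm (C (r n)))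
            \<le> ?n1 * exp (norm (C (r n))) * norm (C (r n))"
        proof (intro always_eventually allI)
          fix n
          have "inverse (norm (C (r n))) * norm (matrix_exp (C (r n)) - mat 1 - C (r n))
             \<le> inverse (norm (C (r n))) * (?n1 * exp (norm (C (r n))) * (norm (C (r n)))\<^sup>2)"
            by (intro mult_left_mono matrix_exp_first_order) simp
          moreover have "inverse (norm (C (r n))) * (?n1 * exp (norm (C (r n))) * (norm (C (r n)))\<^sup>2)
             = ?n1 * exp (norm (C (r n))) * norm (C (r n))"
            using C0[of "r n"] by (simp add: power2_eq_square)
          ultimately show "norm ((matrix_exp (C (r n)) - mat 1 - C (r n)) /\<^sub>R norm (C (r n)))
            \<le> ?n1 * exp (norm (C (r n))) * norm (C (r n))"
            by simp
        qed
        have "(\<lambda>n. ?n1 * exp (norm (C (r n))) * norm (C (r n))) \<longlonglongrightarrow> ?n1 * exp 0 * 0"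
          by (intro tendsto_mult tendsto_const tendsto_exp Crn)
        then show "(\<lambda>n. ?n1 * exp (norm (C (r n))) * norm (C (r n))) \<longlonglongrightarrow> 0" by simp
      qed
      from tendsto_add[OF this l(3)]
      show "(\<lambda>n. (matrix_exp (C (r n)) - mat 1) /\<^sub>R norm (C (r n))) \<longlonglongrightarrow> l"
        by (simp flip: scaleR_add_right)
    qed
    then have "P l = l" by (rule P(3))
    moreover have "(\<lambda>n. P (C (r n) /\<^sub>R norm (C (r n)))) \<longlonglongrightarrow> P l"
      by (rule bounded_linear.tendsto[OF P(1) l(3)])
    moreover have "P (C (r n) /\<^sub>R norm (C (r n))) = 0" for n
      using P(3)[OF P(2)] by (simp add: C_def linear_cmul[OF P_lin] linear_diff[OF P_lin])
    ultimately have "l = 0"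
      by (simp add: LIMSEQ_const_iff)
    then show False using l(1) by simp
  qed
  then obtain n where n: "\<And>v. norm v < inverse (real (Suc n)) \<Longrightarrow> \<phi> v \<in> \<Gamma> \<Longrightarrow> \<phi> v \<in> ?N" by blast
  have "\<phi> 0 \<in> interior (\<phi> ` ball 0 (inverse (real (Suc n))))"
    by (rule sussmann_open_mapping[OF open_UNIV cont UNIV_I der bounded_linear_ident])
       (auto simp: o_def id_def interior_open)
  then have W: "mat 1 \<in> interior (\<phi> ` ball 0 (inverse (real (Suc n))))"
    by (simp add: \<phi>_def P0)
  show ?thesis
  proof (rule connected_subgroup_subset_if_nhd[OF \<Gamma>(1) N conn open_interior W])
    show "interior (\<phi> ` ball 0 (inverse (real (Suc n)))) \<inter> \<Gamma> \<subseteq> ?N"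
      using n interior_subset[of "\<phi> ` ball 0 (inverse (real (Suc n)))"] by auto
  qed
qed

section \<open>The Lie algebra of a generated subgroup\<close>

text \<open>The squared norm, damped by \<open>exp (- 2 * C * t)\<close>, is nonincreasing,
  nonnegative and starts at 0.\<close>

lemma gronwall_zero_nonneg:
  fixes z :: "real \<Rightarrow> 'a::real_inner"
  assumes z: "\<And>t. (z has_vector_derivative z' t) (at t)"
    and le: "\<And>t. norm (z' t) \<le> C * norm (z t)" and "z 0 = 0" "t \<ge> 0"
  shows "z t = 0"
proof -
  define u where "u t = (z t \<bullet> z t) * exp (- 2 * C * t)" for t
  have "\<exists>y. (u has_real_derivative y) (at x) \<and> y \<le> 0" for x
  proof (intro exI conjI)
    have "((\<lambda>t. z t \<bullet> z t) has_real_derivative (2 * (z x \<bullet> z' x))) (at x)"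
      using bounded_bilinear.has_vector_derivative[OF bounded_bilinear_inner z[of x] z[of x]]
      by (simp add: has_real_derivative_iff_has_vector_derivative inner_commute)
    then show "(u has_real_derivative (2 * (z x \<bullet> z' x)) * exp (- 2 * C * x) + (z x \<bullet> z x) * (exp (- 2 * C * x) * (- 2 * C))) (at x)"
      unfolding u_def by (auto intro!: derivative_eq_intros)
    have "z x \<bullet> z' x \<le> norm (z x) * norm (z' x)"
      by (rule norm_cauchy_schwarz)
    also have "\<dots> \<le> norm (z x) * (C * norm (z x))"
      by (intro mult_left_mono le) simp
    finally have "z x \<bullet> z' x - C * (z x \<bullet> z x) \<le> 0"
      by (simp add: dot_square_norm power2_eq_square mult_ac)
    then have "2 * exp (- 2 * C * x) * (z x \<bullet> z' x - C * (z x \<bullet> z x)) \<le> 0"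
      by (intro mult_nonneg_nonpos) auto
    then show "(2 * (z x \<bullet> z' x)) * exp (- 2 * C * x) + (z x \<bullet> z x) * (exp (- 2 * C * x) * (- 2 * C)) \<le> 0"
      by (simp add: algebra_simps)
  qed
  from DERIV_nonpos_imp_nonincreasing[OF \<open>t \<ge> 0\<close> this]
  have "u t \<le> 0" using \<open>z 0 = 0\<close> by (simp add: u_def)
  then have "z t \<bullet> z t \<le> 0" by (simp add: u_def mult_le_0_iff)
  then have "z t \<bullet> z t = 0" using inner_ge_zero by (rule antisym)
  then show ?thesis by simp
qed

lemma gronwall_zero:
  fixes z :: "real \<Rightarrow> 'a::real_inner"
  assumes z: "\<And>t. (z has_vector_derivative z' t) (at t)"
    and le: "\<And>t. norm (z' t) \<le> C * norm (z t)" and "z 0 = 0"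
  shows "z t = 0"
proof (cases "t \<ge> 0")
  case False
  have "((\<lambda>s. z (- s)) has_vector_derivative - z' (- s)) (at s)" for s
  proof -
    have "((\<lambda>s. - s :: real) has_vector_derivative -1) (at s)"
      by (auto intro!: derivative_eq_intros)
    from vector_diff_chain_at[OF this, of z "z' (- s)"] z show ?thesis by (simp add: o_def)
  qed
  from gronwall_zero_nonneg[OF this, of C "- t"] le \<open>z 0 = 0\<close> False show ?thesis
    by simp
qed (use gronwall_zero_nonneg[OF assms] in blast)

text \<open>The conjugates form a curve with derivative \<open>A ** y t - y t ** A\<close>. As
  bracketing with \<open>A\<close> preserves \<open>h\<close>, the component of the curve orthogonal
  to \<open>h\<close> satisfies a homogeneous linear estimate. Nothing is assumed about a closed
  group with Lie algebra \<open>h\<close>, so \<open>cLie_Ad\<close> does not serve here.\<close>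

lemma exp_conj_in_subspace:
  fixes h :: "(complex ^ 'n ^ 'n) set"
  assumes h: "subspace h" and br: "\<And>A B. A \<in> h \<Longrightarrow> B \<in> h \<Longrightarrow> A ** B - B ** A \<in> h"
    and A: "A \<in> h" and B: "B \<in> h"
  shows "matrix_exp A ** B ** matrix_exp (- A) \<in> h"
proof -
  obtain P where P: "bounded_linear P" "\<And>x. P x \<in> h" "\<And>x. x \<in> h \<Longrightarrow> P x = x"
    "\<And>x. norm (x - P x) \<le> norm x"
    using obtain_orthogonal_projection[OF h] by metis
  note Pl = bounded_linear.linear[OF P(1)]
  define y where "y t = matrix_exp (t *\<^sub>R A) ** B ** matrix_exp (t *\<^sub>R (- A))" for t
  define z where "z t = y t - P (y t)" for t
  have dy: "(y has_vector_derivative (A ** y t - y t ** A)) (at t)" for t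
  proof -
    have 1: "((\<lambda>t. matrix_exp (t *\<^sub>R A) ** B) has_vector_derivative A ** matrix_exp (t *\<^sub>R A) ** B) (at t)"
      using has_vector_derivative_matrix_mult[OF matrix_exp_has_vector_derivative[of A t UNIV] has_vector_derivative_const[of B]]
      by (simp add: matrix_mult_simps)
    from has_vector_derivative_matrix_mult[OF 1 matrix_exp_has_vector_derivative[of "- A" t UNIV]]
    show ?thesis
      using matrix_exp_scaleR_commute[of t "- A"]
      by (simp add: y_def[abs_def] matrix_mult_simps matrix_mul_assoc[symmetric])
  qed
  have dz: "(z has_vector_derivative (A ** y t - y t ** A) - P (A ** y t - y t ** A)) (at t)" for t
    unfolding z_def
    by (intro has_vector_derivative_diff dy bounded_linear.has_vector_derivative[OF P(1)])
  have eq: "(A ** y t - y t ** A) - P (A ** y t - y t ** A) = (A ** z t - z t ** A) - P (A ** z t - z t ** A)" for t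
  proof -
    have "A ** P (y t) - P (y t) ** A \<in> h" by (intro br A P)
    from P(3)[OF this] have "P (A ** P (y t) - P (y t) ** A) = A ** P (y t) - P (y t) ** A" .
    moreover have "A ** y t - y t ** A = (A ** P (y t) - P (y t) ** A) + (A ** z t - z t ** A)"
      by (simp add: z_def matrix_mult_simps)
    ultimately show ?thesis
      by (simp only: linear_add[OF Pl] add_diff_add) simp
  qed
  have bound: "norm ((A ** y t - y t ** A) - P (A ** y t - y t ** A)) \<le> (2 * norm A) * norm (z t)" for t
  proof -
    have "norm ((A ** z t - z t ** A) - P (A ** z t - z t ** A)) \<le> norm (A ** z t - z t ** A)"
      by (rule P(4))
    also have "\<dots> \<le> norm (A ** z t) + norm (z t ** A)"
      by (rule norm_triangle_ineq4)
    also have "\<dots> \<le> norm A * norm (z t) + norm (z t) * norm A"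
      by (intro add_mono norm_matrix_mult_le)
    finally show ?thesis unfolding eq by simp
  qed
  have "z 0 = 0" by (simp add: z_def y_def P(3)[OF B])
  from gronwall_zero[OF dz bound this, of 1] show ?thesis
    using P(2)[of "y 1"] by (simp add: z_def y_def)
qed

text \<open>Coordinates of the second kind. The parameter enters through inner products with the
  listed matrices, so it can range over the whole matrix space and leave its other components free
  for transversal coordinates.\<close>

primrec exp_prod :: "(complex ^ 'n ^ 'n) list \<Rightarrow> complex ^ 'n ^ 'n \<Rightarrow> complex ^ 'n ^ 'n" where
  "exp_prod [] v = mat 1"
| "exp_prod (X # Xs) v = matrix_exp ((v \<bullet> X) *\<^sub>R X) ** exp_prod Xs v"

text \<open>An explicit inverse, whose continuity is as immediate as that of the product
  itself.\<close>

primrec exp_prod_inv :: "(complex ^ 'n ^ 'n) list \<Rightarrow> complex ^ 'n ^ 'n \<Rightarrow> complex ^ 'n ^ 'n" where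
  "exp_prod_inv [] v = mat 1"
| "exp_prod_inv (X # Xs) v = exp_prod_inv Xs v ** matrix_exp (- ((v \<bullet> X) *\<^sub>R X))"

lemma exp_prod_inv: "exp_prod_inv Xs v ** exp_prod Xs v = mat 1" "exp_prod Xs v ** exp_prod_inv Xs v = mat 1"
proof -
  show "exp_prod_inv Xs v ** exp_prod Xs v = mat 1"
  proof (induction Xs)
    case (Cons X Xs)
    have "exp_prod_inv (X # Xs) v ** exp_prod (X # Xs) v
      = exp_prod_inv Xs v ** (matrix_exp (- ((v \<bullet> X) *\<^sub>R X)) ** matrix_exp ((v \<bullet> X) *\<^sub>R X)) ** exp_prod Xs v"
      by (simp add: matrix_mul_assoc)
    then show ?case by (simp add: matrix_exp_minus_mult Cons)
  qed simp
  then show "exp_prod Xs v ** exp_prod_inv Xs v = mat 1"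
    by (simp add: matrix_left_right_inverse)
qed

lemma exp_prod_0 [simp]: "exp_prod Xs 0 = mat 1"
  by (induction Xs) auto

lemma continuous_on_exp_prod:
  "continuous_on S f \<Longrightarrow> continuous_on S (\<lambda>x. exp_prod Xs (f x))"
  "continuous_on S f \<Longrightarrow> continuous_on S (\<lambda>x. exp_prod_inv Xs (f x))"
  by (induction Xs) (auto intro!: continuous_intros)

lemma exp_prod_conj_in_subspace:
  assumes st: "\<forall>A\<in>h. \<forall>B\<in>h. matrix_exp A ** B ** matrix_exp (- A) \<in> h"
    and h: "subspace h" and Xs: "set Xs \<subseteq> h" and Z: "Z \<in> h"
  shows "exp_prod Xs v ** Z ** exp_prod_inv Xs v \<in> h" "exp_prod_inv Xs v ** Z ** exp_prod Xs v \<in> h"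
  using Xs Z
proof (induction Xs arbitrary: Z)
  case (Cons X Xs)
  have X: "(v \<bullet> X) *\<^sub>R X \<in> h" "- ((v \<bullet> X) *\<^sub>R X) \<in> h" if "set (X # Xs) \<subseteq> h"
    using that h by (auto intro: subspace_scale subspace_neg)
  {
    case 1
    then have "exp_prod Xs v ** Z ** exp_prod_inv Xs v \<in> h" using Cons by auto
    from st[rule_format, OF X(1)[OF 1(1)] this] show ?case by (simp add: matrix_mul_assoc)
  next
    case 2
    then have "matrix_exp (- ((v \<bullet> X) *\<^sub>R X)) ** Z ** matrix_exp ((v \<bullet> X) *\<^sub>R X) \<in> h"
      using st[rule_format, OF X(2)[OF 2(1)], of Z] by simp
    from Cons.IH(2)[OF _ this] 2 show ?case by (simp add: matrix_mul_assoc)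
  }
qed auto

text \<open>In the product rule the contribution of the tail gets conjugated by the first
  exponential. Conjugation by exponentials preserves \<open>h\<close>, so the derivative, translated
  back to the identity, keeps its values in \<open>h\<close>.\<close>

lemma exp_prod_has_derivative_ex:
  fixes h :: "(complex ^ 'n ^ 'n) set"
  assumes st: "\<forall>A\<in>h. \<forall>B\<in>h. matrix_exp A ** B ** matrix_exp (- A) \<in> h"
    and h: "subspace h" and Xs: "set Xs \<subseteq> h"
  shows "\<exists>H. (\<forall>v. (exp_prod Xs has_derivative (\<lambda>\<delta>. H v \<delta> ** exp_prod Xs v)) (at v)) \<and>
    (\<forall>v \<delta>. H v \<delta> \<in> h) \<and> (\<forall>\<delta>. continuous_on UNIV (\<lambda>v. H v \<delta>)) \<and> (\<forall>\<delta>. H 0 \<delta> = (\<Sum>X\<leftarrow>Xs. (\<delta> \<bullet> X) *\<^sub>R X))"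
  using Xs
proof (induction Xs)
  case Nil
  show ?case
    by (rule exI[of _ "\<lambda>v \<delta>. 0"]) (auto simp: matrix_mult_simps subspace_0[OF h] intro!: has_derivative_const)
next
  case (Cons X Xs)
  then obtain H where H: "\<And>v. (exp_prod Xs has_derivative (\<lambda>\<delta>. H v \<delta> ** exp_prod Xs v)) (at v)"
    "\<And>v \<delta>. H v \<delta> \<in> h" "\<And>\<delta>. continuous_on UNIV (\<lambda>v. H v \<delta>)" "\<And>\<delta>. H 0 \<delta> = (\<Sum>X\<leftarrow>Xs. (\<delta> \<bullet> X) *\<^sub>R X)"
    by auto
  have X: "X \<in> h" using Cons.prems by simp
  define e where "e v = matrix_exp ((v \<bullet> X) *\<^sub>R X)" for v
  define ei where "ei v = matrix_exp (- ((v \<bullet> X) *\<^sub>R X))" for v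
  have ei: "ei v ** e v = mat 1" for v by (simp add: e_def ei_def matrix_exp_minus_mult)
  have de: "(e has_derivative (\<lambda>\<delta>. ((\<delta> \<bullet> X) *\<^sub>R X) ** e v)) (at v)" for v
  proof -
    have 1: "((\<lambda>v. v \<bullet> X) has_derivative (\<lambda>\<delta>. \<delta> \<bullet> X)) (at v)"
      by (auto intro!: derivative_eq_intros)
    from has_derivative_compose[OF 1 matrix_exp_has_vector_derivative[of X "v \<bullet> X" UNIV, unfolded has_vector_derivative_def]]
    show ?thesis by (simp add: e_def[abs_def] matrix_mult_simps)
  qed
  define H' where "H' v \<delta> = (\<delta> \<bullet> X) *\<^sub>R X + e v ** H v \<delta> ** ei v" for v \<delta>
  show ?case
  proof (intro exI[of _ H'] conjI allI)
    fix v
    have "H' v \<delta> ** exp_prod (X # Xs) v = e v ** (H v \<delta> ** exp_prod Xs v) + ((\<delta> \<bullet> X) *\<^sub>R X) ** e v ** exp_prod Xs v" for \<delta>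
    proof -
      have "H' v \<delta> ** exp_prod (X # Xs) v = ((\<delta> \<bullet> X) *\<^sub>R X) ** e v ** exp_prod Xs v + e v ** H v \<delta> ** (ei v ** e v) ** exp_prod Xs v"
        by (simp add: H'_def e_def[symmetric] matrix_mult_simps matrix_mul_assoc)
      then show ?thesis by (simp add: ei matrix_mul_assoc add.commute)
    qed
    moreover have "exp_prod (X # Xs) = (\<lambda>v. e v ** exp_prod Xs v)"
      by (simp add: fun_eq_iff e_def)
    ultimately show "(exp_prod (X # Xs) has_derivative (\<lambda>\<delta>. H' v \<delta> ** exp_prod (X # Xs) v)) (at v)"
      using has_derivative_matrix_mult[OF de H(1), of v] by (simp only: matrix_mul_assoc)
  next
    fix v \<delta>
    have "e v ** H v \<delta> ** ei v \<in> h"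
      unfolding e_def ei_def by (intro st[rule_format] H subspace_scale[OF h X])
    then show "H' v \<delta> \<in> h"
      unfolding H'_def by (intro subspace_add subspace_scale h X)
  next
    fix \<delta>
    show "continuous_on UNIV (\<lambda>v. H' v \<delta>)"
      unfolding H'_def e_def ei_def by (intro continuous_intros H)
    show "H' 0 \<delta> = (\<Sum>X\<leftarrow>X # Xs. (\<delta> \<bullet> X) *\<^sub>R X)"
      by (simp add: H'_def e_def ei_def H(4))
  qed
qed

lemma exp_prod_has_derivative:
  fixes h :: "(complex ^ 'n ^ 'n) set"
  assumes st: "\<forall>A\<in>h. \<forall>B\<in>h. matrix_exp A ** B ** matrix_exp (- A) \<in> h"
    and h: "subspace h" and Xs: "set Xs \<subseteq> h"
  obtains H where "\<And>v. (exp_prod Xs has_derivative (\<lambda>\<delta>. H v \<delta> ** exp_prod Xs v)) (at v)"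
    "\<And>v \<delta>. H v \<delta> \<in> h" "\<And>\<delta>. continuous_on UNIV (\<lambda>v. H v \<delta>)"
    "\<And>\<delta>. H 0 \<delta> = (\<Sum>X\<leftarrow>Xs. (\<delta> \<bullet> X) *\<^sub>R X)"
proof -
  from exp_prod_has_derivative_ex[OF assms] obtain H where
    H: "(\<forall>v. (exp_prod Xs has_derivative (\<lambda>\<delta>. H v \<delta> ** exp_prod Xs v)) (at v)) \<and>
      (\<forall>v \<delta>. H v \<delta> \<in> h) \<and> (\<forall>\<delta>. continuous_on UNIV (\<lambda>v. H v \<delta>)) \<and> (\<forall>\<delta>. H 0 \<delta> = (\<Sum>X\<leftarrow>Xs. (\<delta> \<bullet> X) *\<^sub>R X))"
    by (rule exE)
  show ?thesis
  proof (rule that)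
    show "(exp_prod Xs has_derivative (\<lambda>\<delta>. H v \<delta> ** exp_prod Xs v)) (at v)" for v
      using H by simp
  qed (use H in simp_all)
qed

text \<open>Continuity of the derivative in each direction is, in finite dimension, continuity in
  operator norm, the form in which the inverse function theorem asks for it.\<close>

lemma inverse_function_continuous_derivative:
  fixes f :: "'a::euclidean_space \<Rightarrow> 'a"
  assumes U: "open U" "x0 \<in> U"
    and der: "\<And>x. x \<in> U \<Longrightarrow> (f has_derivative f' x) (at x)"
    and cont: "\<And>b. continuous_on U (\<lambda>x. f' x b)" and id: "\<And>v. f' x0 v = v"
  obtains U' V g g' where "U' \<subseteq> U" "open V" "f x0 \<in> V" "g (f x0) = x0"
    "\<And>y. y \<in> V \<Longrightarrow> g y \<in> U' \<and> f (g y) = y"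
    "\<And>y. y \<in> V \<Longrightarrow> (g has_derivative g' y) (at y)"
    "\<And>y v. y \<in> V \<Longrightarrow> f' (g y) (g' y v) = v"
proof -
  define F where "F x = Blinfun (f' x)" for x
  have F: "blinfun_apply (F x) = f' x" if "x \<in> U" for x
    unfolding F_def by (rule bounded_linear_Blinfun_apply) (rule has_derivative_bounded_linear[OF der[OF that]])
  have derF: "(f has_derivative blinfun_apply (F x)) (at x)" if "x \<in> U" for x
    using der[OF that] F[OF that] by simp
  have contF: "continuous_on U F"
  proof (rule continuous_on_blinfun_componentwise)
    fix b :: 'a
    show "continuous_on U (\<lambda>x. blinfun_apply (F x) b)"
      using cont[of b] by (rule continuous_on_eq) (simp add: F)
  qed
  have invF: "blinfun_compose id_blinfun (F x0) = id_blinfun"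
    by (rule blinfun_eqI) (simp add: F[OF U(2)] id)
  show ?thesis
  proof (rule inverse_function_theorem[OF U(1) derF contF U(2) invF])
    fix U' V g g'
    assume A: "U' \<subseteq> U" "x0 \<in> U'" "open V" "f x0 \<in> V" "homeomorphism U' V f g"
      "\<And>y. y \<in> V \<Longrightarrow> (g has_derivative g' y) (at y)"
      "\<And>y. y \<in> V \<Longrightarrow> g' y = inv_into UNIV (blinfun_apply (F (g y)))"
      "\<And>y. y \<in> V \<Longrightarrow> bij (blinfun_apply (F (g y)))"
    have gU: "g y \<in> U' \<and> f (g y) = y" if "y \<in> V" for y
      using homeomorphism_image2[OF A(5)] homeomorphism_apply2[OF A(5)] that by blast
    show ?thesis
    proof (rule that[OF A(1,3,4) homeomorphism_apply1[OF A(5,2)] gU A(6)])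
      fix y v assume y: "y \<in> V"
      have "F (g y) (g' y v) = v"
        unfolding A(7)[OF y] by (rule surj_f_inv_f[OF bij_is_surj[OF A(8)[OF y]]])
      moreover have "g y \<in> U" using gU[OF y] A(1) by blast
      ultimately show "f' (g y) (g' y v) = v" by (simp add: F)
    qed
  qed
qed

text \<open>In the chart \<open>v \<mapsto> exp_prod Xs v ** (mat 1 + C v)\<close>, with \<open>Xs\<close> an orthonormal basis of \<open>h\<close>
  and \<open>C\<close> the projection onto its complement, the transversal coordinate \<open>c\<close> is constant along the
  leaves of the foliation with tangent spaces \<open>h ** y\<close>.\<close>

lemma exp_chart:
  fixes h :: "(complex ^ 'n ^ 'n) set"
  assumes h: "subspace h"
    and br: "\<forall>A\<in>h. \<forall>B\<in>h. A ** B - B ** A \<in> h"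
  obtains Xs V c where "set Xs \<subseteq> h" "open V" "mat 1 \<in> V"
    "c (mat 1) = 0"
    "\<And>y. y \<in> V \<Longrightarrow> c y = 0 \<Longrightarrow> \<exists>v\<in>ball 0 1. y = exp_prod Xs v"
    "\<forall>\<gamma> Y. (\<forall>t\<in>{0..1}. \<gamma> t \<in> V \<and> Y t \<in> h \<and> (\<gamma> has_vector_derivative Y t ** \<gamma> t) (at t within {0..1})) \<longrightarrow> c (\<gamma> 1) = c (\<gamma> 0)"
    "\<And>X. ((\<lambda>t. c (matrix_exp (t *\<^sub>R X))) has_vector_derivative (0 :: complex ^ 'n ^ 'n)) (at 0) \<Longrightarrow> X \<in> h"
    "\<And>X. (\<lambda>t. c (matrix_exp (t *\<^sub>R X))) differentiable (at 0)"
proof -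
  obtain B P where P: "finite B" "B \<subseteq> h" "\<And>x. P x = (\<Sum>b\<in>B. (x \<bullet> b) *\<^sub>R b)"
    "bounded_linear P" "\<And>x. P x \<in> h" "\<And>x. x \<in> h \<Longrightarrow> P x = x"
    "\<And>x. norm (P x) \<le> norm x" "\<And>x. norm (x - P x) \<le> norm x"
    by (rule obtain_orthogonal_projection[OF h]) (rule that; assumption)
  note Pl = bounded_linear.linear[OF P(4)]
  have PP: "P (x - P x) = 0" for x using P(5,6) by (simp add: linear_diff[OF Pl])
  obtain Xs where Xs: "set Xs = B" "distinct Xs" using finite_distinct_list[OF P(1)] by blast
  have Xh: "set Xs \<subseteq> h" using Xs P(2) by simp
  have st: "\<forall>A\<in>h. \<forall>B\<in>h. matrix_exp A ** B ** matrix_exp (- A) \<in> h"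
    using exp_conj_in_subspace[OF h] br by blast
  obtain H where H: "\<And>v. (exp_prod Xs has_derivative (\<lambda>\<delta>. H v \<delta> ** exp_prod Xs v)) (at v)"
    "\<And>v \<delta>. H v \<delta> \<in> h" "\<And>\<delta>. continuous_on UNIV (\<lambda>v. H v \<delta>)"
    "\<And>\<delta>. H 0 \<delta> = (\<Sum>X\<leftarrow>Xs. (\<delta> \<bullet> X) *\<^sub>R X)"
    by (rule exp_prod_has_derivative[OF st h Xh]) (rule that; assumption)
  have H0: "H 0 \<delta> = P \<delta>" for \<delta>
    using H(4) Xs P(3) by (simp add: sum_list_distinct_conv_sum_set)
  let ?E = "exp_prod Xs" and ?Ei = "exp_prod_inv Xs"
  define \<phi> where "\<phi> v = ?E v ** (mat 1 + (v - P v))" for v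
  define d where "d v \<delta> = ?E v ** (\<delta> - P \<delta>) + H v \<delta> ** ?E v ** (mat 1 + (v - P v))" for v \<delta>
  have der: "(\<phi> has_derivative d v) (at v)" for v
  proof -
    have "((\<lambda>v. mat 1 + (v - P v)) has_derivative (\<lambda>\<delta>. 0 + (\<delta> - P \<delta>))) (at v)"
      by (intro has_derivative_add has_derivative_const has_derivative_diff has_derivative_ident
          bounded_linear.has_derivative[OF P(4)])
    from has_derivative_matrix_mult[OF H(1) this]
    show ?thesis unfolding \<phi>_def[abs_def] d_def[abs_def] by simp
  qed
  have contd: "continuous_on (ball 0 1) (\<lambda>v. d v i)" for i
    unfolding d_def
    by (intro continuous_intros continuous_on_exp_prod continuous_on_subset[OF H(3)]
        bounded_linear.continuous_on[OF P(4)]) auto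
  have d0: "d 0 \<delta> = \<delta>" for \<delta>
    by (simp add: d_def H0 linear_0[OF Pl])
  have z: "(0 :: complex ^ 'n ^ 'n) \<in> ball 0 1" by simp
  obtain U V g g' where U: "U \<subseteq> ball 0 1" "open V" "\<phi> 0 \<in> V" "g (\<phi> 0) = 0"
    "\<And>y. y \<in> V \<Longrightarrow> g y \<in> U \<and> \<phi> (g y) = y"
    "\<And>y. y \<in> V \<Longrightarrow> (g has_derivative g' y) (at y)"
    "\<And>y v. y \<in> V \<Longrightarrow> d (g y) (g' y v) = v"
    by (rule inverse_function_continuous_derivative[OF open_ball z der contd d0]) (rule that; assumption)
  have \<phi>0: "\<phi> 0 = mat 1" by (simp add: \<phi>_def linear_0[OF Pl])
  have g1: "g (mat 1) = 0" using U(4) \<phi>0 by simp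
  define c where "c y = g y - P (g y)" for y
  have gU: "g y \<in> U" "\<phi> (g y) = y" if "y \<in> V" for y
    using U(5)[OF that] by simp_all
  have cder: "((\<lambda>t. c (\<gamma> t)) has_vector_derivative (g' (\<gamma> t) w - P (g' (\<gamma> t) w))) (at t within S)"
    if "\<gamma> t \<in> V" "(\<gamma> has_vector_derivative w) (at t within S)" for \<gamma> t w S
  proof -
    have 1: "((\<lambda>t. g (\<gamma> t)) has_vector_derivative g' (\<gamma> t) w) (at t within S)"
      using vector_derivative_diff_chain_within[OF that(2) has_derivative_at_withinI[OF U(6)[OF that(1)]]]
      by (simp add: o_def)
    show ?thesis
      unfolding c_def by (intro has_vector_derivative_diff 1 bounded_linear.has_vector_derivative[OF P(4)])
  qed
  \<comment> \<open>For a velocity tangent to the leaf, the chart equation becomes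
    \<open>w - P w = Z ** (mat 1 + (v - P v))\<close> with \<open>Z\<close> in \<open>h\<close>.
    Applying \<open>P\<close> bounds the norm of \<open>Z\<close> by itself times that of
    \<open>v - P v\<close>, which is less than 1 because the chart was taken on the unit ball; so
    \<open>Z\<close> is 0.\<close>
  have key: "g' y (Y ** y) - P (g' y (Y ** y)) = 0" if y: "y \<in> V" and Y: "Y \<in> h" for y Y
  proof -
    define v where "v = g y"
    define w where "w = g' y (Y ** y)"
    have "d v w = Y ** y"
      using U(7)[OF y] by (simp add: v_def w_def)
    moreover have "y = ?E v ** (mat 1 + (v - P v))"
      using gU[OF y] by (simp add: v_def \<phi>_def)
    ultimately have "?E v ** (w - P w) + H v w ** ?E v ** (mat 1 + (v - P v)) = Y ** ?E v ** (mat 1 + (v - P v))"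
      by (simp only: d_def matrix_mul_assoc)
    then have eq: "?E v ** (w - P w) = (Y - H v w) ** ?E v ** (mat 1 + (v - P v))"
      by (simp only: matrix_mult_simps(7) eq_diff_eq)
    define Z where "Z = ?Ei v ** (Y - H v w) ** ?E v"
    have Zh: "Z \<in> h"
      unfolding Z_def by (intro exp_prod_conj_in_subspace[OF st h Xh] subspace_diff[OF h Y H(2)])
    have "?Ei v ** (?E v ** (w - P w)) = ?Ei v ** ((Y - H v w) ** ?E v ** (mat 1 + (v - P v)))"
      by (simp only: eq)
    then have eq2: "w - P w = Z ** (mat 1 + (v - P v))"
      by (simp only: matrix_mul_assoc exp_prod_inv Z_def matrix_mul_lid)
    then have "P (w - P w) = P (Z + Z ** (v - P v))"
      by (simp add: matrix_mult_simps)
    then have Zeq: "Z = - P (Z ** (v - P v))"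
      using PP P(6)[OF Zh] by (simp add: linear_add[OF Pl] eq_neg_iff_add_eq_0)
    have "norm (v - P v) < 1"
      using gU(1)[OF y] U(1) P(8)[of v] by (auto simp: v_def)
    moreover have "norm Z \<le> norm Z * norm (v - P v)"
    proof -
      have "norm Z \<le> norm (Z ** (v - P v))"
        by (subst Zeq) (simp only: norm_minus_cancel P(7))
      then show ?thesis using norm_matrix_mult_le[of Z "v - P v"] by linarith
    qed
    ultimately have "Z = 0"
      by (metis less_irrefl mult.right_neutral mult_strict_left_mono norm_eq_zero norm_ge_zero order.strict_trans2 order_le_less)
    then show ?thesis using eq2 by (simp add: w_def matrix_mult_simps)
  qed
  show ?thesis
  proof (rule that[OF Xh U(2)])
    show "mat 1 \<in> V" using U(3) \<phi>0 by simp
    show "c (mat 1) = 0" by (simp add: c_def g1 linear_0[OF Pl])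
    fix y assume y: "y \<in> V" "c y = 0"
    have "y = ?E (g y)" using gU(2)[OF y(1)] y(2) by (simp add: \<phi>_def c_def)
    moreover have "g y \<in> ball 0 1" using gU(1)[OF y(1)] U(1) by auto
    ultimately show "\<exists>v\<in>ball 0 1. y = exp_prod Xs v" by blast
  next
    show "\<forall>\<gamma> Y. (\<forall>t\<in>{0..1}. \<gamma> t \<in> V \<and> Y t \<in> h \<and> (\<gamma> has_vector_derivative Y t ** \<gamma> t) (at t within {0..1})) \<longrightarrow> c (\<gamma> 1) = c (\<gamma> 0)"
    proof (intro allI impI)
    fix \<gamma> :: "real \<Rightarrow> complex ^ 'n ^ 'n" and Y
    assume "\<forall>t\<in>{0..1}. \<gamma> t \<in> V \<and> Y t \<in> h \<and> (\<gamma> has_vector_derivative Y t ** \<gamma> t) (at t within {0..1})"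
    then have a: "\<And>t. t \<in> {0..1} \<Longrightarrow> \<gamma> t \<in> V \<and> Y t \<in> h \<and> (\<gamma> has_vector_derivative Y t ** \<gamma> t) (at t within {0..1})"
      by blast
    have "((\<lambda>t. c (\<gamma> t)) has_derivative (\<lambda>h. 0)) (at t within {0..1})" if "t \<in> {0..1}" for t
      using cder[of \<gamma> t "Y t ** \<gamma> t" "{0..1}"] a[OF that] key[of "\<gamma> t" "Y t"]
      by (simp add: has_vector_derivative_def)
    from has_derivative_zero_unique[OF _ this, of 1 0] show "c (\<gamma> 1) = c (\<gamma> 0)" by simp
    qed
  next
    fix X :: "complex ^ 'n ^ 'n"
    have V1: "mat 1 \<in> V" using U(3) \<phi>0 by simp
    have "g' (mat 1) v = v" for v
      using U(7)[OF V1] g1 d0 by simp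
    then have *: "((\<lambda>t. c (matrix_exp (t *\<^sub>R X))) has_vector_derivative X - P X) (at 0)"
      using cder[of "\<lambda>t. matrix_exp (t *\<^sub>R X)" 0 X UNIV] V1 matrix_exp_has_vector_derivative[of X 0 UNIV] by simp
    show "(\<lambda>t. c (matrix_exp (t *\<^sub>R X))) differentiable (at 0)"
      using * by (rule differentiableI_vector)
    assume "((\<lambda>t. c (matrix_exp (t *\<^sub>R X))) has_vector_derivative 0) (at 0)"
    with * have "X - P X = 0" by (rule vector_derivative_unique_at)
    then show "X \<in> h" using P(5)[of X] by simp
  qed
qed

section \<open>Uncountably many times on countably many leaves\<close>

lemma uncountable_pigeonhole:
  fixes T :: "real set" and S :: "'w \<Rightarrow> real set"
  assumes "countable W" "uncountable T" "T \<subseteq> (\<Union>w\<in>W. S w)"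
  obtains w where "w \<in> W" "infinite (T \<inter> S w)"
proof -
  have "T = (\<Union>w\<in>W. T \<inter> S w)" using assms(3) by blast
  then have "\<not> (\<forall>w\<in>W. countable (T \<inter> S w))"
    using assms(1,2) by (metis countable_UN)
  then show ?thesis using that countable_finite by blast
qed

text \<open>Bolzano-Weierstrass is applied to the graph of \<open>v\<close> over \<open>T\<close>,
  so that times and parameters become close together.\<close>

lemma infinite_graph_close_pair:
  fixes T :: "real set" and v :: "real \<Rightarrow> 'a::euclidean_space"
  assumes "infinite T" "T \<subseteq> cball 0 a" "\<And>t. t \<in> T \<Longrightarrow> norm (v t) \<le> b" "e > 0"
  obtains s t where "s \<in> T" "t \<in> T" "s \<noteq> t" "\<bar>s - t\<bar> < e" "norm (v s - v t) < e"
proof -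
  define Z where "Z = (\<lambda>t. (t, v t)) ` T"
  have "inj_on (\<lambda>t. (t, v t)) T" by (auto intro: inj_onI)
  then have inf: "infinite Z" using assms(1) by (simp add: Z_def finite_image_iff)
  have sub: "Z \<subseteq> cball 0 a \<times> cball 0 b" using assms by (auto simp: Z_def)
  have "compact (cball (0::real) a \<times> cball (0::'a) b)" by (intro compact_Times compact_cball)
  from Heine_Borel_imp_Bolzano_Weierstrass[OF this inf sub] obtain p where "p islimpt Z" by blast
  then have inf2: "infinite (Z \<inter> ball p (e / 2))"
    using assms(4) unfolding islimpt_eq_infinite_ball by simp
  obtain z1 where z1: "z1 \<in> Z \<inter> ball p (e / 2)" using infinite_imp_nonempty[OF inf2] by blast
  have "infinite (Z \<inter> ball p (e / 2) - {z1})" using inf2 by (rule infinite_remove)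
  then obtain z2 where z2: "z2 \<in> Z \<inter> ball p (e / 2) - {z1}" using infinite_imp_nonempty by blast
  have z: "z1 \<in> Z \<inter> ball p (e / 2)" "z2 \<in> Z \<inter> ball p (e / 2)" "z1 \<noteq> z2" using z1 z2 by auto
  then obtain s t where st: "s \<in> T" "t \<in> T" "z1 = (s, v s)" "z2 = (t, v t)" by (auto simp: Z_def)
  have d: "dist z1 z2 < e"
    using z dist_triangle_half_r[of p z1 e z2] by simp
  have "dist s t < e" "dist (v s) (v t) < e"
    using d dist_fst_le[of z1 z2] dist_snd_le[of z1 z2] st by auto
  then show ?thesis using st z that by (auto simp: dist_norm)
qed

text \<open>The head of the list is the rightmost factor: words are extended on the right, where the
  elements of the generated group are multiplied.\<close>

primrec exp_words :: "(complex ^ 'n ^ 'n) list \<Rightarrow> (complex ^ 'n ^ 'n) list \<Rightarrow> complex ^ 'n ^ 'n" where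
  "exp_words Xs [] = mat 1"
| "exp_words Xs (w # ws) = exp_words Xs ws ** exp_prod Xs w"

text \<open>Countably many translates of a leaf cover the generated group, so uncountably many points
  \<open>exp (t X)\<close> lie on one translate; two close ones force the transversal coordinate of \<open>X\<close> to vanish.\<close>

lemma cLie_generate_exp:
  fixes h :: "(complex ^ 'n ^ 'n) set"
  assumes h: "subspace h"
    and br: "\<forall>A\<in>h. \<forall>B\<in>h. A ** B - B ** A \<in> h"
    and X: "X \<in> cLie (generate GL (matrix_exp ` h))"
  shows "X \<in> h"
proof -
  have st: "\<forall>A\<in>h. \<forall>B\<in>h. matrix_exp A ** B ** matrix_exp (- A) \<in> h"
    using exp_conj_in_subspace[OF h] br by blast
  obtain Xs V c where Xs: "set Xs \<subseteq> h" and V: "open V" "mat 1 \<in> V" and c1: "c (mat 1) = 0"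
    and leaf: "\<And>y. y \<in> V \<Longrightarrow> c y = 0 \<Longrightarrow> \<exists>v\<in>ball 0 1. y = exp_prod Xs v"
    and path: "\<forall>\<gamma> Y. (\<forall>t\<in>{0..1}. \<gamma> t \<in> V \<and> Y t \<in> h \<and> (\<gamma> has_vector_derivative Y t ** \<gamma> t) (at t within {0..1})) \<longrightarrow> c (\<gamma> 1) = c (\<gamma> 0)"
    and tang: "\<And>X. ((\<lambda>t. c (matrix_exp (t *\<^sub>R X))) has_vector_derivative (0 :: complex ^ 'n ^ 'n)) (at 0) \<Longrightarrow> X \<in> h"
    and diff: "\<And>X. (\<lambda>t. c (matrix_exp (t *\<^sub>R X))) differentiable (at 0)"
    by (rule exp_chart[OF h br]) (rule that; assumption)
  let ?E = "exp_prod Xs" and ?Ei = "exp_prod_inv Xs"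
  obtain H where H: "\<And>v. (?E has_derivative (\<lambda>\<delta>. H v \<delta> ** ?E v)) (at v)" "\<And>v \<delta>. H v \<delta> \<in> h"
    by (rule exp_prod_has_derivative[OF st h Xs]) (rule that; assumption)
  \<comment> \<open>The point \<open>?E u ** matrix_exp A\<close> as seen from \<open>?E v\<close>.
    It is the identity for \<open>u = v\<close> and \<open>A = 0\<close>; uniform continuity on a
    compact set then gives one \<open>\<eta>\<close> for all \<open>v\<close>.\<close>
  define \<Theta> where "\<Theta> v u A = ?Ei v ** ?E u ** matrix_exp A" for v u A
  obtain \<rho> where \<rho>: "\<rho> > 0" "ball (mat 1) \<rho> \<subseteq> V" using V open_contains_ball by blast
  let ?b = "cball 0 1 :: (complex ^ 'n ^ 'n) set"
  have "uniformly_continuous_on (?b \<times> ?b \<times> ?b) (\<lambda>(v, u, A). \<Theta> v u A)"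
    unfolding \<Theta>_def split_def
    by (intro compact_uniformly_continuous compact_Times compact_cball continuous_intros continuous_on_exp_prod)
  then obtain \<eta>0 where \<eta>0: "\<eta>0 > 0"
    "\<And>p q. p \<in> ?b \<times> ?b \<times> ?b \<Longrightarrow> q \<in> ?b \<times> ?b \<times> ?b \<Longrightarrow> dist q p < \<eta>0 \<Longrightarrow>
      dist ((\<lambda>(v, u, A). \<Theta> v u A) q) ((\<lambda>(v, u, A). \<Theta> v u A) p) < \<rho>"
    using \<rho>(1) unfolding uniformly_continuous_on_def by metis
  define \<eta> where "\<eta> = min 1 (\<eta>0 / 2)"
  have \<eta>: "\<eta> > 0" using \<eta>0 by (simp add: \<eta>_def)
  have inV: "\<Theta> v u A \<in> V" if "v \<in> ?b" "u \<in> ?b" "norm (u - v) < \<eta>" "norm A < \<eta>" for v u A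
  proof -
    have "dist (v, u, A) (v, v, 0) \<le> dist (u, A) (v, 0)"
      by (simp add: dist_Pair_Pair)
    also have "\<dots> \<le> dist u v + dist A 0"
      by (simp add: dist_Pair_Pair sqrt_sum_squares_le_sum)
    also have "\<dots> < \<eta>0" using that by (simp add: dist_norm \<eta>_def)
    finally have "dist (\<Theta> v u A) (\<Theta> v v 0) < \<rho>"
      using \<eta>0(2)[of "(v, v, 0)" "(v, u, A)"] that by (auto simp: \<eta>_def)
    then show ?thesis using \<rho>(2) by (auto simp: \<Theta>_def exp_prod_inv dist_commute)
  qed
  \<comment> \<open>On the straight segment from \<open>(v, 0)\<close> to \<open>(u, A)\<close> the
    velocity, translated to the identity, stays in \<open>h\<close>, because conjugation by
    exponentials preserves \<open>h\<close>. Hence \<open>c\<close> keeps the value 0 that it has at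
    the identity.\<close>
  have c\<Theta>: "c (\<Theta> v u A) = 0" if v: "v \<in> ?b" and u: "u \<in> ?b" "norm (u - v) < \<eta>" and A: "A \<in> h" "norm A < \<eta>" for v u A
  proof -
    define p where "p t = v + t *\<^sub>R (u - v)" for t
    define e where "e t = ?E (p t)" for t
    define x where "x t = matrix_exp (t *\<^sub>R A)" for t
    define y where "y t = \<Theta> v (p t) (t *\<^sub>R A)" for t
    define Y where "Y t = ?Ei v ** H (p t) (u - v) ** ?E v + ?Ei v ** (e t ** A ** ?Ei (p t)) ** ?E v" for t
    have "c (y 1) = c (y 0)"
    proof (rule path[rule_format, of y Y], intro conjI)
      fix t :: real assume t: "t \<in> {0..1}"
      have le: "norm (t *\<^sub>R z) \<le> norm z" for z :: "complex ^ 'n ^ 'n"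
        using t by (simp add: mult_left_le_one_le)
      have "p t \<in> ?b"
      proof -
        have "p t = (1 - t) *\<^sub>R v + t *\<^sub>R u" by (simp add: p_def algebra_simps)
        then show ?thesis using convexD[OF convex_cball v u(1), of "1 - t" t] t by simp
      qed
      then show "y t \<in> V"
        unfolding y_def using le[of "u - v"] le[of A] u A
        by (intro inV v) (auto simp: p_def)
      have "e t ** A ** ?Ei (p t) \<in> h"
        unfolding e_def by (rule exp_prod_conj_in_subspace[OF st h Xs A(1)])
      then show "Y t \<in> h"
        unfolding Y_def by (intro subspace_add h exp_prod_conj_in_subspace[OF st h Xs] H)
      have dp: "(p has_vector_derivative (u - v)) (at t within {0..1})"
        unfolding p_def by (auto intro!: derivative_eq_intros)
      have de: "(e has_vector_derivative H (p t) (u - v) ** e t) (at t within {0..1})"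
        using vector_derivative_diff_chain_within[OF dp has_derivative_at_withinI[OF H(1)]]
        by (simp add: o_def e_def[abs_def])
      have dE: "((\<lambda>t. ?Ei v ** e t) has_vector_derivative ?Ei v ** (H (p t) (u - v) ** e t)) (at t within {0..1})"
        using has_vector_derivative_matrix_mult[OF has_vector_derivative_const de, of "?Ei v"]
        by (simp add: matrix_mult_simps)
      have "(y has_vector_derivative (?Ei v ** e t ** (A ** x t) + ?Ei v ** (H (p t) (u - v) ** e t) ** x t)) (at t within {0..1})"
        using has_vector_derivative_matrix_mult[OF dE matrix_exp_has_vector_derivative[of A t]]
        by (simp add: y_def[abs_def] \<Theta>_def e_def x_def)
      moreover have "Y t ** y t = ?Ei v ** e t ** (A ** x t) + ?Ei v ** (H (p t) (u - v) ** e t) ** x t"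
      proof -
        have "Y t ** y t = ?Ei v ** H (p t) (u - v) ** (?E v ** ?Ei v) ** e t ** x t
            + ?Ei v ** e t ** A ** (?Ei (p t) ** ((?E v ** ?Ei v) ** e t)) ** x t"
          by (simp add: Y_def y_def \<Theta>_def e_def x_def matrix_mult_simps matrix_mul_assoc)
        also have "\<dots> = ?Ei v ** H (p t) (u - v) ** e t ** x t + ?Ei v ** e t ** A ** x t"
          by (simp add: exp_prod_inv e_def)
        finally show ?thesis by (simp add: matrix_mul_assoc add.commute)
      qed
      ultimately show "(y has_vector_derivative Y t ** y t) (at t within {0..1})" by simp
    qed
    then show ?thesis by (simp add: y_def p_def \<Theta>_def exp_prod_inv c1)
  qed
  \<comment> \<open>Rounding leaf parameters to a countable dense set is what keeps the set
    \<open>W\<close> of translates countable.\<close>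
  obtain D where D: "countable D" "D \<subseteq> ?b" "?b \<subseteq> closure D" using separable by metis
  define W where "W = exp_words Xs ` lists D"
  define S where "S = {\<gamma> ** ?E v | \<gamma> v. \<gamma> \<in> W \<and> v \<in> ball 0 1}"
  \<comment> \<open>The parameter \<open>v\<close> is rounded to a new letter \<open>w\<close> of
    the word; what remains, \<open>\<Theta> w v A\<close>, lies on the leaf through the identity and
    is absorbed as some \<open>?E u\<close>.\<close>
  have small: "x ** matrix_exp A \<in> S" if x: "x \<in> S" and A: "A \<in> h" "norm A < \<eta>" for x A
  proof -
    obtain ws v where x: "x = exp_words Xs ws ** ?E v" "ws \<in> lists D" "v \<in> ball 0 1"
      using x by (auto simp: S_def W_def)
    have "v \<in> closure D" using x D by auto
    then obtain w where w: "w \<in> D" "dist w v < \<eta>" using \<eta> by (metis closure_approachable)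
    have wb: "w \<in> ?b" "v \<in> ?b" "norm (v - w) < \<eta>"
      using w D(2) x by (auto simp: dist_norm norm_minus_commute)
    obtain u where u: "u \<in> ball 0 1" "\<Theta> w v A = ?E u"
      using leaf[OF inV[OF wb A(2)] c\<Theta>[OF wb A]] by blast
    have "x ** matrix_exp A = exp_words Xs ws ** (?E w ** ?Ei w) ** ?E v ** matrix_exp A"
      using x by (simp add: exp_prod_inv)
    also have "\<dots> = exp_words Xs (w # ws) ** \<Theta> w v A"
      by (simp add: \<Theta>_def matrix_mul_assoc)
    finally have "x ** matrix_exp A = exp_words Xs (w # ws) ** ?E u" using u by simp
    moreover have "exp_words Xs (w # ws) \<in> W"
      unfolding W_def using x(2) w(1) by (intro imageI) auto
    ultimately show ?thesis using u unfolding S_def by blast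
  qed
  have pow: "x ** matrix_power (matrix_exp A) k \<in> S" if "x \<in> S" "A \<in> h" "norm A < \<eta>" for x A k
    using that small[OF _ that(2,3)] by (induction k) (auto simp: matrix_power_Suc2 matrix_mul_assoc)
  have big: "x ** matrix_exp A \<in> S" if x: "x \<in> S" and A: "A \<in> h" for x A
  proof -
    \<comment> \<open>An arbitrary exponential is the \<open>k\<close>-th power of one short enough
      for \<open>small\<close>.\<close>
    obtain k :: nat where k: "norm A / \<eta> < real k" using reals_Archimedean2 by blast
    have kpos: "real k > 0" using k \<eta> by (meson divide_nonneg_pos le_less_trans norm_ge_zero)
    have "norm ((1 / real k) *\<^sub>R A) < \<eta>"
      using k kpos \<eta> by (simp add: field_simps)
    from pow[OF x subspace_scale[OF h A] this, of k] show ?thesis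
      using matrix_exp_of_nat_scaleR[of k "(1 / real k) *\<^sub>R A"] kpos by simp
  qed
  have one: "mat 1 \<in> S"
  proof -
    have "exp_words Xs [] \<in> W" unfolding W_def by (rule imageI) simp
    moreover have "0 \<in> ball (0 :: complex ^ 'n ^ 'n) 1" by simp
    ultimately have "exp_words Xs [] ** ?E 0 \<in> S" unfolding S_def by blast
    then show ?thesis by simp
  qed
  have gen: "x ** g \<in> S" if "g \<in> generate GL (matrix_exp ` h)" "x \<in> S" for x g
    using that
  proof (induction arbitrary: x rule: generate.induct)
    case (inv g)
    then obtain A where A: "A \<in> h" "g = matrix_exp A" by blast
    have "inv\<^bsub>GL\<^esub> g = matrix_exp (- A)"
      using A by (simp add: inv_GL invertible_matrix_exp matrix_inv_eqI matrix_exp_minus_mult)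
    then show ?case using big[OF inv(2)] subspace_neg[OF h A(1)] by simp
  qed (auto simp: big matrix_mul_assoc)
  have "\<exists>\<gamma> v. \<gamma> \<in> W \<and> v \<in> ball 0 1 \<and> matrix_exp (t *\<^sub>R X) = \<gamma> ** ?E v" for t
    using gen[of "matrix_exp (t *\<^sub>R X)", OF _ one] X by (auto simp: S_def cLie_def)
  then obtain \<gamma> v where \<gamma>v: "\<And>t. \<gamma> t \<in> W" "\<And>t. v t \<in> ball 0 1" "\<And>t. matrix_exp (t *\<^sub>R X) = \<gamma> t ** ?E (v t)"
    by metis
  have "countable W" unfolding W_def using D(1) by simp
  moreover have "uncountable {0..1::real}" by (rule uncountable_closed_interval[THEN iffD2]) simp
  moreover have "{0..1} \<subseteq> (\<Union>g\<in>W. {t. \<gamma> t = g})" using \<gamma>v(1) by blast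
  ultimately obtain g where g: "infinite ({0..1} \<inter> {t. \<gamma> t = g})"
    by (rule uncountable_pigeonhole)
  \<comment> \<open>For two times on the same translate the common factor \<open>g\<close> cancels
    from the quotient of the exponentials, which becomes the transition
    \<open>\<Theta> (v t) (v s) 0\<close>.\<close>
  have close: "\<exists>\<tau>. \<tau> \<noteq> 0 \<and> \<bar>\<tau>\<bar> < e \<and> c (matrix_exp (\<tau> *\<^sub>R X)) = 0" if e: "e > 0" for e
  proof -
    have "min e \<eta> > 0" using e \<eta> by simp
    moreover have "{0..1} \<inter> {t. \<gamma> t = g} \<subseteq> cball 0 1" by auto
    moreover have "norm (v t) \<le> 1" for t using \<gamma>v(2)[of t] by simp
    ultimately obtain s t where "s \<in> {0..1} \<inter> {t. \<gamma> t = g}" "t \<in> {0..1} \<inter> {t. \<gamma> t = g}"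
      and st: "s \<noteq> t" "\<bar>s - t\<bar> < min e \<eta>" "norm (v s - v t) < min e \<eta>"
      using infinite_graph_close_pair[OF g, of 1 v 1 "min e \<eta>"] by blast
    then have g: "\<gamma> s = g" "\<gamma> t = g" by auto
    have "matrix_exp ((s - t) *\<^sub>R X) = matrix_exp (- (t *\<^sub>R X)) ** matrix_exp (s *\<^sub>R X)"
      using matrix_exp_add_scaleR[of "- t" s X] by simp
    also have "matrix_exp (s *\<^sub>R X) = matrix_exp (t *\<^sub>R X) ** ?Ei (v t) ** ?E (v s)"
    proof -
      have "matrix_exp (t *\<^sub>R X) ** ?Ei (v t) = g ** (?E (v t) ** ?Ei (v t))"
        using \<gamma>v(3)[of t] g by (simp add: matrix_mul_assoc)
      then show ?thesis using \<gamma>v(3)[of s] g by (simp add: exp_prod_inv)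
    qed
    finally have "matrix_exp ((s - t) *\<^sub>R X) = matrix_exp (- (t *\<^sub>R X)) ** matrix_exp (t *\<^sub>R X) ** \<Theta> (v t) (v s) 0"
      by (simp add: \<Theta>_def matrix_mul_assoc)
    then have "matrix_exp ((s - t) *\<^sub>R X) = \<Theta> (v t) (v s) 0"
      by (simp add: matrix_exp_minus_mult)
    moreover have "c (\<Theta> (v t) (v s) 0) = 0"
      using \<gamma>v(2)[of t] \<gamma>v(2)[of s] st \<eta> by (intro c\<Theta>) (auto simp: subspace_0[OF h])
    ultimately show ?thesis using st by (intro exI[of _ "s - t"]) auto
  qed
  obtain \<tau> where \<tau>: "\<And>n. \<tau> n \<noteq> 0" "\<And>n. \<bar>\<tau> n\<bar> < inverse (real (Suc n))" "\<And>n. c (matrix_exp (\<tau> n *\<^sub>R X)) = 0"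
    using close[of "inverse (real (Suc _))"] by (metis inverse_positive_iff_positive of_nat_0_less_iff zero_less_Suc)
  have \<tau>0: "\<tau> \<longlonglongrightarrow> 0"
    by (rule Lim_null_comparison[OF _ LIMSEQ_inverse_real_of_nat])
       (use \<tau>(2) in \<open>auto intro!: always_eventually less_imp_le\<close>)
  obtain w where w: "((\<lambda>t. c (matrix_exp (t *\<^sub>R X))) has_vector_derivative w) (at 0)"
    using diff[of X] by (metis vector_derivative_works)
  have "(\<lambda>n. 0) \<longlonglongrightarrow> w"
    using has_vector_derivative_sequentially[OF w \<tau>0 \<tau>(1)] \<tau>(3) by (simp add: c1)
  then have "w = 0" by (simp add: LIMSEQ_const_iff)
  then show ?thesis using w tang by blast
qed

section \<open>Polynomial functions of bounded degree\<close>

text \<open>Gaussian elimination: a nonzero coefficient at \<open>p\<close> in one equation removes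
  the unknown \<open>p\<close> from all the others, at the price of one equation and one
  unknown.\<close>

lemma homogeneous_system_nontrivial:
  fixes M :: "'b \<Rightarrow> 'a \<Rightarrow> real"
  assumes "finite B" "finite A" "card B < card A"
  shows "\<exists>x. (\<exists>a\<in>A. x a \<noteq> 0) \<and> (\<forall>b\<in>B. (\<Sum>a\<in>A. M b a * x a) = 0)"
  using assms
proof (induction B arbitrary: A M rule: finite_induct)
  case empty
  then obtain a where "a \<in> A" by fastforce
  then show ?case by (intro exI[of _ "\<lambda>_. 1"]) auto
next
  case (insert b B)
  show ?case
  proof (cases "\<forall>a\<in>A. M b a = 0")
    case True
    have "card B < card A" using insert.prems insert.hyps by simp
    from insert.IH[OF insert.prems(1) this, of M] show ?thesis using True by auto
  next
    case False
    then obtain p where p: "p \<in> A" "M b p \<noteq> 0" by blast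
    define A' where "A' = A - {p}"
    have A': "finite A'" "p \<notin> A'" "A = insert p A'" "card B < card A'"
      using insert p by (auto simp: A'_def)
    define M' where "M' b' a = M b' a - M b' p * M b a / M b p" for b' a
    from insert.IH[OF A'(1,4), of M'] obtain x where
      x: "\<exists>a\<in>A'. x a \<noteq> 0" "\<And>b'. b' \<in> B \<Longrightarrow> (\<Sum>a\<in>A'. M' b' a * x a) = 0" by auto
    define s where "s = (\<Sum>a\<in>A'. M b a * x a)"
    define y where "y a = (if a = p then - s / M b p else x a)" for a
    have sumA: "(\<Sum>a\<in>A. M b' a * y a) = M b' p * (- s / M b p) + (\<Sum>a\<in>A'. M b' a * x a)" for b'
    proof -
      have "(\<Sum>a\<in>A'. M b' a * y a) = (\<Sum>a\<in>A'. M b' a * x a)"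
        by (rule sum.cong) (use A'(2) in \<open>auto simp: y_def\<close>)
      then show ?thesis using A' by (simp add: y_def)
    qed
    have "(\<Sum>a\<in>A. M b a * y a) = 0"
      unfolding sumA using p by (simp add: s_def)
    moreover have "(\<Sum>a\<in>A. M b' a * y a) = 0" if "b' \<in> B" for b'
    proof -
      have "0 = (\<Sum>a\<in>A'. M b' a * x a - M b' p / M b p * (M b a * x a))"
        using x(2)[OF that] by (simp add: M'_def algebra_simps)
      also have "\<dots> = (\<Sum>a\<in>A'. M b' a * x a) - M b' p / M b p * s"
        by (simp add: sum_subtractf s_def sum_distrib_left)
      finally show ?thesis unfolding sumA by simp
    qed
    moreover have "\<exists>a\<in>A. y a \<noteq> 0"
      using x(1) A' by (auto simp: y_def)
    ultimately show ?thesis by blast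
  qed
qed

text \<open>The index is an upper bound for the degree. Building on bounded linear maps instead of
  coordinates makes the bound visibly stable under linear substitutions, such as multiplication by a
  fixed matrix.\<close>

inductive pdeg :: "nat \<Rightarrow> ('a::real_normed_vector \<Rightarrow> real) \<Rightarrow> bool" where
  const: "pdeg n (\<lambda>x. c)"
| lin: "bounded_linear f \<Longrightarrow> pdeg (Suc n) f"
| add: "\<lbrakk>pdeg n f; pdeg n g\<rbrakk> \<Longrightarrow> pdeg n (\<lambda>x. f x + g x)"
| mult: "\<lbrakk>pdeg m f; pdeg n g\<rbrakk> \<Longrightarrow> pdeg (m + n) (\<lambda>x. f x * g x)"

lemma pdeg_mono: "pdeg n f \<Longrightarrow> n \<le> m \<Longrightarrow> pdeg m f"
proof (induction arbitrary: m rule: pdeg.induct)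
  case (lin f n)
  then show ?case by (metis Suc_le_D pdeg.lin)
next
  case (mult m f n g k)
  have "pdeg (m + (k - m)) (\<lambda>x. f x * g x)"
    using mult by (intro pdeg.mult) auto
  then show ?case using mult.prems by simp
qed (auto intro: pdeg.intros)

lemma pdeg_cmult: "pdeg n f \<Longrightarrow> pdeg n (\<lambda>x. c * f x)"
  using pdeg.mult[OF pdeg.const[of 0 c]] by simp

lemma pdeg_sum: "(\<And>i. i \<in> I \<Longrightarrow> pdeg n (f i)) \<Longrightarrow> pdeg n (\<lambda>x. \<Sum>i\<in>I. f i x)"
  by (induction I rule: infinite_finite_induct) (auto intro: pdeg.intros)

lemma pdeg_power: "pdeg n f \<Longrightarrow> pdeg (n * k) (\<lambda>x. f x ^ k)"
  by (induction k) (auto intro: pdeg.intros)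

lemma pdeg_prod: "(\<And>i. i \<in> I \<Longrightarrow> pdeg n (f i)) \<Longrightarrow> pdeg (n * card I) (\<lambda>x. \<Prod>i\<in>I. f i x)"
  by (induction I rule: infinite_finite_induct) (auto intro: pdeg.intros)

lemma pdeg_compose_linear:
  assumes "pdeg n f" "bounded_linear A"
  shows "pdeg n (\<lambda>x. f (A x))"
  using assms(1)
proof induction
  case (lin f n)
  from bounded_linear_compose[OF lin assms(2)] show ?case by (rule pdeg.lin)
qed (auto intro: pdeg.intros)

text \<open>The direction \<open>A x\<close> depends linearly on the point, as for the vector field
  of a one-parameter group. It restores the degree that differentiation takes away, so spaces of
  bounded degree are preserved.\<close>

lemma pdeg_derivative:
  assumes "pdeg n f"
  shows "\<exists>f'. (\<forall>x. (f has_derivative f' x) (at x)) \<and> (\<forall>A. bounded_linear A \<longrightarrow> pdeg n (\<lambda>x. f' x (A x)))"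
  using assms
proof induction
  case (const n c)
  show ?case
    by (rule exI[of _ "\<lambda>x v. 0"]) (auto intro: pdeg.const)
next
  case (lin f n)
  show ?case
    by (rule exI[of _ "\<lambda>x. f"])
       (auto intro: pdeg.lin bounded_linear_imp_has_derivative bounded_linear_compose[OF lin] lin)
next
  case (add n f g)
  then obtain f' g' where f': "\<And>x. (f has_derivative f' x) (at x)" "\<And>A. bounded_linear A \<Longrightarrow> pdeg n (\<lambda>x. f' x (A x))"
    and g': "\<And>x. (g has_derivative g' x) (at x)" "\<And>A. bounded_linear A \<Longrightarrow> pdeg n (\<lambda>x. g' x (A x))" by blast
  show ?case
    by (rule exI[of _ "\<lambda>x v. f' x v + g' x v"])
       (auto intro: has_derivative_add f' g' pdeg.add)
next
  case (mult m f n g)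
  then obtain f' g' where f': "\<And>x. (f has_derivative f' x) (at x)" "\<And>A. bounded_linear A \<Longrightarrow> pdeg m (\<lambda>x. f' x (A x))"
    and g': "\<And>x. (g has_derivative g' x) (at x)" "\<And>A. bounded_linear A \<Longrightarrow> pdeg n (\<lambda>x. g' x (A x))" by blast
  show ?case
  proof (intro exI[of _ "\<lambda>x v. f x * g' x v + f' x v * g x"] conjI allI impI)
    show "((\<lambda>x. f x * g x) has_derivative (\<lambda>v. f x * g' x v + f' x v * g x)) (at x)" for x
      by (rule has_derivative_mult[OF f'(1) g'(1)])
    fix A :: "'a \<Rightarrow> 'a" assume A: "bounded_linear A"
    show "pdeg (m + n) (\<lambda>x. f x * g' x (A x) + f' x (A x) * g x)"
      by (rule pdeg.add[OF pdeg.mult[OF mult.hyps(1) g'(2)[OF A]] pdeg.mult[OF f'(2)[OF A] mult.hyps(2)]])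
  qed
qed

lemma pdeg_has_derivative:
  assumes "pdeg n f"
  shows "(f has_derivative frechet_derivative f (at x)) (at x)"
  using pdeg_derivative[OF assms] by (metis differentiable_def frechet_derivative_works)

lemma pdeg_frechet_derivative:
  assumes "pdeg n f" "bounded_linear A"
  shows "pdeg n (\<lambda>x. frechet_derivative f (at x) (A x))"
proof -
  from pdeg_derivative[OF assms(1)] obtain f' where
    f': "(\<forall>x. (f has_derivative f' x) (at x)) \<and> (\<forall>A. bounded_linear A \<longrightarrow> pdeg n (\<lambda>x. f' x (A x)))" by (rule exE)
  then have "frechet_derivative f (at x) = f' x" for x
    using frechet_derivative_at[of f "f' x" x] by simp
  then show ?thesis using f' assms(2) by simp
qed

lemma pdeg_continuous_on: "pdeg n f \<Longrightarrow> continuous_on S f"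
  by (rule continuous_at_imp_continuous_on) (simp add: has_derivative_continuous[OF pdeg_has_derivative])

definition box_monomial :: "('a::euclidean_space \<Rightarrow> nat) \<Rightarrow> 'a \<Rightarrow> real" where
  "box_monomial \<alpha> x = (\<Prod>b\<in>Basis. (x \<bullet> b) ^ \<alpha> b)"

text \<open>Bounding each exponent separately is coarser than bounding the total degree, but the
  number of monomials is then simply \<open>(n + 1) ^ DIM('a)\<close>.\<close>

definition box_span :: "nat \<Rightarrow> ('a::euclidean_space \<Rightarrow> real) \<Rightarrow> bool" where
  "box_span n f \<longleftrightarrow> (\<exists>a. \<forall>x. f x = (\<Sum>\<alpha>\<in>PiE Basis (\<lambda>_. {..n}). a \<alpha> * box_monomial \<alpha> x))"

lemma finite_box: "finite (PiE Basis (\<lambda>_ :: 'a::euclidean_space. {..n::nat}))"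
  by (intro finite_PiE) auto

lemma box_span_mono:
  fixes \<alpha> :: "'a::euclidean_space \<Rightarrow> nat"
  assumes "\<And>b. b \<in> Basis \<Longrightarrow> \<alpha> b \<le> n"
  shows "box_span n (box_monomial \<alpha>)"
proof -
  have "box_monomial \<alpha> x = (\<Sum>\<beta>\<in>PiE Basis (\<lambda>_. {..n}). (if \<beta> = restrict \<alpha> Basis then 1 else 0) * box_monomial \<beta> x)" for x
  proof -
    have "(\<Sum>\<beta>\<in>PiE Basis (\<lambda>_. {..n}). (if \<beta> = restrict \<alpha> Basis then 1 else 0) * box_monomial \<beta> x)
      = (\<Sum>\<beta>\<in>PiE Basis (\<lambda>_. {..n}). if \<beta> = restrict \<alpha> Basis then box_monomial \<beta> x else 0)"
      by (rule sum.cong) auto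
    also have "\<dots> = box_monomial (restrict \<alpha> Basis) x"
      using assms by (simp add: finite_box restrict_PiE_iff)
    finally show ?thesis by (simp add: box_monomial_def)
  qed
  then show ?thesis unfolding box_span_def by (intro exI allI)
qed

lemma box_span_sum:
  assumes "finite I" "\<And>i. i \<in> I \<Longrightarrow> box_span n (f i)"
  shows "box_span n (\<lambda>x. \<Sum>i\<in>I. c i * f i x)"
proof -
  obtain a where a: "\<And>i x. i \<in> I \<Longrightarrow> f i x = (\<Sum>\<alpha>\<in>PiE Basis (\<lambda>_. {..n}). a i \<alpha> * box_monomial \<alpha> x)"
    using assms(2) unfolding box_span_def by metis
  have "(\<Sum>i\<in>I. c i * f i x) = (\<Sum>\<alpha>\<in>PiE Basis (\<lambda>_. {..n}). (\<Sum>i\<in>I. c i * a i \<alpha>) * box_monomial \<alpha> x)" for x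
  proof -
    have "(\<Sum>i\<in>I. c i * f i x) = (\<Sum>i\<in>I. \<Sum>\<alpha>\<in>PiE Basis (\<lambda>_. {..n}). c i * a i \<alpha> * box_monomial \<alpha> x)"
      by (rule sum.cong) (simp_all add: a sum_distrib_left mult.assoc)
    then show ?thesis by (subst (asm) sum.swap) (simp add: sum_distrib_right)
  qed
  then show ?thesis unfolding box_span_def by (intro exI allI)
qed

lemma pdeg_box_span:
  fixes f :: "'a::euclidean_space \<Rightarrow> real"
  assumes "pdeg n f"
  shows "box_span n f"
  using assms
proof induction
  case (const n c)
  have "box_span n (\<lambda>x. \<Sum>i\<in>{()}. c * box_monomial (\<lambda>_. 0) x)"
    by (intro box_span_sum box_span_mono) auto
  then show ?case by (simp add: box_monomial_def)
next
  case (lin f n)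
  define e where "e b = (\<lambda>b'. if b' = b then 1 else 0 :: nat)" for b :: 'a
  have e: "box_monomial (e b) x = x \<bullet> b" if "b \<in> Basis" for b x
  proof -
    have "box_monomial (e b) x = (\<Prod>b'\<in>Basis. if b' = b then x \<bullet> b' else 1)"
      unfolding box_monomial_def e_def by (rule prod.cong) auto
    then show ?thesis using that by simp
  qed
  have "box_span (Suc n) (\<lambda>x. \<Sum>b\<in>Basis. f b * box_monomial (e b) x)"
    by (intro box_span_sum box_span_mono) (auto simp: e_def)
  moreover have "f = (\<lambda>x. \<Sum>b\<in>Basis. f b * box_monomial (e b) x)"
  proof
    fix x
    have "f x = f (\<Sum>b\<in>Basis. (x \<bullet> b) *\<^sub>R b)" by (simp add: euclidean_representation)
    also have "\<dots> = (\<Sum>b\<in>Basis. (x \<bullet> b) * f b)"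
      using bounded_linear.linear[OF lin] by (simp add: linear_sum linear_cmul)
    finally show "f x = (\<Sum>b\<in>Basis. f b * box_monomial (e b) x)" by (simp add: e mult.commute)
  qed
  ultimately show ?case by simp
next
  case (add n f g)
  have "box_span n (\<lambda>x. \<Sum>i\<in>{True, False}. 1 * (if i then f else g) x)"
    by (intro box_span_sum) (use add in auto)
  then show ?case by simp
next
  case (mult m f n g)
  obtain a where a: "\<And>x. f x = (\<Sum>\<alpha>\<in>PiE Basis (\<lambda>_. {..m}). a \<alpha> * box_monomial \<alpha> x)"
    using mult.IH(1) unfolding box_span_def by blast
  obtain b where b: "\<And>x. g x = (\<Sum>\<alpha>\<in>PiE Basis (\<lambda>_. {..n}). b \<alpha> * box_monomial \<alpha> x)"
    using mult.IH(2) unfolding box_span_def by blast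
  let ?I = "PiE Basis (\<lambda>_::'a. {..m}) \<times> PiE Basis (\<lambda>_::'a. {..n})"
  have "box_span (m + n) (\<lambda>x. \<Sum>i\<in>?I. (a (fst i) * b (snd i)) * box_monomial (\<lambda>c. fst i c + snd i c) x)"
    by (intro box_span_sum box_span_mono) (auto simp: finite_box PiE_iff intro!: add_mono)
  moreover have "f x * g x = (\<Sum>i\<in>?I. (a (fst i) * b (snd i)) * box_monomial (\<lambda>c. fst i c + snd i c) x)" for x
    unfolding a b sum_product sum.cartesian_product
    by (rule sum.cong) (auto simp: box_monomial_def power_add prod.distrib)
  ultimately show ?case by presburger
qed

lemma pdeg_family_dependent:
  fixes \<phi> :: "'i \<Rightarrow> 'a::euclidean_space \<Rightarrow> real"
  assumes "finite I" "\<And>i. i \<in> I \<Longrightarrow> pdeg n (\<phi> i)" "(n + 1) ^ DIM('a) < card I"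
  obtains \<kappa> where "\<exists>i\<in>I. \<kappa> i \<noteq> 0" "\<And>x. (\<Sum>i\<in>I. \<kappa> i * \<phi> i x) = 0"
proof -
  let ?B = "PiE Basis (\<lambda>_ :: 'a. {..n})"
  obtain a where a: "\<And>i x. i \<in> I \<Longrightarrow> \<phi> i x = (\<Sum>\<alpha>\<in>?B. a i \<alpha> * box_monomial \<alpha> x)"
    using pdeg_box_span[OF assms(2)] unfolding box_span_def by metis
  have "card ?B = (n + 1) ^ DIM('a)" by (simp add: card_PiE)
  then obtain \<kappa> where \<kappa>: "\<exists>i\<in>I. \<kappa> i \<noteq> 0" "\<And>\<alpha>. \<alpha> \<in> ?B \<Longrightarrow> (\<Sum>i\<in>I. a i \<alpha> * \<kappa> i) = 0"
    using homogeneous_system_nontrivial[OF finite_box assms(1), of n "\<lambda>\<alpha> i. a i \<alpha>"] assms(3) by auto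
  have "(\<Sum>i\<in>I. \<kappa> i * \<phi> i x) = 0" for x
  proof -
    have "(\<Sum>i\<in>I. \<kappa> i * \<phi> i x) = (\<Sum>i\<in>I. \<Sum>\<alpha>\<in>?B. a i \<alpha> * \<kappa> i * box_monomial \<alpha> x)"
      by (rule sum.cong) (simp_all add: a sum_distrib_left mult_ac)
    also have "\<dots> = (\<Sum>\<alpha>\<in>?B. (\<Sum>i\<in>I. a i \<alpha> * \<kappa> i) * box_monomial \<alpha> x)"
      by (subst sum.swap) (simp add: sum_distrib_right)
    finally show ?thesis using \<kappa>(2) by simp
  qed
  with \<kappa>(1) show ?thesis by (rule that)
qed

text \<open>Independent subfamilies have bounded size by \<open>pdeg_family_dependent\<close>, so a
  largest one exists, and it spans.\<close>

lemma finite_spanning_family: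
  fixes W :: "('a::euclidean_space \<Rightarrow> real) set"
  assumes W: "\<And>f. f \<in> W \<Longrightarrow> pdeg n f"
  obtains F where "finite F" "F \<subseteq> W"
    "\<And>f. f \<in> W \<Longrightarrow> \<exists>c. \<forall>x. f x = (\<Sum>g\<in>F. c g * g x)"
proof -
  define indep where "indep F \<longleftrightarrow> finite F \<and> F \<subseteq> W \<and> (\<forall>c. (\<forall>x. (\<Sum>g\<in>F. c g * g x) = 0) \<longrightarrow> (\<forall>g\<in>F. c g = 0))"
    for F :: "('a \<Rightarrow> real) set"
  have bound: "card F \<le> (n + 1) ^ DIM('a)" if F: "indep F" for F
  proof (rule ccontr)
    assume "\<not> ?thesis"
    then have less: "(n + 1) ^ DIM('a) < card F" by simp
    have fin: "finite F" and sub: "F \<subseteq> W" using F unfolding indep_def by blast+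
    have p: "pdeg n g" if "g \<in> F" for g using sub that W by blast
    obtain \<kappa> where "\<exists>i\<in>F. \<kappa> i \<noteq> 0" "\<And>x. (\<Sum>i\<in>F. \<kappa> i * i x) = 0"
      by (rule pdeg_family_dependent[OF fin _ less, of "\<lambda>g. g"]) (rule p, assumption, rule that, assumption+)
    then show False using F unfolding indep_def by blast
  qed
  have "indep {}" by (simp add: indep_def)
  then have ne: "card ` Collect indep \<noteq> {}" by blast
  have fin: "finite (card ` Collect indep)"
    by (rule finite_subset[of _ "{..(n + 1) ^ DIM('a)}"]) (use bound in auto)
  define k where "k = Max (card ` Collect indep)"
  have k: "\<exists>F. indep F \<and> card F = k" "\<And>F. indep F \<Longrightarrow> card F \<le> k"
    using Max_in[OF fin ne] Max_ge[OF fin] by (auto simp: k_def)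
  from k(1) obtain F where F: "indep F" "card F = k" by blast
  show ?thesis
  proof (rule that)
    show "finite F" "F \<subseteq> W" using F by (auto simp: indep_def)
    fix f assume f: "f \<in> W"
    show "\<exists>c. \<forall>x. f x = (\<Sum>g\<in>F. c g * g x)"
    proof (cases "f \<in> F")
      case True
      have "f x = (\<Sum>g\<in>F. (if g = f then 1 else 0) * g x)" for x
      proof -
        have "(\<Sum>g\<in>F. (if g = f then 1 else 0) * g x) = (\<Sum>g\<in>F. if g = f then g x else 0)"
          by (rule sum.cong) auto
        then show ?thesis using True \<open>finite F\<close> by simp
      qed
      then show ?thesis by (intro exI allI)
    next
      case False
      have "card (insert f F) = Suc k" using False \<open>finite F\<close> F by simp
      then have "\<not> indep (insert f F)" using k(2)[of "insert f F"] by auto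
      then obtain c where c: "\<And>x. (\<Sum>g\<in>insert f F. c g * g x) = 0" "\<exists>g\<in>insert f F. c g \<noteq> 0"
        using f \<open>finite F\<close> \<open>F \<subseteq> W\<close> by (auto simp: indep_def)
      have c1: "c f * f x + (\<Sum>g\<in>F. c g * g x) = 0" for x
        using c(1)[of x] False \<open>finite F\<close> by simp
      have "c f \<noteq> 0"
      proof
        assume "c f = 0"
        then have "\<forall>g\<in>F. c g = 0" using c1 F(1) unfolding indep_def by auto
        with \<open>c f = 0\<close> c(2) show False by auto
      qed
      then have "f x = (\<Sum>g\<in>F. (- c g / c f) * g x)" for x
      proof -
        have "(\<Sum>g\<in>F. (- c g / c f) * g x) = - (\<Sum>g\<in>F. c g * g x) / c f"
          by (simp add: sum_negf sum_divide_distrib)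
        also have "\<dots> = f x" using c1[of x] \<open>c f \<noteq> 0\<close> by (simp add: field_simps)
        finally show ?thesis by simp
      qed
      then show ?thesis by (intro exI allI)
    qed
  qed
qed

section \<open>Tangent vectors of the Zariski closure\<close>

text \<open>The ideal of \<open>S\<close> over the reals, cut off at degree \<open>n\<close> so that
  it has finite dimension.\<close>

definition vanishing :: "nat \<Rightarrow> 'a::real_normed_vector set \<Rightarrow> ('a \<Rightarrow> real) set" where
  "vanishing n S = {f. pdeg n f \<and> (\<forall>x\<in>S. f x = 0)}"

lemma vanishing_mono: "n \<le> m \<Longrightarrow> vanishing n S \<subseteq> vanishing m S"
  by (auto simp: vanishing_def intro: pdeg_mono)

lemma frechet_derivative_compose_linear:
  fixes f :: "'b::euclidean_space \<Rightarrow> real" and A :: "'a::euclidean_space \<Rightarrow> 'b"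
  assumes "pdeg n f" "bounded_linear A"
  shows "frechet_derivative (\<lambda>x. f (A x)) (at x) = (\<lambda>v. frechet_derivative f (at (A x)) (A v))"
proof -
  have "(A has_derivative A) (at x)"
    by (rule bounded_linear_imp_has_derivative[OF assms(2)])
  from has_derivative_compose[OF this pdeg_has_derivative[OF assms(1)]]
  show ?thesis by (rule frechet_derivative_at[symmetric])
qed

lemma frechet_derivative_linear_combination:
  fixes f :: "'a::euclidean_space \<Rightarrow> real"
  assumes "\<And>g. g \<in> F \<Longrightarrow> pdeg n g" "\<And>x. f x = (\<Sum>g\<in>F. c g * g x)"
  shows "frechet_derivative f (at q) v = (\<Sum>g\<in>F. c g * frechet_derivative g (at q) v)"
proof -
  have eq: "f = (\<lambda>x. \<Sum>g\<in>F. c g * g x)" using assms(2) by (rule ext)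
  have d: "((\<lambda>x. \<Sum>g\<in>F. c g * g x) has_derivative (\<lambda>v. \<Sum>g\<in>F. c g * frechet_derivative g (at q) v)) (at q)"
    by (intro has_derivative_sum has_derivative_mult_right pdeg_has_derivative[OF assms(1)])
  show ?thesis unfolding eq frechet_derivative_at[OF d, symmetric] by (rule refl)
qed

lemma bounded_linear_matrix_mult:
  "bounded_linear (\<lambda>x :: 'a::real_normed_field ^ 'n ^ 'n. A ** x)"
  "bounded_linear (\<lambda>x :: 'a::real_normed_field ^ 'n ^ 'n. x ** A)"
  by (rule bounded_bilinear.bounded_linear_right[OF bounded_bilinear_matrix_mult])
     (rule bounded_bilinear.bounded_linear_left[OF bounded_bilinear_matrix_mult])

lemma vanishing_translate:
  fixes \<Gamma> :: "(complex ^ 'n ^ 'n) set"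
  assumes \<Gamma>: "\<And>x y. x \<in> \<Gamma> \<Longrightarrow> y \<in> \<Gamma> \<Longrightarrow> x ** y \<in> \<Gamma>" and f: "f \<in> vanishing n \<Gamma>" and k: "k \<in> \<Gamma>"
  shows "(\<lambda>x. f (x ** k)) \<in> vanishing n \<Gamma>" "(\<lambda>x. f (k ** x)) \<in> vanishing n \<Gamma>"
  using assms pdeg_compose_linear[OF _ bounded_linear_matrix_mult(2), of n f k]
    pdeg_compose_linear[OF _ bounded_linear_matrix_mult(1), of n f k]
  by (auto simp: vanishing_def)

text \<open>The flow \<open>t \<mapsto> exp (t X)\<close> differentiates polynomials by a derivation that preserves the degree
  filtration and the ideal of \<open>\<Gamma>\<close>, so the values at \<open>exp (t X)\<close> of the finitely many polynomials that
  span the degree \<open>n\<close> part of the ideal solve a homogeneous linear differential equation.\<close>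

lemma vanishing_matrix_exp:
  fixes \<Gamma> :: "(complex ^ 'n ^ 'n) set"
  assumes one: "mat 1 \<in> \<Gamma>" and mult: "\<And>x y. x \<in> \<Gamma> \<Longrightarrow> y \<in> \<Gamma> \<Longrightarrow> x ** y \<in> \<Gamma>"
    and X: "\<And>f. f \<in> vanishing n \<Gamma> \<Longrightarrow> frechet_derivative f (at (mat 1)) X = 0"
    and f: "f \<in> vanishing n \<Gamma>"
  shows "f (matrix_exp (t *\<^sub>R X)) = 0"
proof -
  define W where "W = vanishing n \<Gamma>"
  have pW: "pdeg n f" if "f \<in> W" for f using that by (simp add: W_def vanishing_def)
  obtain F where F: "finite F" "F \<subseteq> W" "\<And>f. f \<in> W \<Longrightarrow> \<exists>c. \<forall>x. f x = (\<Sum>g\<in>F. c g * g x)"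
    using finite_spanning_family[of W n] pW by blast
  define Lf where "Lf f x = frechet_derivative f (at x) (X ** x)" for f :: "complex ^ 'n ^ 'n \<Rightarrow> real" and x
  have LfW: "Lf f \<in> W" if fW: "f \<in> W" for f
  proof -
    have "pdeg n (Lf f)"
      unfolding Lf_def by (rule pdeg_frechet_derivative[OF pW[OF fW] bounded_linear_matrix_mult(1)])
    \<comment> \<open>This value is the derivative at the identity, in direction \<open>X\<close>,
      of the translate of \<open>f\<close> by \<open>k\<close>, which lies in the ideal again; the
      hypothesis on \<open>X\<close> applies to it.\<close>
    moreover have "Lf f k = 0" if k: "k \<in> \<Gamma>" for k
    proof -
      have "(\<lambda>x. f (x ** k)) \<in> vanishing n \<Gamma>"
        using vanishing_translate(1)[OF mult _ k] fW by (simp add: W_def)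
      from X[OF this] show ?thesis
        by (simp add: Lf_def frechet_derivative_compose_linear[OF pW[OF fW] bounded_linear_matrix_mult(2)])
    qed
    ultimately show ?thesis by (simp add: W_def vanishing_def)
  qed
  have "\<exists>c. \<forall>x. Lf g x = (\<Sum>k\<in>F. c k * k x)" if "g \<in> F" for g
    using F(3)[OF LfW] F(2) that by blast
  then obtain C where C: "\<And>g x. g \<in> F \<Longrightarrow> Lf g x = (\<Sum>k\<in>F. C g k * k x)"
    by metis
  define e where "e t = matrix_exp (t *\<^sub>R X)" for t
  \<comment> \<open>Gronwall is applied to one scalar, the sum of the squares of the spanning
    polynomials along the flow; \<open>C\<close> is the matrix of the derivation on them.\<close>
  define S where "S t = (\<Sum>g\<in>F. (g (e t))\<^sup>2)" for t
  define S' where "S' t = (\<Sum>g\<in>F. 2 * g (e t) * (\<Sum>k\<in>F. C g k * k (e t)))" for t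
  have dg: "((\<lambda>t. g (e t)) has_real_derivative (\<Sum>k\<in>F. C g k * k (e t))) (at t)" if g: "g \<in> F" for g t
  proof -
    have "(e has_vector_derivative X ** e t) (at t)"
      unfolding e_def by (rule matrix_exp_has_vector_derivative)
    moreover have "(g has_derivative frechet_derivative g (at (e t))) (at (e t) within range e)"
      using pdeg_has_derivative[OF pW] g F(2) by (blast intro: has_derivative_at_withinI)
    ultimately have "((g \<circ> e) has_vector_derivative Lf g (e t)) (at t)"
      unfolding Lf_def by (rule vector_derivative_diff_chain_within)
    then show ?thesis
      by (simp add: C[OF g] has_real_derivative_iff_has_vector_derivative o_def)
  qed
  have dS: "(S has_vector_derivative S' t) (at t)" for t
    unfolding has_real_derivative_iff_has_vector_derivative[symmetric] S_def S'_def
  proof (rule DERIV_sum)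
    fix g assume "g \<in> F"
    from DERIV_power[OF dg[OF this], of 2 t]
    show "((\<lambda>t. (g (e t))\<^sup>2) has_real_derivative 2 * g (e t) * (\<Sum>k\<in>F. C g k * k (e t))) (at t)"
      by (simp add: mult_ac)
  qed
  have S0: "S t \<ge> 0" for t by (simp add: S_def sum_nonneg)
  define c where "c = (\<Sum>g\<in>F. \<Sum>k\<in>F. \<bar>C g k\<bar>)"
  have le: "norm (S' t) \<le> (2 * c) * norm (S t)" for t
  proof -
    have sq: "(g (e t))\<^sup>2 \<le> S t" if "g \<in> F" for g
      unfolding S_def by (rule member_le_sum[OF that]) (use F in auto)
    have "\<bar>S' t\<bar> = \<bar>\<Sum>g\<in>F. \<Sum>k\<in>F. C g k * (2 * g (e t) * k (e t))\<bar>"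
      by (simp add: S'_def sum_distrib_left mult_ac)
    also have "\<dots> \<le> (\<Sum>g\<in>F. \<Sum>k\<in>F. \<bar>C g k\<bar> * (2 * S t))"
    proof (intro order_trans[OF sum_abs] sum_mono)
      fix g k assume gk: "g \<in> F" "k \<in> F"
      have "\<bar>2 * g (e t) * k (e t)\<bar> \<le> (g (e t))\<^sup>2 + (k (e t))\<^sup>2"
        using sum_squares_bound[of "\<bar>g (e t)\<bar>" "\<bar>k (e t)\<bar>"] by (simp add: abs_mult)
      also have "\<dots> \<le> 2 * S t" using sq[OF gk(1)] sq[OF gk(2)] by simp
      finally show "\<bar>C g k * (2 * g (e t) * k (e t))\<bar> \<le> \<bar>C g k\<bar> * (2 * S t)"
        unfolding abs_mult[of "C g k"] by (intro mult_left_mono) auto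
    qed
    also have "\<dots> = 2 * c * S t"
      by (simp add: c_def sum_distrib_right sum_distrib_left mult_ac)
    finally show ?thesis using S0[of t] by simp
  qed
  have "S 0 = 0"
    using F(2) one by (auto simp: S_def e_def W_def vanishing_def intro!: sum.neutral)
  from gronwall_zero[OF dS le this] have "S t = 0" .
  then have zero: "g (e t) = 0" if "g \<in> F" for g
    using that F(1) by (simp add: S_def sum_nonneg_eq_0_iff)
  obtain d where d: "\<And>x. f x = (\<Sum>g\<in>F. d g * g x)"
    using F(3)[of f] f by (auto simp: W_def)
  have "f (e t) = 0"
    unfolding d by (rule sum.neutral) (use zero in force)
  then show ?thesis by (simp add: e_def)
qed

text \<open>The spaces \<open>Z n\<close> of vectors at the identity annihilated by the ideal up to
  degree \<open>n\<close> decrease with \<open>n\<close>, so they are constant beyond a degree of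
  least dimension. Finitely many polynomials of that degree thus control all degrees
  \<open>m\<close>; translations from either side carry their common kernel at \<open>q\<close> into
  \<open>Z n\<close>.\<close>

lemma zariski_tangent:
  fixes \<Gamma> :: "(complex ^ 'n ^ 'n) set"
  assumes \<Gamma>: "subgroup \<Gamma> GL"
  obtains n F where "finite F" "F \<subseteq> vanishing n \<Gamma>"
    "\<And>q v t m f. q \<in> \<Gamma> \<Longrightarrow> \<forall>g\<in>F. frechet_derivative g (at q) v = 0 \<Longrightarrow> f \<in> vanishing m \<Gamma> \<Longrightarrow>
       f (matrix_exp (t *\<^sub>R (v ** matrix_inv q))) = 0 \<and> f (matrix_exp (t *\<^sub>R (matrix_inv q ** v))) = 0"
proof -
  note G = subgroup_GL_D[OF \<Gamma>]
  define Z where "Z n = {X. \<forall>f\<in>vanishing n \<Gamma>. frechet_derivative f (at (mat 1)) X = 0}" for n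
  have lin: "linear (frechet_derivative f (at q))" if "f \<in> vanishing n \<Gamma>" for f n q
    using pdeg_has_derivative[of n f q] that has_derivative_linear by (auto simp: vanishing_def)
  have subZ: "subspace (Z n)" for n
    by (rule subspaceI) (auto simp: Z_def linear_0[OF lin] linear_add[OF lin] linear_cmul[OF lin])
  have antiZ: "Z m \<subseteq> Z n" if "n \<le> m" for m n
    using vanishing_mono[OF that, of \<Gamma>] by (auto simp: Z_def)
  define n where "n = arg_min (\<lambda>n. dim (Z n)) (\<lambda>_. True)"
  have nmin: "dim (Z n) \<le> dim (Z m)" for m
    unfolding n_def by (rule arg_min_nat_le) simp
  have Zn: "X \<in> Z m" if "X \<in> Z n" for X m
  proof -
    let ?k = "max m n"
    have "Z ?k = Z n"
      using antiZ[of n ?k] nmin[of ?k] by (intro subspace_dim_equal subZ) auto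
    then show ?thesis using antiZ[of m ?k] that by auto
  qed
  obtain F where F: "finite F" "F \<subseteq> vanishing n \<Gamma>" "\<And>f. f \<in> vanishing n \<Gamma> \<Longrightarrow> \<exists>c. \<forall>x. f x = (\<Sum>g\<in>F. c g * g x)"
    using finite_spanning_family[of "vanishing n \<Gamma>" n] by (auto simp: vanishing_def)
  show ?thesis
  proof (rule that[OF F(1,2)])
    fix q v t m f
    assume q: "q \<in> \<Gamma>" and v: "\<forall>g\<in>F. frechet_derivative g (at q) v = 0" and f: "f \<in> vanishing m \<Gamma>"
    have all: "frechet_derivative g (at q) v = 0" if g: "g \<in> vanishing n \<Gamma>" for g
    proof -
      obtain c where c: "\<And>x. g x = (\<Sum>k\<in>F. c k * k x)" using F(3)[OF g] by blast
      have "frechet_derivative g (at q) v = (\<Sum>k\<in>F. c k * frechet_derivative k (at q) v)"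
        by (rule frechet_derivative_linear_combination[OF _ c, of n]) (use F(2) in \<open>auto simp: vanishing_def\<close>)
      then show ?thesis using v by simp
    qed
    have 1: "v ** matrix_inv q \<in> Z n"
      unfolding Z_def
    proof (intro CollectI ballI)
      fix g assume g: "g \<in> vanishing n \<Gamma>"
      have g': "(\<lambda>x. g (x ** matrix_inv q)) \<in> vanishing n \<Gamma>" "(\<lambda>x. g (x ** q)) \<in> vanishing n \<Gamma>"
        using vanishing_translate(1)[OF G(2) g] G(4)[OF q] q by auto
      have pg: "pdeg n (\<lambda>x. g (x ** matrix_inv q))" "pdeg n g" using g g' by (auto simp: vanishing_def)
      have "frechet_derivative (\<lambda>x. g (x ** matrix_inv q)) (at q) v = 0"
        by (rule all[OF g'(1)])
      then show "frechet_derivative g (at (mat 1)) (v ** matrix_inv q) = 0"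
        using frechet_derivative_compose_linear[OF pg(2) bounded_linear_matrix_mult(2), of "matrix_inv q" q] G(3)[OF q]
        by (simp add: matrix_inv_mult)
    qed
    have 2: "matrix_inv q ** v \<in> Z n"
      unfolding Z_def
    proof (intro CollectI ballI)
      fix g assume g: "g \<in> vanishing n \<Gamma>"
      have g': "(\<lambda>x. g (matrix_inv q ** x)) \<in> vanishing n \<Gamma>"
        using vanishing_translate(2)[OF G(2) g] G(4)[OF q] by auto
      have pg: "pdeg n g" using g by (auto simp: vanishing_def)
      have "frechet_derivative (\<lambda>x. g (matrix_inv q ** x)) (at q) v = 0"
        by (rule all[OF g'])
      then show "frechet_derivative g (at (mat 1)) (matrix_inv q ** v) = 0"
        using frechet_derivative_compose_linear[OF pg bounded_linear_matrix_mult(1), of "matrix_inv q" q] G(3)[OF q]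
        by (simp add: matrix_inv_mult)
    qed
    have exp0: "f (matrix_exp (t *\<^sub>R X)) = 0" if "X \<in> Z n" for X
      using vanishing_matrix_exp[OF G(1,2) _ f] Zn[OF that, of m] by (auto simp: Z_def)
    show "f (matrix_exp (t *\<^sub>R (v ** matrix_inv q))) = 0 \<and> f (matrix_exp (t *\<^sub>R (matrix_inv q ** v))) = 0"
      using exp0[OF 1] exp0[OF 2] by simp
  qed
qed

section \<open>Counting with polynomial relations\<close>

abbreviation exps :: "nat \<Rightarrow> 'i set \<Rightarrow> ('i \<Rightarrow> nat) set" where
  "exps s A \<equiv> PiE A (\<lambda>_. {..<s})"

lemma finite_exps: "finite A \<Longrightarrow> finite (exps s A)"
  by (rule finite_PiE) auto

lemma sum_exps_insert:
  fixes h :: "('i \<Rightarrow> nat) \<Rightarrow> real"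
  assumes "i \<notin> A"
  shows "(\<Sum>\<alpha>\<in>exps s (insert i A). h \<alpha>) = (\<Sum>k<s. \<Sum>\<alpha>\<in>exps s A. h (\<alpha>(i := k)))"
proof -
  have "(\<Sum>\<alpha>\<in>exps s (insert i A). h \<alpha>) = (\<Sum>(k, \<alpha>)\<in>{..<s} \<times> exps s A. h (\<alpha>(i := k)))"
    unfolding PiE_insert_eq
    by (subst sum.reindex) (use inj_combinator[OF assms] in \<open>auto simp: o_def split_def\<close>)
  then show ?thesis by (simp add: sum.cartesian_product)
qed

lemma poly_zero_on_interval:
  fixes c :: "nat \<Rightarrow> real"
  assumes "\<delta> > 0" "\<And>t. \<bar>t - t0\<bar> < \<delta> \<Longrightarrow> (\<Sum>k<s. c k * t ^ k) = 0" "k < s"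
  shows "c k = 0"
proof (rule ccontr)
  assume ne: "c k \<noteq> 0"
  obtain n where n: "s = Suc n" using assms(3) by (cases s) auto
  have "finite {t. (\<Sum>k\<le>n. c k * t ^ k) = 0}"
    using polyfun_finite_roots[of c n] ne assms(3) n by auto
  moreover have "{t0 <..< t0 + \<delta>} \<subseteq> {t. (\<Sum>k\<le>n. c k * t ^ k) = 0}"
    using assms(2) by (auto simp: n lessThan_Suc_atMost)
  ultimately have "finite {t0 <..< t0 + \<delta>}" by (rule rev_finite_subset)
  then show False using assms(1) infinite_Ioo[of t0 "t0 + \<delta>"] by simp
qed

text \<open>The variables are treated one at a time: with the others frozen, a polynomial in
  \<open>y i\<close> that vanishes on an interval has zero coefficients, and these are polynomials
  of the same kind in the remaining variables.\<close>

lemma poly_zero_on_box: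
  fixes \<kappa> :: "('i \<Rightarrow> nat) \<Rightarrow> real"
  assumes "finite A" "\<delta> > 0"
    and "\<And>y. (\<And>i. i \<in> A \<Longrightarrow> \<bar>y i - y0 i\<bar> < \<delta>) \<Longrightarrow> (\<Sum>\<alpha>\<in>exps s A. \<kappa> \<alpha> * (\<Prod>i\<in>A. y i ^ \<alpha> i)) = 0"
    and "\<alpha> \<in> exps s A"
  shows "\<kappa> \<alpha> = 0"
  using assms(1,3,4)
proof (induction A arbitrary: \<kappa> \<alpha> rule: finite_induct)
  case empty
  then show ?case by simp
next
  case (insert i A)
  have coeff: "(\<Sum>\<alpha>\<in>exps s A. \<kappa> (\<alpha>(i := k)) * (\<Prod>j\<in>A. y j ^ \<alpha> j)) = 0"
    if k: "k < s" and y: "\<And>j. j \<in> A \<Longrightarrow> \<bar>y j - y0 j\<bar> < \<delta>" for k y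
  proof (rule poly_zero_on_interval[OF assms(2) _ k])
    fix t assume t: "\<bar>t - y0 i\<bar> < \<delta>"
    have prod: "(\<Prod>j\<in>insert i A. (y(i := t)) j ^ (\<alpha>(i := k)) j) = t ^ k * (\<Prod>j\<in>A. y j ^ \<alpha> j)" for \<alpha> k
    proof -
      have "(\<Prod>j\<in>A. (y(i := t)) j ^ (\<alpha>(i := k)) j) = (\<Prod>j\<in>A. y j ^ \<alpha> j)"
        by (rule prod.cong) (use insert.hyps in auto)
      then show ?thesis using insert.hyps by simp
    qed
    have "(\<Sum>\<alpha>\<in>exps s (insert i A). \<kappa> \<alpha> * (\<Prod>j\<in>insert i A. (y(i := t)) j ^ \<alpha> j)) = 0"
      by (rule insert.prems(1)) (use y t in auto)
    then show "(\<Sum>k<s. (\<Sum>\<alpha>\<in>exps s A. \<kappa> (\<alpha>(i := k)) * (\<Prod>j\<in>A. y j ^ \<alpha> j)) * t ^ k) = 0"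
      unfolding sum_exps_insert[OF insert.hyps(2)] prod by (simp add: sum_distrib_left sum_distrib_right mult_ac)
  qed
  define \<beta> where "\<beta> = restrict \<alpha> A"
  have "\<beta> \<in> exps s A" "\<alpha> = \<beta>(i := \<alpha> i)" "\<alpha> i < s"
    using insert.prems(2) insert.hyps by (auto simp: \<beta>_def fun_eq_iff PiE_iff extensional_def)
  with insert.IH[of "\<lambda>\<alpha>'. \<kappa> (\<alpha>'(i := \<alpha> i))" \<beta>] coeff[of "\<alpha> i"] show ?case by simp
qed

text \<open>Kronecker substitution: the weights turn distinct exponent vectors into distinct exponents.\<close>

lemma ex_injective_weight:
  assumes "finite A"
  shows "\<exists>n :: 'i \<Rightarrow> nat. (\<forall>i. n i \<ge> 1) \<and> inj_on (\<lambda>\<alpha>. \<Sum>i\<in>A. n i * \<alpha> i) (exps s A)"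
  using assms
proof (induction A rule: finite_induct)
  case empty
  show ?case by (rule exI[of _ "\<lambda>_. 1"]) simp
next
  case (insert i A)
  then obtain n where n: "\<And>i. n i \<ge> (1::nat)" "inj_on (\<lambda>\<alpha>. \<Sum>i\<in>A. n i * \<alpha> i) (exps s A)" by blast
  \<comment> \<open>\<open>M\<close> exceeds every weight in the other variables, so
    \<open>\<alpha> i\<close> is the quotient on division by \<open>M\<close> and their weight is
    the remainder.\<close>
  define M where "M = 1 + (\<Sum>j\<in>A. n j * s)"
  have w: "(\<Sum>j\<in>insert i A. (n(i := M)) j * \<alpha> j) = M * \<alpha> i + (\<Sum>j\<in>A. n j * \<alpha> j)" for \<alpha> :: "'i \<Rightarrow> nat"
  proof -
    have "(\<Sum>j\<in>A. (n(i := M)) j * \<alpha> j) = (\<Sum>j\<in>A. n j * \<alpha> j)"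
      by (rule sum.cong) (use insert.hyps in auto)
    then show ?thesis using insert.hyps by simp
  qed
  have small: "(\<Sum>j\<in>A. n j * \<alpha> j) < M" if "\<alpha> \<in> exps s (insert i A)" for \<alpha>
  proof -
    have "(\<Sum>j\<in>A. n j * \<alpha> j) \<le> (\<Sum>j\<in>A. n j * s)"
      by (intro sum_mono mult_le_mono2) (use that in \<open>auto simp: PiE_iff less_imp_le\<close>)
    then show ?thesis by (simp add: M_def)
  qed
  have "inj_on (\<lambda>\<alpha>. \<Sum>j\<in>insert i A. (n(i := M)) j * \<alpha> j) (exps s (insert i A))"
  proof (rule inj_onI)
    fix \<alpha> \<beta> assume ab: "\<alpha> \<in> exps s (insert i A)" "\<beta> \<in> exps s (insert i A)"
      and eq: "(\<Sum>j\<in>insert i A. (n(i := M)) j * \<alpha> j) = (\<Sum>j\<in>insert i A. (n(i := M)) j * \<beta> j)"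
    have eq': "M * \<alpha> i + (\<Sum>j\<in>A. n j * \<alpha> j) = M * \<beta> i + (\<Sum>j\<in>A. n j * \<beta> j)"
      using eq unfolding w .
    have i: "\<alpha> i = \<beta> i"
    proof -
      have "(M * \<alpha> i + (\<Sum>j\<in>A. n j * \<alpha> j)) div M = \<alpha> i" "(M * \<beta> i + (\<Sum>j\<in>A. n j * \<beta> j)) div M = \<beta> i"
        using small[OF ab(1)] small[OF ab(2)] by auto
      then show ?thesis using eq' by simp
    qed
    have "(\<Sum>j\<in>A. n j * restrict \<alpha> A j) = (\<Sum>j\<in>A. n j * restrict \<beta> A j)"
      using eq' i by simp
    moreover have "restrict \<alpha> A \<in> exps s A" "restrict \<beta> A \<in> exps s A"
      using ab by (auto simp: PiE_iff)
    ultimately have "restrict \<alpha> A = restrict \<beta> A"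
      using n(2) by (simp add: inj_on_def)
    then have "\<alpha> j = \<beta> j" if "j \<in> A" for j using that by (metis restrict_apply)
    then show "\<alpha> = \<beta>" using ab i by (intro PiE_ext[of \<alpha> "insert i A" "\<lambda>_. {..<s}" \<beta>]) auto
  qed
  then show ?case using n(1) by (intro exI[of _ "n(i := M)"]) (auto simp: M_def)
qed

lemma prod_power_weight:
  fixes \<eta> :: real
  shows "(\<Prod>i\<in>A. (\<eta> ^ n i) ^ \<alpha> i) = \<eta> ^ (\<Sum>i\<in>A. n i * \<alpha> i)"
  by (induction A rule: infinite_finite_induct) (simp_all add: power_add power_mult)

text \<open>There are more monomials in \<open>U\<close>, \<open>W\<close>, \<open>C\<close> and \<open>t\<close> with exponents below \<open>s\<close> than the dimension
  of the space of polynomials of the resulting degree, so they satisfy a linear relation. Its part of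
  lowest weight in \<open>U\<close> survives division by powers of \<open>u\<close> as \<open>u \<rightarrow> 0\<close>, and on \<open>Q\<close> the values of \<open>C\<close> can
  be varied independently, so that only \<open>W\<close> and \<open>t\<close> remain.\<close>

lemma ex_relation_eliminating:
  fixes U W C :: "('a::euclidean_space \<Rightarrow> real) set" and t :: "'a \<Rightarrow> real"
  assumes fin: "finite U" "finite W" "finite C"
    and deg: "\<And>f. f \<in> U \<union> W \<union> C \<Longrightarrow> pdeg D f" "pdeg D t"
    and card: "DIM('a) \<le> card U + card W + card C"
    and s: "s = (D * (card U + card W + card C + 1) + 1) ^ DIM('a) + 1"
    and U0: "\<And>q u. q \<in> Q \<Longrightarrow> u \<in> U \<Longrightarrow> u q = 0"
    and op: "\<And>q \<epsilon>. q \<in> Q \<Longrightarrow> \<epsilon> > 0 \<Longrightarrow> \<exists>\<delta>>0. \<forall>\<eta>. (\<forall>u\<in>U. \<bar>\<eta> u\<bar> < \<delta>) \<longrightarrow>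
        (\<exists>x. dist x q < \<epsilon> \<and> (\<forall>u\<in>U. u x = \<eta> u) \<and> (\<forall>w\<in>W \<union> C. w x = w q))"
    and mv: "\<And>q. q \<in> Q \<Longrightarrow> \<exists>\<delta>>0. \<forall>y. (\<forall>c\<in>C. \<bar>y c - c q\<bar> < \<delta>) \<longrightarrow>
        (\<exists>q'\<in>Q. (\<forall>c\<in>C. c q' = y c) \<and> (\<forall>w\<in>W. w q' = w q) \<and> t q' = t q)"
  shows "\<exists>\<rho>. (\<exists>\<alpha>\<in>exps s W. \<exists>j<s. \<rho> \<alpha> j \<noteq> 0) \<and>
    (\<forall>q\<in>Q. (\<Sum>j<s. (\<Sum>\<alpha>\<in>exps s W. \<rho> \<alpha> j * (\<Prod>w\<in>W. w q ^ \<alpha> w)) * t q ^ j) = 0)"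
proof -
  define k where "k = card U + card W + card C"
  define I where "I = exps s U \<times> exps s C \<times> exps s W \<times> {..<s}"
  define R where "R = exps s C \<times> exps s W \<times> {..<s}"
  define \<psi> where "\<psi> r x = (\<Prod>f\<in>C. f x ^ (fst r) f) * ((\<Prod>f\<in>W. f x ^ (fst (snd r)) f) * t x ^ snd (snd r))"
    for r :: "(('a \<Rightarrow> real) \<Rightarrow> nat) \<times> (('a \<Rightarrow> real) \<Rightarrow> nat) \<times> nat" and x
  define \<phi> where "\<phi> i x = (\<Prod>f\<in>U. f x ^ (fst i) f) * \<psi> (snd i) x"
    for i :: "(('a \<Rightarrow> real) \<Rightarrow> nat) \<times> (('a \<Rightarrow> real) \<Rightarrow> nat) \<times> (('a \<Rightarrow> real) \<Rightarrow> nat) \<times> nat" and x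
  have finI: "finite I" and finR: "finite R"
    using fin by (auto simp: I_def R_def finite_exps)
  have degp: "pdeg (D * s * card A) (\<lambda>x. \<Prod>f\<in>A. f x ^ \<alpha> f)"
    if "A \<subseteq> U \<union> W \<union> C" "\<alpha> \<in> exps s A" for A \<alpha>
  proof (rule pdeg_prod)
    fix f assume f: "f \<in> A"
    show "pdeg (D * s) (\<lambda>x. f x ^ \<alpha> f)"
      by (rule pdeg_mono[OF pdeg_power[OF deg(1)]]) (use f that in \<open>auto simp: PiE_iff less_imp_le\<close>)
  qed
  have deg\<psi>: "pdeg (D * s * card C + (D * s * card W + D * s)) (\<psi> r)" if "r \<in> R" for r
    unfolding \<psi>_def
    by (intro pdeg.mult degp pdeg_mono[OF pdeg_power[OF deg(2)]])
       (use that in \<open>auto simp: R_def less_imp_le\<close>)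
  have deg\<phi>: "pdeg (D * s * (k + 1)) (\<phi> i)" if "i \<in> I" for i
  proof -
    have "pdeg (D * s * card U + (D * s * card C + (D * s * card W + D * s))) (\<phi> i)"
      unfolding \<phi>_def by (intro pdeg.mult degp deg\<psi>) (use that in \<open>auto simp: I_def R_def\<close>)
    then show ?thesis by (simp add: k_def algebra_simps)
  qed
  \<comment> \<open>There are \<open>s ^ (k + 1)\<close> monomials against a space of dimension at
    most \<open>(s * (D * (k + 1) + 1)) ^ DIM('a)\<close>. As \<open>k\<close> is at least the
    dimension, one spare power of \<open>s\<close> remains, and \<open>s\<close> is chosen just
    above \<open>(D * (k + 1) + 1) ^ DIM('a)\<close>.\<close>
  have cardI: "(D * s * (k + 1) + 1) ^ DIM('a) < card I"
  proof -
    have s1: "s \<ge> 1" by (simp add: s)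
    have "D * s * (k + 1) + 1 \<le> s * (D * (k + 1) + 1)" using s1 by (simp add: algebra_simps)
    then have "(D * s * (k + 1) + 1) ^ DIM('a) \<le> (s * (D * (k + 1) + 1)) ^ DIM('a)"
      by (rule power_mono) simp
    also have "\<dots> = s ^ DIM('a) * (D * (k + 1) + 1) ^ DIM('a)"
      by (rule power_mult_distrib)
    also have "\<dots> < s ^ DIM('a) * s"
      using s1 by (intro mult_strict_left_mono) (auto simp: s k_def)
    also have "\<dots> \<le> s ^ k * s"
      using s1 card by (intro mult_right_mono power_increasing) (auto simp: k_def)
    also have "\<dots> = card I"
      using fin by (simp add: I_def k_def card_cartesian_product card_PiE power_add)
    finally show ?thesis .
  qed
  obtain \<kappa> where \<kappa>: "\<exists>i\<in>I. \<kappa> i \<noteq> 0" "\<And>x. (\<Sum>i\<in>I. \<kappa> i * \<phi> i x) = 0"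
    by (rule pdeg_family_dependent[OF finI _ cardI, of \<phi>]) (rule deg\<phi>, assumption, rule that, assumption+)
  obtain n where n: "\<And>u. n u \<ge> (1::nat)" "inj_on (\<lambda>\<alpha>. \<Sum>u\<in>U. n u * \<alpha> u) (exps s U)"
    using ex_injective_weight[OF fin(1)] by blast
  define wt where "wt \<alpha> = (\<Sum>u\<in>U. n u * \<alpha> u)" for \<alpha>
  define g where "g \<alpha> x = (\<Sum>r\<in>R. \<kappa> (\<alpha>, r) * \<psi> r x)" for \<alpha> x
  have rel: "(\<Sum>\<alpha>\<in>exps s U. (\<Prod>u\<in>U. u x ^ \<alpha> u) * g \<alpha> x) = 0" for x
  proof -
    have "(\<Sum>i\<in>I. \<kappa> i * \<phi> i x) = (\<Sum>(\<alpha>, r)\<in>exps s U \<times> R. \<kappa> (\<alpha>, r) * \<phi> (\<alpha>, r) x)"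
      by (simp add: I_def R_def split_def)
    also have "\<dots> = (\<Sum>\<alpha>\<in>exps s U. \<Sum>r\<in>R. \<kappa> (\<alpha>, r) * \<phi> (\<alpha>, r) x)"
      by (rule sum.cartesian_product[symmetric])
    also have "\<dots> = (\<Sum>\<alpha>\<in>exps s U. (\<Prod>u\<in>U. u x ^ \<alpha> u) * g \<alpha> x)"
      by (simp add: \<phi>_def g_def sum_distrib_left mult_ac)
    finally show ?thesis using \<kappa>(2) by simp
  qed
  \<comment> \<open>The exponent vectors of \<open>U\<close> that occur in the relation. Injectivity
    of the weight makes the one of lowest weight, \<open>a\<close>, unique.\<close>
  define Su where "Su = {\<alpha> \<in> exps s U. \<exists>r\<in>R. \<kappa> (\<alpha>, r) \<noteq> 0}"
  have Su: "finite Su" "Su \<noteq> {}"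
    using \<kappa>(1) finite_exps[OF fin(1)] by (auto simp: Su_def I_def R_def)
  obtain a where a: "a \<in> Su" "\<And>b. b \<in> Su \<Longrightarrow> wt a \<le> wt b"
    using arg_min_if_finite(1)[OF Su, of wt] arg_min_least[OF Su, of _ wt] by blast
  have wt_less: "wt a < wt b" if "b \<in> Su" "b \<noteq> a" for b
  proof -
    have "wt a \<noteq> wt b" using n(2) a(1) that by (auto simp: inj_on_def Su_def wt_def)
    then show ?thesis using a(2)[OF that(1)] by simp
  qed
  have g0: "g \<alpha> x = 0" if "\<alpha> \<in> exps s U" "\<alpha> \<notin> Su" for \<alpha> x
    using that by (auto simp: g_def Su_def intro!: sum.neutral)
  have contg: "continuous_on UNIV (g \<alpha>)" for \<alpha>
    unfolding g_def
  proof (rule continuous_on_sum)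
    fix r assume "r \<in> R"
    from pdeg_continuous_on[OF deg\<psi>[OF this]]
    show "continuous_on UNIV (\<lambda>x. \<kappa> (\<alpha>, r) * \<psi> r x)"
      by (rule continuous_on_mult[OF continuous_on_const])
  qed
  \<comment> \<open>At points tending to \<open>q\<close> where each \<open>u\<close> has the value
    \<open>\<eta> ^ n u\<close>, the monomial of \<open>U\<close> with exponents
    \<open>\<alpha>\<close> becomes \<open>\<eta> ^ wt \<alpha>\<close>. After division by
    \<open>\<eta> ^ wt a\<close> all terms except that of \<open>a\<close> tend to 0.\<close>
  have leading: "g a q = 0" if q: "q \<in> Q" for q
  proof -
    have "\<exists>x \<eta>. 0 < \<eta> \<and> \<eta> \<le> e \<and> dist x q < e \<and> (\<forall>u\<in>U. u x = \<eta> ^ n u)" if e: "e > 0" for e :: real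
    proof -
      from op[OF q e] obtain \<delta> where \<delta>0: "\<delta> > 0 \<and> (\<forall>\<eta>. (\<forall>u\<in>U. \<bar>\<eta> u\<bar> < \<delta>) \<longrightarrow>
        (\<exists>x. dist x q < e \<and> (\<forall>u\<in>U. u x = \<eta> u) \<and> (\<forall>w\<in>W \<union> C. w x = w q)))" by (rule exE)
      have \<delta>: "\<delta> > 0" using \<delta>0 by (rule conjunct1)
      have \<delta>_ex: "\<exists>x. dist x q < e \<and> (\<forall>u\<in>U. u x = \<eta> u)" if "\<forall>u\<in>U. \<bar>\<eta> u\<bar> < \<delta>" for \<eta>
        using mp[OF spec[OF conjunct2[OF \<delta>0]] that] by (elim exE conjE) (intro exI conjI)
      define \<eta> where "\<eta> = min (min 1 e) (\<delta> / 2)"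
      have \<eta>: "0 < \<eta>" "\<eta> \<le> e" "\<eta> \<le> 1" "\<eta> < \<delta>" using \<delta> e by (auto simp: \<eta>_def)
      have "\<bar>\<eta> ^ n u\<bar> < \<delta>" for u
      proof -
        have "\<eta> ^ n u \<le> \<eta> ^ 1" using \<eta> n(1)[of u] by (intro power_decreasing) auto
        then show ?thesis using \<eta> by simp
      qed
      then show ?thesis using \<delta>_ex[of "\<lambda>u. \<eta> ^ n u"] \<eta> by auto
    qed
    then have "\<forall>m. \<exists>x \<eta>. 0 < \<eta> \<and> \<eta> \<le> inverse (real (Suc m)) \<and> dist x q < inverse (real (Suc m)) \<and> (\<forall>u\<in>U. u x = \<eta> ^ n u)"
      by simp
    then obtain x \<eta> where x: "\<And>m. 0 < \<eta> m" "\<And>m. \<eta> m \<le> inverse (real (Suc m))"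
      "\<And>m. dist (x m) q < inverse (real (Suc m))" "\<And>m u. u \<in> U \<Longrightarrow> u (x m) = \<eta> m ^ n u" by metis
    have \<eta>0: "\<eta> \<longlonglongrightarrow> 0"
      by (rule Lim_null_comparison[OF _ LIMSEQ_inverse_real_of_nat])
         (use x in \<open>auto intro!: always_eventually simp: less_imp_le\<close>)
    have xq: "x \<longlonglongrightarrow> q"
    proof -
      have "(\<lambda>m. dist (x m) q) \<longlonglongrightarrow> 0"
        by (rule Lim_null_comparison[OF _ LIMSEQ_inverse_real_of_nat])
           (use x(3) in \<open>auto intro!: always_eventually simp: less_imp_le\<close>)
      then show ?thesis using tendsto_dist_iff by blast
    qed
    have gx: "(\<lambda>m. g \<alpha> (x m)) \<longlonglongrightarrow> g \<alpha> q" for \<alpha>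
      by (rule isCont_tendsto_compose[OF _ xq]) (use contg[of \<alpha>] in \<open>simp add: continuous_on_eq_continuous_at\<close>)
    have eq: "g a (x m) + (\<Sum>\<alpha>\<in>Su - {a}. \<eta> m ^ (wt \<alpha> - wt a) * g \<alpha> (x m)) = 0" for m
    proof -
      have "(\<Prod>u\<in>U. u (x m) ^ \<alpha> u) = \<eta> m ^ wt \<alpha>" for \<alpha>
        unfolding wt_def prod_power_weight[symmetric] by (rule prod.cong) (simp_all add: x(4))
      then have "0 = (\<Sum>\<alpha>\<in>exps s U. \<eta> m ^ wt \<alpha> * g \<alpha> (x m))"
        using rel[of "x m"] by simp
      also have "\<dots> = (\<Sum>\<alpha>\<in>Su. \<eta> m ^ wt \<alpha> * g \<alpha> (x m))"
        by (rule sum.mono_neutral_right) (use finite_exps[OF fin(1)] g0 in \<open>auto simp: Su_def\<close>)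
      also have "\<dots> = (\<Sum>\<alpha>\<in>Su. \<eta> m ^ wt a * (\<eta> m ^ (wt \<alpha> - wt a) * g \<alpha> (x m)))"
        by (rule sum.cong) (simp_all add: a(2) mult.assoc[symmetric] power_add[symmetric])
      also have "\<dots> = \<eta> m ^ wt a * (\<Sum>\<alpha>\<in>Su. \<eta> m ^ (wt \<alpha> - wt a) * g \<alpha> (x m))"
        by (rule sum_distrib_left[symmetric])
      finally have "(\<Sum>\<alpha>\<in>Su. \<eta> m ^ (wt \<alpha> - wt a) * g \<alpha> (x m)) = 0"
        using x(1)[of m] by simp
      then show ?thesis using Su(1) a(1) by (simp add: sum.remove)
    qed
    have "(\<lambda>m. g a (x m) + (\<Sum>\<alpha>\<in>Su - {a}. \<eta> m ^ (wt \<alpha> - wt a) * g \<alpha> (x m)))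
        \<longlonglongrightarrow> g a q + (\<Sum>\<alpha>\<in>Su - {a}. 0 ^ (wt \<alpha> - wt a) * g \<alpha> q)"
      by (intro tendsto_add tendsto_sum tendsto_mult tendsto_power gx \<eta>0)
    then have "g a q + (\<Sum>\<alpha>\<in>Su - {a}. 0 ^ (wt \<alpha> - wt a) * g \<alpha> q) = 0"
      unfolding eq by (simp add: LIMSEQ_const_iff)
    moreover have "(\<Sum>\<alpha>\<in>Su - {a}. 0 ^ (wt \<alpha> - wt a) * g \<alpha> q) = 0"
      by (rule sum.neutral) (use wt_less in auto)
    ultimately show ?thesis by simp
  qed
  \<comment> \<open>The exponent \<open>b\<close> is taken from a term that occurs together with
    \<open>a\<close>, so the relation that remains after comparing coefficients in \<open>C\<close>
    is nontrivial.\<close>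
  obtain b \<alpha>0 j0 where b: "b \<in> exps s C" "\<alpha>0 \<in> exps s W" "j0 < s" "\<kappa> (a, b, \<alpha>0, j0) \<noteq> 0"
    using a(1) by (auto simp: Su_def R_def)
  have final: "(\<Sum>j<s. (\<Sum>\<alpha>\<in>exps s W. \<kappa> (a, b, \<alpha>, j) * (\<Prod>w\<in>W. w q ^ \<alpha> w)) * t q ^ j) = 0" if q: "q \<in> Q" for q
  proof -
    define \<mu> where "\<mu> \<beta> = (\<Sum>j<s. (\<Sum>\<alpha>\<in>exps s W. \<kappa> (a, \<beta>, \<alpha>, j) * (\<Prod>w\<in>W. w q ^ \<alpha> w)) * t q ^ j)" for \<beta>
    obtain \<delta> where \<delta>: "\<delta> > 0" "\<And>y. (\<forall>c\<in>C. \<bar>y c - c q\<bar> < \<delta>) \<Longrightarrow>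
        \<exists>q'\<in>Q. (\<forall>c\<in>C. c q' = y c) \<and> (\<forall>w\<in>W. w q' = w q) \<and> t q' = t q"
      using mv[OF q] by blast
    have "\<mu> b = 0"
    \<comment> \<open>The values of \<open>C\<close> fill a box around those at \<open>q\<close>
      while \<open>W\<close> and \<open>t\<close> keep theirs, so the coefficient of every monomial
      in \<open>C\<close> vanishes at \<open>q\<close>.\<close>
    proof (rule poly_zero_on_box[OF fin(3) \<delta>(1) _ b(1), of "\<lambda>c. c q"])
      fix y assume "\<And>c. c \<in> C \<Longrightarrow> \<bar>y c - c q\<bar> < \<delta>"
      then obtain q' where q': "q' \<in> Q" "\<And>c. c \<in> C \<Longrightarrow> c q' = y c" "\<And>w. w \<in> W \<Longrightarrow> w q' = w q" "t q' = t q"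
        using \<delta>(2)[of y] by blast
      have pC: "(\<Prod>c\<in>C. c q' ^ \<beta> c) = (\<Prod>c\<in>C. y c ^ \<beta> c)" for \<beta> by (rule prod.cong) (simp_all add: q')
      have pW: "(\<Prod>w\<in>W. w q' ^ \<alpha> w) = (\<Prod>w\<in>W. w q ^ \<alpha> w)" for \<alpha> by (rule prod.cong) (simp_all add: q')
      have "0 = g a q'" using leading[OF q'(1)] by simp
      also have "\<dots> = (\<Sum>(\<beta>, r)\<in>exps s C \<times> (exps s W \<times> {..<s}). \<kappa> (a, \<beta>, r) * \<psi> (\<beta>, r) q')"
        by (simp add: g_def R_def split_def)
      also have "\<dots> = (\<Sum>\<beta>\<in>exps s C. \<Sum>r\<in>exps s W \<times> {..<s}. \<kappa> (a, \<beta>, r) * \<psi> (\<beta>, r) q')"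
        by (rule sum.cartesian_product[symmetric])
      also have "\<dots> = (\<Sum>\<beta>\<in>exps s C. \<mu> \<beta> * (\<Prod>c\<in>C. y c ^ \<beta> c))"
      proof (rule sum.cong[OF refl])
        fix \<beta>
        have "(\<Sum>r\<in>exps s W \<times> {..<s}. \<kappa> (a, \<beta>, r) * \<psi> (\<beta>, r) q')
          = (\<Sum>(\<alpha>, j)\<in>exps s W \<times> {..<s}. \<kappa> (a, \<beta>, \<alpha>, j) * (\<Prod>w\<in>W. w q ^ \<alpha> w) * t q ^ j * (\<Prod>c\<in>C. y c ^ \<beta> c))"
          by (rule sum.cong) (auto simp: \<psi>_def pC pW q')
        also have "\<dots> = (\<Sum>\<alpha>\<in>exps s W. \<Sum>j<s. \<kappa> (a, \<beta>, \<alpha>, j) * (\<Prod>w\<in>W. w q ^ \<alpha> w) * t q ^ j * (\<Prod>c\<in>C. y c ^ \<beta> c))"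
          by (rule sum.cartesian_product[symmetric])
        also have "\<dots> = \<mu> \<beta> * (\<Prod>c\<in>C. y c ^ \<beta> c)"
          by (subst sum.swap) (simp add: \<mu>_def sum_distrib_right)
        finally show "(\<Sum>r\<in>exps s W \<times> {..<s}. \<kappa> (a, \<beta>, r) * \<psi> (\<beta>, r) q') = \<mu> \<beta> * (\<Prod>c\<in>C. y c ^ \<beta> c)" .
      qed
      finally show "(\<Sum>\<beta>\<in>exps s C. \<mu> \<beta> * (\<Prod>c\<in>C. y c ^ \<beta> c)) = 0" by simp
    qed
    then show ?thesis by (simp add: \<mu>_def)
  qed
  show ?thesis
    by (rule exI[of _ "\<lambda>\<alpha> j. \<kappa> (a, b, \<alpha>, j)"]) (use b final in blast)
qed

text \<open>At \<open>y0\<close> itself all coefficients of the relation may vanish. So the points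
  are moved slightly to a common value \<open>y\<close> of \<open>W\<close> at which some
  coefficient survives; their \<open>t\<close>-values remain distinct and are roots of one nonzero
  polynomial of degree less than \<open>s\<close>.\<close>

lemma card_less_if_relation:
  fixes W :: "('a::euclidean_space \<Rightarrow> real) set" and t :: "'a \<Rightarrow> real"
  assumes fin: "finite W" "finite J"
    and \<rho>: "\<exists>\<alpha>\<in>exps s W. \<exists>j<s. \<rho> \<alpha> j \<noteq> 0"
      "\<And>q. q \<in> Q \<Longrightarrow> (\<Sum>j<s. (\<Sum>\<alpha>\<in>exps s W. \<rho> \<alpha> j * (\<Prod>w\<in>W. w q ^ \<alpha> w)) * t q ^ j) = 0"
    and inj: "inj_on t J"
    and J: "\<And>q e. q \<in> J \<Longrightarrow> e > 0 \<Longrightarrow> \<exists>\<delta>>0. \<forall>y. (\<forall>w\<in>W. \<bar>y w - y0 w\<bar> < \<delta>) \<longrightarrow>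
        (\<exists>q'\<in>Q. \<bar>t q' - t q\<bar> < e \<and> (\<forall>w\<in>W. w q' = y w))"
  shows "card J < s"
proof -
  obtain \<alpha>0 j0 where r0: "\<alpha>0 \<in> exps s W" "j0 < s" "\<rho> \<alpha>0 j0 \<noteq> 0" using \<rho>(1) by blast
  \<comment> \<open>The extra element 1 makes the minimum meaningful if \<open>J\<close> has fewer
    than two points.\<close>
  define gaps where "gaps = insert 1 ((\<lambda>(p, q). \<bar>t p - t q\<bar>) ` {(p, q) \<in> J \<times> J. p \<noteq> q})"
  have fg: "finite gaps" unfolding gaps_def using fin(2) by (auto intro: finite_subset[of _ "J \<times> J"])
  \<comment> \<open>Half the least gap: shifts of less than \<open>e\<close> cannot make two
    \<open>t\<close>-values collide.\<close>
  define e where "e = Min gaps / 2"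
  have "x > 0" if "x \<in> gaps" for x using that inj by (auto simp: gaps_def inj_on_def)
  then have e: "e > 0" using fg by (simp add: e_def gaps_def)
  have gap: "2 * e \<le> \<bar>t p - t q\<bar>" if "p \<in> J" "q \<in> J" "p \<noteq> q" for p q
    using that fg by (auto simp: e_def gaps_def intro!: Min_le)
  obtain \<delta> where \<delta>: "\<And>q. q \<in> J \<Longrightarrow> \<delta> q > 0"
    "\<And>q y. q \<in> J \<Longrightarrow> (\<forall>w\<in>W. \<bar>y w - y0 w\<bar> < \<delta> q) \<Longrightarrow> \<exists>q'\<in>Q. \<bar>t q' - t q\<bar> < e \<and> (\<forall>w\<in>W. w q' = y w)"
    using J[OF _ e] by metis
  define d where "d = Min (insert 1 (\<delta> ` J))"
  have d: "d > 0" using fin(2) \<delta>(1) by (simp add: d_def)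
  have dle: "d \<le> \<delta> q" if "q \<in> J" for q using that fin(2) by (auto simp: d_def)
  have "\<exists>y. (\<forall>w\<in>W. \<bar>y w - y0 w\<bar> < d) \<and> (\<Sum>\<alpha>\<in>exps s W. \<rho> \<alpha> j0 * (\<Prod>w\<in>W. y w ^ \<alpha> w)) \<noteq> 0"
  proof (rule ccontr)
    assume "\<not> ?thesis"
    then have "\<rho> \<alpha>0 j0 = 0"
      by (intro poly_zero_on_box[OF fin(1) d _ r0(1), of y0 "\<lambda>\<alpha>. \<rho> \<alpha> j0"]) blast
    then show False using r0 by simp
  qed
  then obtain y where y: "\<forall>w\<in>W. \<bar>y w - y0 w\<bar> < d" and
    ne: "(\<Sum>\<alpha>\<in>exps s W. \<rho> \<alpha> j0 * (\<Prod>w\<in>W. y w ^ \<alpha> w)) \<noteq> 0" by blast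
  have "\<exists>q'\<in>Q. \<bar>t q' - t q\<bar> < e \<and> (\<forall>w\<in>W. w q' = y w)" if "q \<in> J" for q
    using \<delta>(2)[OF that, of y] y dle[OF that] by force
  then obtain h where h: "\<And>q. q \<in> J \<Longrightarrow> h q \<in> Q \<and> \<bar>t (h q) - t q\<bar> < e \<and> (\<forall>w\<in>W. w (h q) = y w)" by metis
  define c where "c j = (\<Sum>\<alpha>\<in>exps s W. \<rho> \<alpha> j * (\<Prod>w\<in>W. y w ^ \<alpha> w))" for j
  have root: "(\<Sum>j<s. c j * t (h q) ^ j) = 0" if q: "q \<in> J" for q
  proof -
    have "(\<Prod>w\<in>W. w (h q) ^ \<alpha> w) = (\<Prod>w\<in>W. y w ^ \<alpha> w)" for \<alpha>
      by (rule prod.cong) (use h[OF q] in auto)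
    then show ?thesis using \<rho>(2)[of "h q"] h[OF q] by (simp add: c_def)
  qed
  have inj2: "inj_on (\<lambda>q. t (h q)) J"
  proof (rule inj_onI, rule ccontr)
    fix p q assume pq: "p \<in> J" "q \<in> J" "t (h p) = t (h q)" "p \<noteq> q"
    show False using gap[OF pq(1,2,4)] h[OF pq(1)] h[OF pq(2)] pq(3) by linarith
  qed
  obtain m where m: "s = Suc m" using r0(2) by (cases s) auto
  have "\<exists>k\<le>m. c k \<noteq> 0" using ne r0(2) by (intro exI[of _ j0]) (simp add: c_def m)
  note bd = polyfun_rootbound[OF this]
  have "(\<lambda>q. t (h q)) ` J \<subseteq> {z. (\<Sum>j\<le>m. c j * z ^ j) = 0}"
    using root by (auto simp: m lessThan_Suc_atMost)
  from order_trans[OF card_mono[OF conjunct1[OF bd] this] conjunct2[OF bd]]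
  have "card ((\<lambda>q. t (h q)) ` J) \<le> m" .
  then show ?thesis using card_image[OF inj2] m by simp
qed

section \<open>Selecting transversal families of functions\<close>

lemma dual_basis_pick:
  assumes "dual_basis D A v" "finite A" "B \<subseteq> A" "f \<in> A" "linear (D f)"
  shows "D f (\<Sum>g\<in>B. c g *\<^sub>R v g) = (if f \<in> B then c f else 0)"
proof -
  have "D f (\<Sum>g\<in>B. c g *\<^sub>R v g) = (\<Sum>g\<in>B. c g * D f (v g))"
    by (simp add: linear_sum[OF assms(5)] linear_cmul[OF assms(5)])
  also have "\<dots> = (\<Sum>g\<in>B. if g = f then c g else 0)"
    by (rule sum.cong) (use assms in \<open>auto simp: dual_basis_def subset_iff\<close>)
  finally show ?thesis using finite_subset[OF assms(3,2)] by (simp add: sum.delta)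
qed

lemma dual_basis_subset: "dual_basis D A v \<Longrightarrow> B \<subseteq> A \<Longrightarrow> dual_basis D B v"
  unfolding dual_basis_def by blast

lemma dual_basis_independent:
  fixes v :: "'i \<Rightarrow> 'a::euclidean_space"
  assumes "dual_basis D A v" "finite A" "\<And>f. f \<in> A \<Longrightarrow> linear (D f)"
  shows "inj_on v A" "independent (v ` A)"
proof -
  show inj: "inj_on v A"
    using assms(1) by (auto simp: inj_on_def dual_basis_def) (metis zero_neq_one)
  show "independent (v ` A)"
    unfolding independent_explicit
  proof (intro conjI allI impI ballI)
    show "finite (v ` A)" using assms(2) by simp
    fix u b assume 0: "(\<Sum>w\<in>v ` A. u w *\<^sub>R w) = 0" and "b \<in> v ` A"
    then obtain f where f: "f \<in> A" "b = v f" by blast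
    have "(\<Sum>g\<in>A. u (v g) *\<^sub>R v g) = 0" using 0 by (simp add: sum.reindex[OF inj])
    then have "D f (\<Sum>g\<in>A. u (v g) *\<^sub>R v g) = 0" by (simp add: linear_0[OF assms(3)[OF f(1)]])
    then show "u b = 0"
      using dual_basis_pick[OF assms(1,2) subset_refl f(1) assms(3)[OF f(1)], of "\<lambda>g. u (v g)"] f by simp
  qed
qed

lemma dual_basis_card_le_dim:
  fixes v :: "'i \<Rightarrow> 'a::euclidean_space"
  assumes "dual_basis D A v" "finite A" "\<And>f. f \<in> A \<Longrightarrow> linear (D f)" "v ` A \<subseteq> S"
  shows "card A \<le> dim S"
proof -
  note i = dual_basis_independent[OF assms(1-3)]
  have "card (v ` A) \<le> dim S" using assms(4) i(2) by (intro independent_card_le_dim)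
  then show ?thesis by (simp add: card_image[OF i(1)])
qed

lemma dual_basis_kernel_trivial:
  fixes v :: "'i \<Rightarrow> 'a::euclidean_space"
  assumes "dual_basis D A v" "finite A" and lin: "\<And>f. f \<in> A \<Longrightarrow> linear (D f)" and "DIM('a) \<le> card A"
    and 0: "\<And>f. f \<in> A \<Longrightarrow> D f x = 0"
  shows "x = 0"
proof -
  note i = dual_basis_independent[OF assms(1-3)]
  have "UNIV \<subseteq> span (v ` A)"
    using assms(4) card_image[OF i(1)] by (intro card_ge_dim_independent i(2)) auto
  then have "x \<in> span (v ` A)" by blast
  then obtain u where u: "x = (\<Sum>w\<in>v ` A. u w *\<^sub>R w)"
    using span_finite[OF finite_imageI[OF assms(2), of v]] by auto
  then have x: "x = (\<Sum>g\<in>A. u (v g) *\<^sub>R v g)" by (simp add: sum.reindex[OF i(1)])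
  have "u (v f) = 0" if f: "f \<in> A" for f
    using dual_basis_pick[OF assms(1,2) subset_refl f lin[OF f], of "\<lambda>g. u (v g)"] 0[OF f] f by (simp flip: x)
  then show ?thesis by (subst x) simp
qed

text \<open>By \<open>ker\<close> the functionals are coordinates on the whole space with respect to
  \<open>v\<close>, and on \<open>S\<close> the coordinates outside \<open>B\<close> vanish.\<close>

lemma dim_le_card_if_dual_basis:
  fixes v :: "'i \<Rightarrow> 'a::euclidean_space"
  assumes dual: "dual_basis D A v" and fin: "finite A" and lin: "\<And>f. f \<in> A \<Longrightarrow> linear (D f)"
    and BA: "B \<subseteq> A"
    and ker: "\<And>x. (\<And>f. f \<in> A \<Longrightarrow> D f x = 0) \<Longrightarrow> x = 0"
    and S: "\<And>x f. x \<in> S \<Longrightarrow> f \<in> A - B \<Longrightarrow> D f x = 0"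
  shows "dim S \<le> card B"
proof -
  have "x = (\<Sum>f\<in>B. D f x *\<^sub>R v f)" if x: "x \<in> S" for x
  proof -
    have "x - (\<Sum>f\<in>B. D f x *\<^sub>R v f) = 0"
    proof (rule ker)
      fix f assume f: "f \<in> A"
      show "D f (x - (\<Sum>f\<in>B. D f x *\<^sub>R v f)) = 0"
        unfolding linear_diff[OF lin[OF f]] dual_basis_pick[OF dual fin BA f lin[OF f]]
        using S[OF x, of f] f by auto
    qed
    then show ?thesis by simp
  qed
  then have "S \<subseteq> span (v ` B)"
    by (metis (no_types, lifting) imageI span_base span_scale span_sum subsetI)
  then have "dim S \<le> card (v ` B)"
    using finite_subset[OF BA fin] by (intro dim_le_card) auto
  also have "\<dots> \<le> card B" using finite_subset[OF BA fin] by (rule card_image_le)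
  finally show ?thesis .
qed

text \<open>Independence of functionals is an open condition. The map \<open>T\<close> differs from
  the identity by a term of norm at most \<open>c q\<close> times the argument, so it is invertible
  while \<open>c q\<close> is less than 1, and it carries \<open>D f q0\<close> back to
  \<open>D f q\<close>; the preimages of the \<open>v g\<close> are dual at
  \<open>q\<close>.\<close>

lemma dual_open:
  fixes D :: "'i \<Rightarrow> 'q::topological_space \<Rightarrow> 'a::euclidean_space \<Rightarrow> real"
  assumes fin: "finite A" and lin: "\<And>f q. f \<in> A \<Longrightarrow> linear (D f q)"
    and cont: "\<And>f v. f \<in> A \<Longrightarrow> continuous_on UNIV (\<lambda>q. D f q v)"
    and dual: "dual_basis (\<lambda>f. D f q0) A v"
  obtains N where "open N" "q0 \<in> N" "\<And>q. q \<in> N \<Longrightarrow> \<exists>v. dual_basis (\<lambda>f. D f q) A v"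
proof -
  define c where "c q = (\<Sum>f\<in>A. \<Sum>b\<in>Basis. \<bar>D f q b - D f q0 b\<bar> * norm (v f))" for q
  define N where "N = c -` {..<1}"
  have "continuous_on UNIV c"
    unfolding c_def by (intro continuous_intros cont)
  then have "open N" unfolding N_def by (intro open_vimage) auto
  moreover have "q0 \<in> N" by (simp add: N_def c_def)
  moreover have "\<exists>v. dual_basis (\<lambda>f. D f q) A v" if q: "q \<in> N" for q
  proof -
    define T where "T x = x + (\<Sum>f\<in>A. (D f q x - D f q0 x) *\<^sub>R v f)" for x
    have "linear T"
      by (rule linearI)
         (simp_all add: T_def linear_add[OF lin] linear_cmul[OF lin] algebra_simps sum.distrib sum_subtractf scaleR_sum_right cong: sum.cong)
    moreover have "x = 0" if x: "T x = 0" for x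
    proof -
      have "\<bar>D f q x - D f q0 x\<bar> \<le> (\<Sum>b\<in>Basis. \<bar>D f q b - D f q0 b\<bar>) * norm x" if f: "f \<in> A" for f
      proof -
        have ex: "D f q' x = (\<Sum>b\<in>Basis. (x \<bullet> b) * D f q' b)" for q'
        proof -
          have "D f q' x = D f q' (\<Sum>b\<in>Basis. (x \<bullet> b) *\<^sub>R b)" by (simp add: euclidean_representation)
          then show ?thesis by (simp add: linear_sum[OF lin[OF f]] linear_cmul[OF lin[OF f]])
        qed
        have "\<bar>D f q x - D f q0 x\<bar> = \<bar>\<Sum>b\<in>Basis. (x \<bullet> b) * (D f q b - D f q0 b)\<bar>"
          by (simp add: ex[of q] ex[of q0] sum_subtractf algebra_simps)
        also have "\<dots> \<le> (\<Sum>b\<in>Basis. \<bar>x \<bullet> b\<bar> * \<bar>D f q b - D f q0 b\<bar>)"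
          using sum_abs[of "\<lambda>b. (x \<bullet> b) * (D f q b - D f q0 b)" Basis] by (simp add: abs_mult)
        also have "\<dots> \<le> (\<Sum>b\<in>Basis. norm x * \<bar>D f q b - D f q0 b\<bar>)"
          by (intro sum_mono mult_right_mono Basis_le_norm) auto
        finally show ?thesis by (simp add: sum_distrib_left mult.commute)
      qed
      then have "norm (\<Sum>f\<in>A. (D f q x - D f q0 x) *\<^sub>R v f) \<le> (\<Sum>f\<in>A. (\<Sum>b\<in>Basis. \<bar>D f q b - D f q0 b\<bar>) * norm x * norm (v f))"
        by (intro sum_norm_le) (auto intro: mult_right_mono)
      also have "\<dots> = c q * norm x"
        by (simp add: c_def sum_distrib_left sum_distrib_right mult_ac)
      finally have "norm (\<Sum>f\<in>A. (D f q x - D f q0 x) *\<^sub>R v f) \<le> c q * norm x" .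
      moreover have "norm x = norm (\<Sum>f\<in>A. (D f q x - D f q0 x) *\<^sub>R v f)"
      proof -
        have "x = - (\<Sum>f\<in>A. (D f q x - D f q0 x) *\<^sub>R v f)"
          using x by (simp add: T_def eq_neg_iff_add_eq_0[symmetric])
        from arg_cong[OF this, of norm] show ?thesis by (simp only: norm_minus_cancel)
      qed
      ultimately have le: "norm x \<le> c q * norm x" by simp
      show "x = 0"
      proof (rule ccontr)
        assume "x \<noteq> 0"
        then have "c q * norm x < 1 * norm x" using q by (intro mult_strict_right_mono) (auto simp: N_def)
        then show False using le by simp
      qed
    qed
    ultimately have "surj T"
      by (intro linear_injective_imp_surjective) (auto simp: linear_injective_0)
    then have T: "T (inv_into UNIV T (v g)) = v g" for g by (rule surj_f_inv_f)
    have DT: "D f q0 (T x) = D f q x" if f: "f \<in> A" for f x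
      unfolding T_def linear_add[OF lin[OF f]] dual_basis_pick[OF dual fin subset_refl f lin[OF f]] using f by simp
    have "dual_basis (\<lambda>f. D f q) A (\<lambda>g. inv_into UNIV T (v g))"
      unfolding dual_basis_def
    proof (intro ballI)
      fix f g assume "f \<in> A" "g \<in> A"
      then show "D f q (inv_into UNIV T (v g)) = (if f = g then 1 else 0)"
        using dual T[of g] DT[of f "inv_into UNIV T (v g)"] by (auto simp: dual_basis_def)
    qed
    then show ?thesis by blast
  qed
  ultimately show ?thesis by (rule that)
qed

lemma minimal_subset:
  assumes "finite S" "P S"
  obtains U where "U \<subseteq> S" "P U" "\<And>u. u \<in> U \<Longrightarrow> \<not> P (U - {u})"
proof -
  define U where "U = arg_min card (\<lambda>U. U \<subseteq> S \<and> P U)"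
  have U: "U \<subseteq> S \<and> P U" unfolding U_def by (rule arg_min_natI[of _ S]) (use assms in auto)
  have "\<not> P (U - {u})" if u: "u \<in> U" for u
  proof
    assume "P (U - {u})"
    then have "card U \<le> card (U - {u})"
      unfolding U_def by (intro arg_min_nat_le) (use U in \<open>auto simp: U_def\<close>)
    moreover have "card (U - {u}) < card U"
      using u finite_subset[OF conjunct1[OF U] assms(1)] by (intro psubset_card_mono) auto
    ultimately show False by simp
  qed
  with U show ?thesis using that by blast
qed

text \<open>Selecting minimal subfamilies makes the functionals of \<open>U \<union> W \<union> C'\<close> triangular with respect to
  suitable vectors; clearing the off-diagonal entries gives the dual basis.\<close>

lemma dual_selection:
  fixes D :: "'i \<Rightarrow> 'a::euclidean_space \<Rightarrow> real"
  assumes fin: "finite L" "finite W" "finite C"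
    and lin: "\<And>f. f \<in> L \<union> W \<union> C \<Longrightarrow> linear (D f)"
    and dW: "dual_basis D W vW" "\<And>u w. u \<in> L \<Longrightarrow> w \<in> W \<Longrightarrow> D u (vW w) = 0"
    and kerC: "\<And>v. (\<And>c. c \<in> C \<Longrightarrow> D c v = 0) \<Longrightarrow> v = 0"
  obtains U C' v where "U \<subseteq> L" "C' \<subseteq> C" "U \<inter> W = {}" "C' \<inter> (U \<union> W) = {}"
    "dual_basis D (U \<union> W \<union> C') v"
    "\<And>x u. (\<And>u. u \<in> U \<Longrightarrow> D u x = 0) \<Longrightarrow> u \<in> L \<Longrightarrow> D u x = 0"
    "\<And>x. (\<And>f. f \<in> U \<union> W \<union> C' \<Longrightarrow> D f x = 0) \<Longrightarrow> x = 0"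
proof -
  \<comment> \<open>A minimal \<open>U\<close> with the common kernel of \<open>L\<close> is
    independent: dropping \<open>u\<close> enlarges the kernel by a vector on which, within
    \<open>U\<close>, only \<open>u\<close> is nonzero.\<close>
  define P where "P U \<longleftrightarrow> (\<forall>x. (\<forall>u\<in>U. D u x = 0) \<longrightarrow> (\<forall>u\<in>L. D u x = 0))" for U
  have "P L" by (simp add: P_def)
  then obtain U where U: "U \<subseteq> L" "P U" "\<And>u. u \<in> U \<Longrightarrow> \<not> P (U - {u})"
    using minimal_subset[OF fin(1), of P] by blast
  define R where "R C' \<longleftrightarrow> (\<forall>x. (\<forall>f\<in>U \<union> W \<union> C'. D f x = 0) \<longrightarrow> x = 0)" for C'
  have "R C" using kerC by (auto simp: R_def)
  then obtain C' where C': "C' \<subseteq> C" "R C'" "\<And>c. c \<in> C' \<Longrightarrow> \<not> R (C' - {c})"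
    using minimal_subset[OF fin(3), of R] by blast
  have finU: "finite U" "finite C'" using finite_subset[OF U(1) fin(1)] finite_subset[OF C'(1) fin(3)] by auto
  have UW: "U \<inter> W = {}"
  proof (rule ccontr)
    assume "U \<inter> W \<noteq> {}"
    then obtain f where "f \<in> U" "f \<in> W" by blast
    then show False using dW U(1) by (force simp: dual_basis_def)
  qed
  have exc: "\<exists>x. D c x = 1 \<and> (\<forall>f\<in>U \<union> W \<union> (C' - {c}). D f x = 0) \<and> c \<notin> U \<union> W" if c: "c \<in> C'" for c
  proof -
    obtain x where x: "\<forall>f\<in>U \<union> W \<union> (C' - {c}). D f x = 0" "x \<noteq> 0"
      using C'(3)[OF c] unfolding R_def by blast
    have "D c x \<noteq> 0" using x C'(2) unfolding R_def by blast
    moreover have "linear (D f)" if "f \<in> U \<union> W \<union> C'" for f using lin that U C' by blast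
    ultimately show ?thesis using x c
      by (intro exI[of _ "(1 / D c x) *\<^sub>R x"]) (auto simp: linear_cmul)
  qed
  then obtain vC where vC: "\<And>c. c \<in> C' \<Longrightarrow> D c (vC c) = 1"
    "\<And>c f. c \<in> C' \<Longrightarrow> f \<in> U \<union> W \<union> C' \<Longrightarrow> f \<noteq> c \<Longrightarrow> D f (vC c) = 0" by (metis DiffI UnE UnI1 UnI2 singletonD)
  have CUW: "C' \<inter> (U \<union> W) = {}" using exc by blast
  have exu: "\<exists>x. D u x = 1 \<and> (\<forall>f\<in>U - {u}. D f x = 0)" if u: "u \<in> U" for u
  proof -
    obtain x where x: "\<forall>f\<in>U - {u}. D f x = 0" "\<not> (\<forall>f\<in>L. D f x = 0)"
      using U(3)[OF u] unfolding P_def by blast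
    have "D u x \<noteq> 0" using x U(2) unfolding P_def by blast
    moreover have "linear (D f)" if "f \<in> U" for f using lin that U by blast
    ultimately show ?thesis using x u
      by (intro exI[of _ "(1 / D u x) *\<^sub>R x"]) (auto simp: linear_cmul)
  qed
  then obtain vU where vU: "\<And>u. u \<in> U \<Longrightarrow> D u (vU u) = 1" "\<And>u f. u \<in> U \<Longrightarrow> f \<in> U \<Longrightarrow> f \<noteq> u \<Longrightarrow> D f (vU u) = 0"
    by (metis DiffI singletonD)
  have linA: "linear (D f)" if "f \<in> U \<union> W \<union> C'" for f using lin that U C' by blast
  define clC where "clC x = x - (\<Sum>c\<in>C'. D c x *\<^sub>R vC c)" for x
  have clC: "D f (clC x) = (if f \<in> C' then 0 else D f x)" if f: "f \<in> U \<union> W \<union> C'" for f x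
  proof -
    have "D f (clC x) = D f x - (\<Sum>c\<in>C'. D c x * D f (vC c))"
      by (simp add: clC_def linear_diff[OF linA[OF f]] linear_sum[OF linA[OF f]] linear_cmul[OF linA[OF f]])
    also have "(\<Sum>c\<in>C'. D c x * D f (vC c)) = (\<Sum>c\<in>C'. if c = f then D c x else 0)"
      by (rule sum.cong) (use vC f in auto)
    finally show ?thesis using finU by (simp add: sum.delta)
  qed
  define clW where "clW x = x - (\<Sum>w\<in>W. D w x *\<^sub>R clC (vW w))" for x
  have clW: "D f (clW x) = (if f \<in> W then 0 else D f x)" if f: "f \<in> U \<union> W" for f x
  proof -
    have fA: "f \<in> U \<union> W \<union> C'" "f \<notin> C'" using f CUW by auto
    have "D f (clW x) = D f x - (\<Sum>w\<in>W. D w x * D f (clC (vW w)))"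
      by (simp add: clW_def linear_diff[OF linA[OF fA(1)]] linear_sum[OF linA[OF fA(1)]] linear_cmul[OF linA[OF fA(1)]])
    also have "(\<Sum>w\<in>W. D w x * D f (clC (vW w))) = (\<Sum>w\<in>W. if w = f then D w x else 0)"
    proof (rule sum.cong[OF refl])
      fix w assume w: "w \<in> W"
      have "D f (vW w) = (if w = f then 1 else 0)"
        using f w dW U(1) UW by (auto simp: dual_basis_def)
      then show "D w x * D f (clC (vW w)) = (if w = f then D w x else 0)"
        using clC[OF fA(1)] fA(2) by simp
    qed
    finally show ?thesis using fin by (simp add: sum.delta)
  qed
  \<comment> \<open>The \<open>C'\<close> entries are cleared last: the vectors \<open>vC\<close>
    are annihilated by the functionals in \<open>U\<close> and \<open>W\<close>, so this disturbs
    nothing that was cleared before.\<close>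
  define v where "v f = (if f \<in> C' then vC f else if f \<in> W then clC (vW f) else clC (clW (vU f)))" for f
  have "dual_basis D (U \<union> W \<union> C') v"
    unfolding dual_basis_def
  proof (intro ballI)
    fix f g assume f: "f \<in> U \<union> W \<union> C'" and g: "g \<in> U \<union> W \<union> C'"
    consider "g \<in> C'" | "g \<notin> C'" "g \<in> W" | "g \<notin> C'" "g \<notin> W" "g \<in> U" using g by blast
    then show "D f (v g) = (if f = g then 1 else 0)"
    proof cases
      case 1
      then show ?thesis using vC f by (auto simp: v_def)
    next
      case 2
      then have "D f (vW g) = (if f = g then 1 else 0)" if "f \<notin> C'"
        using f that dW U(1) UW by (auto simp: dual_basis_def)
      then show ?thesis using 2 clC[OF f] by (auto simp: v_def)
    next
      case 3
      show ?thesis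
      proof (cases "f \<in> C'")
        case True
        then show ?thesis using 3 clC[OF f] by (auto simp: v_def)
      next
        case False
        then have f': "f \<in> U \<union> W" using f by blast
        show ?thesis using 3 clC[OF f] False clW[OF f'] vU f' by (auto simp: v_def)
      qed
    qed
  qed
  then show ?thesis
    using that[OF U(1) C'(1) UW CUW] U(2) C'(2) unfolding P_def R_def by blast
qed

text \<open>The functionals that fail to separate a given pair form a hyperplane, and finitely many
  hyperplanes have measure zero.\<close>

lemma separating_functional:
  fixes S :: "'a::euclidean_space set"
  assumes "finite S"
  obtains u where "inj_on (\<lambda>p. p \<bullet> u) S"
proof -
  define N where "N = (\<Union>(p, q)\<in>{(p, q) \<in> S \<times> S. p \<noteq> q}. {u. (p - q) \<bullet> u = 0})"
  have "negligible N"
    unfolding N_def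
  proof (intro negligible_Union finite_imageI)
    show "finite {(p, q) \<in> S \<times> S. p \<noteq> q}"
      using assms by (auto intro: finite_subset[of _ "S \<times> S"])
  qed (auto intro!: negligible_hyperplane)
  then have "N \<noteq> UNIV" using non_negligible_UNIV by metis
  then obtain u where "u \<notin> N" by blast
  then have "inj_on (\<lambda>p. p \<bullet> u) S"
    unfolding inj_on_def N_def by (force simp: inner_diff_left)
  then show ?thesis by (rule that)
qed

lemma pdeg_derivative_continuous:
  fixes f :: "'a::euclidean_space \<Rightarrow> real"
  assumes "pdeg n f"
  shows "continuous_on UNIV (\<lambda>x. frechet_derivative f (at x) v)"
proof -
  have "\<exists>f'. (\<forall>x. (f has_derivative f' x) (at x)) \<and> (\<forall>v. continuous_on UNIV (\<lambda>x. f' x v))"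
    using assms
  proof induction
    case (const n c)
    show ?case by (rule exI[of _ "\<lambda>x v. 0"]) auto
  next
    case (lin f n)
    show ?case by (rule exI[of _ "\<lambda>x. f"]) (auto intro: bounded_linear_imp_has_derivative lin)
  next
    case (add n f g)
    then obtain f' g' where f': "\<And>x. (f has_derivative f' x) (at x)" "\<And>v. continuous_on UNIV (\<lambda>x. f' x v)"
      and g': "\<And>x. (g has_derivative g' x) (at x)" "\<And>v. continuous_on UNIV (\<lambda>x. g' x v)" by blast
    show ?case
      by (rule exI[of _ "\<lambda>x v. f' x v + g' x v"]) (auto intro: has_derivative_add f' g' continuous_on_add)
  next
    case (mult m f n g)
    then obtain f' g' where f': "\<And>x. (f has_derivative f' x) (at x)" "\<And>v. continuous_on UNIV (\<lambda>x. f' x v)"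
      and g': "\<And>x. (g has_derivative g' x) (at x)" "\<And>v. continuous_on UNIV (\<lambda>x. g' x v)" by blast
    show ?case
    proof (intro exI[of _ "\<lambda>x v. f x * g' x v + f' x v * g x"] conjI allI)
      show "((\<lambda>x. f x * g x) has_derivative (\<lambda>v. f x * g' x v + f' x v * g x)) (at x)" for x
        by (rule has_derivative_mult[OF f'(1) g'(1)])
      show "continuous_on UNIV (\<lambda>x. f x * g' x v + f' x v * g x)" for v
        by (rule continuous_on_add[OF continuous_on_mult[OF pdeg_continuous_on[OF mult.hyps(1)] g'(2)]
              continuous_on_mult[OF f'(2) pdeg_continuous_on[OF mult.hyps(2)]]])
    qed
  qed
  then obtain f' where f': "(\<forall>x. (f has_derivative f' x) (at x)) \<and> (\<forall>v. continuous_on UNIV (\<lambda>x. f' x v))" by (rule exE)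
  then have "frechet_derivative f (at x) = f' x" for x
    using frechet_derivative_at[of f "f' x" x] by simp
  then show ?thesis using f' by simp
qed

lemma pdeg_bounded_bilinear:
  fixes h :: "'a::euclidean_space \<Rightarrow> 'b::euclidean_space \<Rightarrow> 'c::euclidean_space"
  assumes "bounded_bilinear h"
  shows "pdeg 2 (\<lambda>q. h (fst q) (snd q) \<bullet> c)"
proof -
  interpret bounded_bilinear h by fact
  have hxy: "h x y = (\<Sum>i\<in>Basis. \<Sum>j\<in>Basis. ((x \<bullet> i) * (y \<bullet> j)) *\<^sub>R h i j)" for x y
  proof -
    have "h x y = h (\<Sum>i\<in>Basis. (x \<bullet> i) *\<^sub>R i) (\<Sum>j\<in>Basis. (y \<bullet> j) *\<^sub>R j)"
      by (simp add: euclidean_representation)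
    also have "\<dots> = (\<Sum>j\<in>Basis. \<Sum>i\<in>Basis. ((x \<bullet> i) * (y \<bullet> j)) *\<^sub>R h i j)"
      by (simp add: sum_left sum_right scaleR_left scaleR_right scaleR_sum_right mult.commute)
    also have "\<dots> = (\<Sum>i\<in>Basis. \<Sum>j\<in>Basis. ((x \<bullet> i) * (y \<bullet> j)) *\<^sub>R h i j)"
      by (rule sum.swap)
    finally show ?thesis .
  qed
  have eq: "(\<lambda>q. h (fst q) (snd q) \<bullet> c) = (\<lambda>q. \<Sum>i\<in>Basis. \<Sum>j\<in>Basis. (h i j \<bullet> c) * ((fst q \<bullet> i) * (snd q \<bullet> j)))"
  proof
    fix q
    have "h (fst q) (snd q) \<bullet> c = (\<Sum>i\<in>Basis. \<Sum>j\<in>Basis. ((fst q \<bullet> i) * (snd q \<bullet> j)) *\<^sub>R h i j) \<bullet> c"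
      by (rule arg_cong[OF hxy])
    also have "\<dots> = (\<Sum>i\<in>Basis. \<Sum>j\<in>Basis. (h i j \<bullet> c) * ((fst q \<bullet> i) * (snd q \<bullet> j)))"
      by (simp add: inner_sum_left mult_ac)
    finally show "h (fst q) (snd q) \<bullet> c = (\<Sum>i\<in>Basis. \<Sum>j\<in>Basis. (h i j \<bullet> c) * ((fst q \<bullet> i) * (snd q \<bullet> j)))" .
  qed
  have 1: "pdeg (Suc 0) (\<lambda>q :: 'a \<times> 'b. fst q \<bullet> i)" for i
    by (intro pdeg.lin bounded_linear_inner_left_comp bounded_linear_fst)
  have 2: "pdeg (Suc 0) (\<lambda>q :: 'a \<times> 'b. snd q \<bullet> i)" for i
    by (intro pdeg.lin bounded_linear_inner_left_comp bounded_linear_snd)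
  have 3: "pdeg 2 (\<lambda>q :: 'a \<times> 'b. (fst q \<bullet> i) * (snd q \<bullet> j))" for i j
    using pdeg.mult[OF 1 2, of i j] by (simp add: numeral_2_eq_2)
  show ?thesis
    unfolding eq by (rule pdeg_sum, rule pdeg_sum, rule pdeg_cmult, rule 3)
qed

lemma matrix_exp_linear_has_derivative:
  fixes f :: "'a::real_normed_vector \<Rightarrow> complex ^ 'n ^ 'n"
  assumes "bounded_linear f" "f q = 0"
  shows "((\<lambda>z. matrix_exp (f z)) has_derivative f) (at q)"
  using has_derivative_compose[OF bounded_linear_imp_has_derivative[OF assms(1), of "at q"], of matrix_exp "\<lambda>v. v"]
    matrix_exp_has_derivative_0 assms(2) by simp

section \<open>Orbits of a pair of closed subgroups\<close>

text \<open>The Zariski closure of \<open>\<Gamma>\<close>, over the reals, has no more one-parameter subgroups than \<open>\<Gamma>\<close>.\<close>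

definition zariski_Lie_closed :: "(complex ^ 'n ^ 'n) set \<Rightarrow> bool" where
  "zariski_Lie_closed \<Gamma> \<longleftrightarrow>
     (\<forall>X. (\<forall>t m. \<forall>f\<in>vanishing m \<Gamma>. f (matrix_exp (t *\<^sub>R X)) = 0) \<longrightarrow> X \<in> cLie \<Gamma>)"

definition orbit_tangent ::
    "(complex ^ 'n ^ 'n) set \<Rightarrow> (complex ^ 'n ^ 'n) set \<Rightarrow> complex ^ 'n ^ 'n \<Rightarrow> (complex ^ 'n ^ 'n) set" where
  "orbit_tangent A K p = {X ** p + p ** Y | X Y. X \<in> cLie A \<and> Y \<in> cLie K}"

lemma invertible_cancel:
  fixes a :: "complex ^ 'n ^ 'n"
  assumes "invertible a"
  shows "matrix_inv a ** (a ** x) = x" "a ** (matrix_inv a ** x) = x"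
    "(x ** a) ** matrix_inv a = x" "(x ** matrix_inv a) ** a = x"
  using matrix_inv_mult[OF assms] by (simp_all add: matrix_mul_assoc) (simp_all flip: matrix_mul_assoc)

lemma invertible_mult_cancel:
  fixes a :: "complex ^ 'n ^ 'n"
  assumes "invertible a"
  shows "x ** a = y ** a \<Longrightarrow> x = y" "a ** x = a ** y \<Longrightarrow> x = y"
proof -
  assume "x ** a = y ** a"
  then have "(x ** a) ** matrix_inv a = (y ** a) ** matrix_inv a" by (rule arg_cong)
  then show "x = y" unfolding invertible_cancel(3)[OF assms] .
next
  assume "a ** x = a ** y"
  then have "matrix_inv a ** (a ** x) = matrix_inv a ** (a ** y)" by (rule arg_cong)
  then show "x = y" unfolding invertible_cancel(1)[OF assms] .
qed

text \<open>To be applied with the image of \<open>L\<close> for \<open>A\<close> and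
  \<open>H^C\<close> for \<open>K\<close>; the double orbits lift the orbits of \<open>L\<close> in
  the quotient by \<open>H^C\<close>.\<close>

locale closed_subgroup_pair =
  fixes A K :: "(complex ^ 'n ^ 'n) set"
  assumes A: "subgroup A GL" "closedin (top_of_set (carrier GL)) A" "zariski_Lie_closed A"
    and K: "subgroup K GL" "closedin (top_of_set (carrier GL)) K" "zariski_Lie_closed K"
begin

lemmas GA = subgroup_GL_D[OF A(1)]
lemmas GK = subgroup_GL_D[OF K(1)]
lemmas subA = subspace_cLie[OF A(1,2)]
lemmas subK = subspace_cLie[OF K(1,2)]

lemma subspace_orbit_tangent: "subspace (orbit_tangent A K p)"
proof (rule subspaceI)
  show "0 \<in> orbit_tangent A K p"
    using subspace_0[OF subA] subspace_0[OF subK] by (force simp: orbit_tangent_def matrix_mult_simps)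
next
  fix x y assume "x \<in> orbit_tangent A K p" "y \<in> orbit_tangent A K p"
  then obtain X Y X' Y' where "X \<in> cLie A" "Y \<in> cLie K" "X' \<in> cLie A" "Y' \<in> cLie K"
    "x = X ** p + p ** Y" "y = X' ** p + p ** Y'" by (auto simp: orbit_tangent_def)
  then show "x + y \<in> orbit_tangent A K p"
    unfolding orbit_tangent_def
    by (intro CollectI exI[of _ "X + X'"] exI[of _ "Y + Y'"])
       (simp add: matrix_mult_simps subspace_add[OF subA] subspace_add[OF subK])
next
  fix c :: real and x assume "x \<in> orbit_tangent A K p"
  then obtain X Y where "X \<in> cLie A" "Y \<in> cLie K" "x = X ** p + p ** Y" by (auto simp: orbit_tangent_def)
  then show "c *\<^sub>R x \<in> orbit_tangent A K p"
    unfolding orbit_tangent_def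
    by (intro CollectI exI[of _ "c *\<^sub>R X"] exI[of _ "c *\<^sub>R Y"])
       (simp add: matrix_mult_simps scaleR_add_right subspace_scale[OF subA] subspace_scale[OF subK])
qed

text \<open>Both Lie algebras are stable under conjugation by their groups. In consequence the
  dimension of the tangent space is constant along a double orbit.\<close>

lemma orbit_tangent_translate:
  assumes a: "a \<in> A" and b: "b \<in> K"
  shows "orbit_tangent A K (a ** g ** b) = (\<lambda>v. a ** v ** b) ` orbit_tangent A K g"
proof (intro equalityI subsetI)
  note ia = invertible_cancel[OF GA(3)[OF a]] and ib = invertible_cancel[OF GK(3)[OF b]]
  fix z assume "z \<in> orbit_tangent A K (a ** g ** b)"
  then obtain X Y where XY: "X \<in> cLie A" "Y \<in> cLie K" "z = X ** (a ** g ** b) + (a ** g ** b) ** Y"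
    by (auto simp: orbit_tangent_def)
  have "matrix_inv a ** X ** a \<in> cLie A" "b ** Y ** matrix_inv b \<in> cLie K"
    using XY a b GA GK
    by (auto intro!: cLie_Ad[OF A(1)] cLie_Ad[OF K(1)] simp: matrix_inv_mult)
  then have "(matrix_inv a ** X ** a) ** g + g ** (b ** Y ** matrix_inv b) \<in> orbit_tangent A K g"
    by (auto simp: orbit_tangent_def)
  moreover have "z = a ** ((matrix_inv a ** X ** a) ** g + g ** (b ** Y ** matrix_inv b)) ** b"
    using ia ib by (simp add: XY(3) matrix_mult_simps matrix_mul_assoc[symmetric])
  ultimately show "z \<in> (\<lambda>v. a ** v ** b) ` orbit_tangent A K g" by blast
next
  note ia = invertible_cancel[OF GA(3)[OF a]] and ib = invertible_cancel[OF GK(3)[OF b]]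
  fix z assume "z \<in> (\<lambda>v. a ** v ** b) ` orbit_tangent A K g"
  then obtain X Y where XY: "X \<in> cLie A" "Y \<in> cLie K" "z = a ** (X ** g + g ** Y) ** b"
    by (auto simp: orbit_tangent_def)
  have "a ** X ** matrix_inv a \<in> cLie A" "matrix_inv b ** Y ** b \<in> cLie K"
    using XY a b GA GK
    by (auto intro!: cLie_Ad[OF A(1)] cLie_Ad[OF K(1)] simp: matrix_inv_mult)
  moreover have "z = (a ** X ** matrix_inv a) ** (a ** g ** b) + (a ** g ** b) ** (matrix_inv b ** Y ** b)"
    using ia ib by (simp add: XY(3) matrix_mult_simps matrix_mul_assoc[symmetric])
  ultimately show "z \<in> orbit_tangent A K (a ** g ** b)" by (auto simp: orbit_tangent_def)
qed

lemma dim_orbit_tangent_translate: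
  assumes a: "a \<in> A" and b: "b \<in> K"
  shows "dim (orbit_tangent A K (a ** g ** b)) = dim (orbit_tangent A K g)"
  unfolding orbit_tangent_translate[OF assms]
proof (rule dim_image_eq)
  show "linear (\<lambda>v. a ** v ** b)"
    by (rule linearI) (simp_all add: matrix_mult_simps)
  show "inj_on (\<lambda>v. a ** v ** b) (span (orbit_tangent A K g))"
  proof (rule inj_onI)
    fix x y assume "a ** x ** b = a ** y ** b"
    then have "a ** x = a ** y" by (rule invertible_mult_cancel(1)[OF GK(3)[OF b]])
    then show "x = y" by (rule invertible_mult_cancel(2)[OF GA(3)[OF a]])
  qed
qed

text \<open>The tangent space of \<open>A \<times> K\<close> at \<open>q\<close>, trivialised from
  the outer sides: moving along \<open>(X, Y)\<close> multiplies \<open>fst q ** g ** snd q\<close>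
  by exponentials on the far left and far right.\<close>

definition product_tangent :: "(complex ^ 'n ^ 'n) \<times> (complex ^ 'n ^ 'n) \<Rightarrow> ((complex ^ 'n ^ 'n) \<times> (complex ^ 'n ^ 'n)) set" where
  "product_tangent q = (\<lambda>z. (fst z ** fst q, snd q ** snd z)) ` (cLie A \<times> cLie K)"

lemma linear_product_tangent: "linear (\<lambda>z. (fst z ** a, b ** snd z))" for a b :: "complex ^ 'n ^ 'n"
  by (rule linearI) (simp_all add: matrix_mult_simps)

lemma dim_product_tangent:
  assumes "q \<in> A \<times> K"
  shows "dim (product_tangent q) = dim (cLie A \<times> cLie K)"
  unfolding product_tangent_def
proof (rule dim_image_eq[OF linear_product_tangent])
  show "inj_on (\<lambda>z. (fst z ** fst q, snd q ** snd z)) (span (cLie A \<times> cLie K))"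
  proof (rule inj_onI)
    fix x y :: "(complex ^ 'n ^ 'n) \<times> (complex ^ 'n ^ 'n)"
    assume "(fst x ** fst q, snd q ** snd x) = (fst y ** fst q, snd q ** snd y)"
    then have "fst x ** fst q = fst y ** fst q" "snd q ** snd x = snd q ** snd y" by auto
    moreover have "invertible (fst q)" "invertible (snd q)" using assms GA(3) GK(3) by auto
    ultimately have "fst x = fst y" "snd x = snd y"
      by (blast dest: invertible_mult_cancel)+
    then show "x = y" by (rule prod_eqI)
  qed
qed

lemma subspace_product_tangent: "subspace (product_tangent q)"
  unfolding product_tangent_def by (intro linear_subspace_image linear_product_tangent subspace_Times subA subK)

text \<open>For \<open>S\<close> the stabiliser of an orbit point this moves \<open>q\<close> inside
  a fibre of the orbit map; for \<open>S\<close> the full Lie algebra it moves the orbit point. In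
  both cases the new point stays in the group, which a move in the ambient space would not
  ensure.\<close>

lemma move_along_group:
  assumes q: "q \<in> A \<times> K" and S: "subspace S" "S \<subseteq> cLie A \<times> cLie K"
    and F: "finite F" "\<And>f. f \<in> F \<Longrightarrow> pdeg n f"
    and v: "dual_basis (\<lambda>f. frechet_derivative f (at q)) F (\<lambda>f. (fst (z f) ** fst q, snd q ** snd (z f)))"
    and z: "\<And>f. f \<in> F \<Longrightarrow> z f \<in> S" and \<epsilon>: "\<epsilon> > 0"
  shows "\<exists>\<delta>>0. \<forall>y. (\<forall>f\<in>F. \<bar>y f - f q\<bar> < \<delta>) \<longrightarrow>
    (\<exists>x\<in>S. dist (matrix_exp (fst x) ** fst q, snd q ** matrix_exp (snd x)) q < \<epsilon> \<and>
      (\<forall>f\<in>F. f (matrix_exp (fst x) ** fst q, snd q ** matrix_exp (snd x)) = y f))"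
proof -
  obtain P where P: "bounded_linear P" "\<And>x. P x \<in> S" "\<And>x. x \<in> S \<Longrightarrow> P x = x"
    using obtain_projection[OF S(1)] by blast
  note P0 = linear_0[OF bounded_linear.linear[OF P(1)]]
  define \<tau> where "\<tau> x = (matrix_exp (fst (P x)) ** fst q, snd q ** matrix_exp (snd (P x)))" for x
  have \<tau>0: "\<tau> 0 = q" by (simp add: \<tau>_def P0)
  have cont: "continuous_on UNIV \<tau>"
    unfolding \<tau>_def by (intro continuous_intros bounded_linear.continuous_on[OF P(1)])
  have der: "(\<tau> has_derivative (\<lambda>x. (fst (P x) ** fst q, snd q ** snd (P x)))) (at 0)"
  proof -
    have l1: "bounded_linear (\<lambda>x. fst (P x))" and l2: "bounded_linear (\<lambda>x. snd (P x))"
      by (auto intro: bounded_linear_compose[OF bounded_linear_fst P(1)] bounded_linear_compose[OF bounded_linear_snd P(1)])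
    have e1: "((\<lambda>x. matrix_exp (fst (P x))) has_derivative (\<lambda>x. fst (P x))) (at 0)"
      by (rule matrix_exp_linear_has_derivative[OF l1]) (simp add: P0)
    have e2: "((\<lambda>x. matrix_exp (snd (P x))) has_derivative (\<lambda>x. snd (P x))) (at 0)"
      by (rule matrix_exp_linear_has_derivative[OF l2]) (simp add: P0)
    show ?thesis
      unfolding \<tau>_def
      by (intro has_derivative_Pair bounded_linear.has_derivative[OF bounded_linear_matrix_mult(2) e1]
          bounded_linear.has_derivative[OF bounded_linear_matrix_mult(1) e2])
  qed
  define N where "N = \<tau> -` ball q \<epsilon>"
  have N: "open N" "0 \<in> N"
    using cont \<epsilon> by (auto simp: N_def \<tau>0 intro: open_vimage)
  have c: "continuous_on N (\<lambda>x. f (\<tau> x))" if "f \<in> F" for f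
    by (rule continuous_on_compose2[OF pdeg_continuous_on[OF F(2)[OF that], of UNIV] continuous_on_subset[OF cont]]) auto
  have d: "((\<lambda>x. f (\<tau> x)) has_derivative (\<lambda>x. frechet_derivative f (at q) (fst (P x) ** fst q, snd q ** snd (P x)))) (at 0)"
    if "f \<in> F" for f
    using has_derivative_compose[OF der, of f "frechet_derivative f (at q)"] pdeg_has_derivative[OF F(2)[OF that]]
    by (simp add: \<tau>0)
  have dual: "dual_basis (\<lambda>f x. frechet_derivative f (at q) (fst (P x) ** fst q, snd q ** snd (P x))) F z"
    using v P(3)[OF z] by (simp add: dual_basis_def)
  from open_map_family[of F N 0 "\<lambda>f x. f (\<tau> x)", OF F(1) N c d dual zero_less_one]
  obtain \<delta> where \<delta>: "\<delta> > 0 \<and>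
    (\<forall>y. (\<forall>f\<in>F. \<bar>y f - f (\<tau> 0)\<bar> < \<delta>) \<longrightarrow> (\<exists>x\<in>N. dist x 0 < 1 \<and> (\<forall>f\<in>F. f (\<tau> x) = y f)))"
    by (rule exE)
  show ?thesis
  proof (intro exI[of _ \<delta>] conjI conjunct1[OF \<delta>] allI impI)
    fix y assume "\<forall>f\<in>F. \<bar>y f - f q\<bar> < \<delta>"
    then have "\<forall>f\<in>F. \<bar>y f - f (\<tau> 0)\<bar> < \<delta>" by (simp only: \<tau>0)
    from mp[OF spec[OF conjunct2[OF \<delta>]] this]
    obtain x where x: "x \<in> N" "\<forall>f\<in>F. f (\<tau> x) = y f" by (elim bexE conjE)
    then show "\<exists>x\<in>S. dist (matrix_exp (fst x) ** fst q, snd q ** matrix_exp (snd x)) q < \<epsilon> \<and>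
      (\<forall>f\<in>F. f (matrix_exp (fst x) ** fst q, snd q ** matrix_exp (snd x)) = y f)"
      using P(2)[of x] by (intro bexI[of _ "P x"]) (auto simp: N_def \<tau>_def dist_commute)
  qed
qed

text \<open>Lower semicontinuity of the dimension of the tangent space, with explicit tangent
  vectors at \<open>p\<close> that are dual to \<open>B\<close>.\<close>

lemma orbit_tangent_nearby:
  assumes B: "finite B" "B \<subseteq> orbit_tangent A K p0" "\<And>b c. b \<in> B \<Longrightarrow> c \<in> B \<Longrightarrow> b \<bullet> c = (if b = c then 1 else 0)"
  obtains N where "open N" "p0 \<in> N"
    "\<And>p. p \<in> N \<Longrightarrow> \<exists>X Y. (\<forall>b\<in>B. X b \<in> cLie A \<and> Y b \<in> cLie K) \<and> dual_basis (\<lambda>b x. x \<bullet> b) B (\<lambda>b. X b ** p + p ** Y b)"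
proof -
  obtain P where P: "bounded_linear P" "\<And>x. P x \<in> cLie A \<times> cLie K" "\<And>x. x \<in> cLie A \<times> cLie K \<Longrightarrow> P x = x"
    using obtain_projection[OF subspace_Times[OF subA subK]] by blast
  note Pl = bounded_linear.linear[OF P(1)]
  have "\<exists>z. z \<in> cLie A \<times> cLie K \<and> b = fst z ** p0 + p0 ** snd z" if "b \<in> B" for b
    using B(2) that by (force simp: orbit_tangent_def)
  then obtain z where z: "\<And>b. b \<in> B \<Longrightarrow> z b \<in> cLie A \<times> cLie K" "\<And>b. b \<in> B \<Longrightarrow> b = fst (z b) ** p0 + p0 ** snd (z b)"
    by metis
  define D where "D b p x = (fst (P x) ** p + p ** snd (P x)) \<bullet> b" for b p x
  have lin: "linear (D b p)" for b p
    by (rule linearI) (simp_all add: D_def linear_add[OF Pl] linear_cmul[OF Pl] matrix_mult_simps inner_add_left algebra_simps)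
  have cont: "continuous_on UNIV (\<lambda>p. D b p x)" for b x
    unfolding D_def by (intro continuous_intros)
  have dual: "dual_basis (\<lambda>b. D b p0) B z"
    unfolding dual_basis_def
  proof (intro ballI)
    fix b c assume bc: "b \<in> B" "c \<in> B"
    have "D b p0 (z c) = c \<bullet> b"
      unfolding D_def P(3)[OF z(1)[OF bc(2)]] z(2)[OF bc(2), symmetric] ..
    then show "D b p0 (z c) = (if b = c then 1 else 0)" using B(3)[OF bc(2,1)] by auto
  qed
  obtain N where N: "open N" "p0 \<in> N" "\<And>p. p \<in> N \<Longrightarrow> \<exists>v. dual_basis (\<lambda>b. D b p) B v"
    by (rule dual_open[of B D p0 z, OF B(1) lin cont dual]) (rule that, assumption+)
  show ?thesis
  proof (rule that[OF N(1,2)])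
    fix p assume "p \<in> N"
    then obtain v where v: "dual_basis (\<lambda>b. D b p) B v" using N(3) by blast
    have "dual_basis (\<lambda>b x. x \<bullet> b) B (\<lambda>b. fst (P (v b)) ** p + p ** snd (P (v b)))"
      using v by (simp add: dual_basis_def D_def)
    moreover have "fst (P (v b)) \<in> cLie A \<and> snd (P (v b)) \<in> cLie K" for b
      using P(2)[of "v b"] by (simp add: mem_Times_iff)
    ultimately show "\<exists>X Y. (\<forall>b\<in>B. X b \<in> cLie A \<and> Y b \<in> cLie K) \<and> dual_basis (\<lambda>b x. x \<bullet> b) B (\<lambda>b. X b ** p + p ** Y b)"
      by (intro exI[of _ "\<lambda>b. fst (P (v b))"] exI[of _ "\<lambda>b. snd (P (v b))"]) simp
  qed
qed

text \<open>A nonzero tangent vector orthogonal to \<open>B\<close> would be independent of the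
  \<open>card B\<close> tangent vectors dual to \<open>B\<close>, one more than the dimension
  allows.\<close>

lemma orbit_tangent_transversal:
  assumes B: "finite B" and d: "dim (orbit_tangent A K p) \<le> card B"
    and XY: "\<And>b. b \<in> B \<Longrightarrow> X b \<in> cLie A \<and> Y b \<in> cLie K"
    and dual: "dual_basis (\<lambda>b x. x \<bullet> b) B (\<lambda>b. X b ** p + p ** Y b)"
    and Z: "Z \<in> orbit_tangent A K p" "\<And>b. b \<in> B \<Longrightarrow> Z \<bullet> b = 0"
  shows "Z = 0"
proof (rule ccontr)
  assume "Z \<noteq> 0"
  then have ZZ: "Z \<bullet> Z \<noteq> 0" by simp
  define w where "w b = X b ** p + p ** Y b" for b
  have wT: "w b \<in> orbit_tangent A K p" if "b \<in> B" for b
    using XY[OF that] by (auto simp: w_def orbit_tangent_def)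
  \<comment> \<open>The index \<open>None\<close> stands for \<open>Z\<close>; the other vectors are
    corrected along \<open>Z\<close> to be orthogonal to it, which leaves their products with
    \<open>B\<close> unchanged.\<close>
  define D where "D i x = (case i of None \<Rightarrow> (x \<bullet> Z) / (Z \<bullet> Z) | Some b \<Rightarrow> x \<bullet> b)" for i x
  define v where "v i = (case i of None \<Rightarrow> Z | Some b \<Rightarrow> w b - ((w b \<bullet> Z) / (Z \<bullet> Z)) *\<^sub>R Z)" for i
  have lin: "linear (D i)" for i
    by (rule linearI) (auto simp: D_def inner_add_left add_divide_distrib split: option.splits)
  have "dual_basis D (insert None (Some ` B)) v"
    using dual Z(2) ZZ
    by (auto simp: dual_basis_def D_def v_def w_def[symmetric] inner_diff_left)
  moreover have "v ` insert None (Some ` B) \<subseteq> orbit_tangent A K p"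
    using wT Z(1) by (auto simp: v_def intro!: subspace_diff subspace_scale subspace_orbit_tangent)
  ultimately have "card (insert None (Some ` B)) \<le> dim (orbit_tangent A K p)"
    using B lin by (intro dual_basis_card_le_dim) auto
  moreover have "card (insert None (Some ` B)) = Suc (card B)"
    using B by (subst card_insert_disjoint) (auto simp: card_image)
  ultimately show False using d by simp
qed

end

section \<open>Polynomials that vanish on a group, differentiated along it\<close>

lemma vanishing_derivative_along_group:
  fixes \<Gamma> :: "(complex ^ 'n ^ 'n) set"
  assumes \<Gamma>: "subgroup \<Gamma> GL" and f: "f \<in> vanishing n \<Gamma>" and X: "X \<in> cLie \<Gamma>" and a: "a \<in> \<Gamma>"
  shows "frechet_derivative f (at a) (X ** a) = 0" "frechet_derivative f (at a) (a ** X) = 0"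
proof -
  have pf: "pdeg n f" using f by (simp add: vanishing_def)
  have zero: "frechet_derivative f (at a) y = 0"
    if c: "(c has_vector_derivative y) (at 0)" "c 0 = a" "\<And>t. c t \<in> \<Gamma>" for c y
  proof -
    have "(f has_derivative frechet_derivative f (at a)) (at (c 0) within range c)"
      using pdeg_has_derivative[OF pf, of a] c(2) by (simp add: has_derivative_at_withinI)
    from vector_derivative_diff_chain_within[OF c(1) this]
    have "((\<lambda>t. f (c t)) has_vector_derivative frechet_derivative f (at a) y) (at 0)" by (simp add: o_def)
    moreover have "(\<lambda>t. f (c t)) = (\<lambda>t. 0)" using f c(3) by (auto simp: vanishing_def)
    ultimately have "((\<lambda>t. 0 :: real) has_vector_derivative frechet_derivative f (at a) y) (at 0)" by simp
    then show ?thesis using vector_derivative_unique_at has_vector_derivative_const by blast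
  qed
  have e: "((\<lambda>t. matrix_exp (t *\<^sub>R X)) has_vector_derivative X) (at 0)"
    using matrix_exp_has_vector_derivative[of X 0 UNIV] by simp
  have in\<Gamma>: "matrix_exp (t *\<^sub>R X) \<in> \<Gamma>" for t using X by (simp add: cLie_def)
  show "frechet_derivative f (at a) (X ** a) = 0"
    by (rule zero[of "\<lambda>t. matrix_exp (t *\<^sub>R X) ** a"])
       (use has_vector_derivative_matrix_mult[OF e has_vector_derivative_const[of a]] in
         \<open>simp_all add: matrix_mult_simps subgroup_GL_D[OF \<Gamma>] in\<Gamma> a\<close>)
  show "frechet_derivative f (at a) (a ** X) = 0"
    by (rule zero[of "\<lambda>t. a ** matrix_exp (t *\<^sub>R X)"])
       (use has_vector_derivative_matrix_mult[OF has_vector_derivative_const[of a] e] in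
         \<open>simp_all add: matrix_mult_simps subgroup_GL_D[OF \<Gamma>] in\<Gamma> a\<close>)
qed

context closed_subgroup_pair
begin

definition two_sided_orbit :: "complex ^ 'n ^ 'n \<Rightarrow> (complex ^ 'n ^ 'n) set" where
  "two_sided_orbit g = {a ** g ** b | a b. a \<in> A \<and> b \<in> K}"

lemma two_sided_orbit_exp:
  assumes "p \<in> two_sided_orbit g" "X \<in> cLie A" "Y \<in> cLie K"
  shows "matrix_exp X ** p ** matrix_exp Y \<in> two_sided_orbit g"
proof -
  obtain a b where ab: "a \<in> A" "b \<in> K" "p = a ** g ** b" using assms(1) by (auto simp: two_sided_orbit_def)
  have "matrix_exp X ** p ** matrix_exp Y = (matrix_exp X ** a) ** g ** (b ** matrix_exp Y)"
    by (simp add: ab matrix_mul_assoc)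
  moreover have "matrix_exp X ** a \<in> A" "b ** matrix_exp Y \<in> K"
    using ab GA(2) GK(2) cLie_exp assms by blast+
  ultimately show ?thesis unfolding two_sided_orbit_def by blast
qed

text \<open>An orbit point \<open>p\<close> near \<open>p0\<close> is moved along its own orbit into
  the slice. Prescribing the starting point (\<open>Inr\<close>) together with the slice coordinates
  of the moved point (\<open>Inl\<close>) in one open mapping argument makes the neighbourhood
  independent of \<open>p\<close>.\<close>

lemma orbit_crosses_transversal:
  assumes B: "finite B" "B \<subseteq> orbit_tangent A K p0" "\<And>b c. b \<in> B \<Longrightarrow> c \<in> B \<Longrightarrow> b \<bullet> c = (if b = c then 1 else 0)"
    and cl: "p0 \<in> closure (two_sided_orbit g)" and N: "open N" "p0 \<in> N"
  shows "\<exists>p\<in>two_sided_orbit g \<inter> N. \<forall>b\<in>B. p \<bullet> b = p0 \<bullet> b"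
proof -
  obtain P where P: "bounded_linear P" "\<And>x. P x \<in> cLie A \<times> cLie K" "\<And>x. x \<in> cLie A \<times> cLie K \<Longrightarrow> P x = x"
    using obtain_projection[OF subspace_Times[OF subA subK]] by blast
  note Pl = bounded_linear.linear[OF P(1)]
  have "\<exists>z. z \<in> cLie A \<times> cLie K \<and> b = fst z ** p0 + p0 ** snd z" if "b \<in> B" for b
    using B(2) that by (force simp: orbit_tangent_def)
  then obtain z where z: "\<And>b. b \<in> B \<Longrightarrow> z b \<in> cLie A \<times> cLie K" "\<And>b. b \<in> B \<Longrightarrow> b = fst (z b) ** p0 + p0 ** snd (z b)"
    by metis
  define L where "L x = fst (P x) ** p0 + p0 ** snd (P x)" for x
  have Ll: "linear L"
    by (rule linearI) (simp_all add: L_def linear_add[OF Pl] linear_cmul[OF Pl] matrix_mult_simps algebra_simps)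
  have Lz: "L (z b) = b" if "b \<in> B" for b
    unfolding L_def P(3)[OF z(1)[OF that]] using z(2)[OF that] by simp
  define \<Psi> where "\<Psi> x = matrix_exp (fst (P (fst x))) ** snd x ** matrix_exp (snd (P (fst x)))" for x :: "((complex ^ 'n ^ 'n) \<times> (complex ^ 'n ^ 'n)) \<times> (complex ^ 'n ^ 'n)"
  define q where "q = ((0, 0) :: (complex ^ 'n ^ 'n) \<times> (complex ^ 'n ^ 'n), p0)"
  have P0: "P 0 = 0" "P (0, 0) = 0" using linear_0[OF Pl] by (simp_all add: zero_prod_def)
  have \<Psi>q: "\<Psi> q = p0" by (simp add: \<Psi>_def q_def P0)
  have cont: "continuous_on UNIV \<Psi>"
    unfolding \<Psi>_def by (intro continuous_intros bounded_linear.continuous_on[OF P(1)])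
  have der: "(\<Psi> has_derivative (\<lambda>x. L (fst x) + snd x)) (at q)"
  proof -
    have l1: "bounded_linear (\<lambda>x :: ((complex ^ 'n ^ 'n) \<times> (complex ^ 'n ^ 'n)) \<times> (complex ^ 'n ^ 'n). fst (P (fst x)))"
      and l2: "bounded_linear (\<lambda>x :: ((complex ^ 'n ^ 'n) \<times> (complex ^ 'n ^ 'n)) \<times> (complex ^ 'n ^ 'n). snd (P (fst x)))"
      by (auto intro: bounded_linear_compose[OF bounded_linear_fst bounded_linear_compose[OF P(1) bounded_linear_fst]]
          bounded_linear_compose[OF bounded_linear_snd bounded_linear_compose[OF P(1) bounded_linear_fst]])
    have e1: "((\<lambda>x. matrix_exp (fst (P (fst x)))) has_derivative (\<lambda>x. fst (P (fst x)))) (at q)"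
      by (rule matrix_exp_linear_has_derivative[OF l1]) (simp add: q_def P0)
    have e2: "((\<lambda>x. matrix_exp (snd (P (fst x)))) has_derivative (\<lambda>x. snd (P (fst x)))) (at q)"
      by (rule matrix_exp_linear_has_derivative[OF l2]) (simp add: q_def P0)
    have s: "(snd has_derivative snd) (at q)" by (rule bounded_linear_imp_has_derivative[OF bounded_linear_snd])
    have "(\<Psi> has_derivative (\<lambda>x. (matrix_exp (fst (P (fst q))) ** snd q) ** snd (P (fst x))
        + (matrix_exp (fst (P (fst q))) ** snd x + fst (P (fst x)) ** snd q) ** matrix_exp (snd (P (fst q))))) (at q)"
      unfolding \<Psi>_def by (intro has_derivative_matrix_mult e1 e2 s)
    then show ?thesis by (simp add: q_def P0 L_def add_ac)
  qed
  define f where "f i x = (case i of Inl b \<Rightarrow> \<Psi> x \<bullet> b | Inr e \<Rightarrow> snd x \<bullet> e)"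
    for i :: "complex ^ 'n ^ 'n + complex ^ 'n ^ 'n" and x
  define f' where "f' i x = (case i of Inl b \<Rightarrow> (L (fst x) + snd x) \<bullet> b | Inr e \<Rightarrow> snd x \<bullet> e)"
    for i :: "complex ^ 'n ^ 'n + complex ^ 'n ^ 'n" and x
  \<comment> \<open>A shift \<open>e\<close> of the starting point is compensated by group
    directions that cancel its effect on the coordinates along \<open>B\<close>.\<close>
  define v where "v i = (case i of Inl b \<Rightarrow> (z b, 0) | Inr e \<Rightarrow> (- (\<Sum>b\<in>B. (e \<bullet> b) *\<^sub>R z b), e))"
    for i :: "complex ^ 'n ^ 'n + complex ^ 'n ^ 'n"
  define I where "I = Inl ` B \<union> Inr ` (Basis :: (complex ^ 'n ^ 'n) set)"
  have dual: "dual_basis f' I v"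
  proof -
    have 1: "(L (- (\<Sum>b\<in>B. (e \<bullet> b) *\<^sub>R z b)) + e) \<bullet> c = 0" if "c \<in> B" for e c
    proof -
      have "L (- (\<Sum>b\<in>B. (e \<bullet> b) *\<^sub>R z b)) = - (\<Sum>b\<in>B. (e \<bullet> b) *\<^sub>R b)"
        unfolding linear_neg[OF Ll] linear_sum[OF Ll] linear_cmul[OF Ll] by (simp add: Lz)
      moreover have "(\<Sum>b\<in>B. (e \<bullet> b) *\<^sub>R b) \<bullet> c = (\<Sum>b\<in>B. if b = c then e \<bullet> b else 0)"
        unfolding inner_sum_left by (rule sum.cong) (use B(3) that in auto)
      ultimately show ?thesis using that B(1) by (simp add: inner_diff_left inner_add_left)
    qed
    show ?thesis
      unfolding dual_basis_def I_def
      by (auto simp: f'_def v_def Lz B(3) 1 inner_Basis split: if_splits)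
  qed
  have U: "open (\<Psi> -` N)" "q \<in> \<Psi> -` N" using cont N by (auto simp: \<Psi>q intro: open_vimage)
  have fc: "continuous_on (\<Psi> -` N) (f i)" for i
    unfolding f_def by (cases i) (auto intro!: continuous_intros continuous_on_subset[OF cont])
  have fd: "(f i has_derivative f' i) (at q)" for i
    unfolding f_def f'_def
    by (cases i) (auto intro!: has_derivative_inner_left der bounded_linear_imp_has_derivative bounded_linear_inner_left_comp bounded_linear_snd)
  have "finite I" by (simp add: I_def B)
  from open_map_family[OF this U fc fd dual zero_less_one]
  obtain \<delta> where \<delta>: "\<delta> > 0 \<and> (\<forall>y. (\<forall>i\<in>I. \<bar>y i - f i q\<bar> < \<delta>) \<longrightarrow> (\<exists>x\<in>\<Psi> -` N. dist x q < 1 \<and> (\<forall>i\<in>I. f i x = y i)))"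
    by (rule exE)
  obtain p where p: "p \<in> two_sided_orbit g" "dist p p0 < \<delta>"
    using cl \<delta> by (metis closure_approachable)
  define y where "y i = (case i of Inl b \<Rightarrow> p0 \<bullet> b | Inr e \<Rightarrow> p \<bullet> e)" for i :: "complex ^ 'n ^ 'n + complex ^ 'n ^ 'n"
  have "\<bar>y i - f i q\<bar> < \<delta>" if "i \<in> I" for i
  proof (cases i)
    case (Inl b)
    then show ?thesis using \<delta> by (simp add: y_def f_def \<Psi>q)
  next
    case (Inr e)
    then have e: "e \<in> Basis" using that by (auto simp: I_def)
    have "\<bar>p \<bullet> e - p0 \<bullet> e\<bar> \<le> norm (p - p0)"
      using Basis_le_norm[OF e, of "p - p0"] by (simp add: inner_diff_left)
    then show ?thesis using p(2) Inr by (simp add: y_def f_def q_def dist_norm)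
  qed
  then have "\<exists>x\<in>\<Psi> -` N. dist x q < 1 \<and> (\<forall>i\<in>I. f i x = y i)"
    by (intro mp[OF spec[OF conjunct2[OF \<delta>]]] ballI)
  then obtain x where x: "\<Psi> x \<in> N" "\<And>i. i \<in> I \<Longrightarrow> f i x = y i" by auto
  have "snd x = p"
  proof (rule euclidean_eqI)
    fix e :: "complex ^ 'n ^ 'n" assume "e \<in> Basis"
    then show "snd x \<bullet> e = p \<bullet> e" using x(2)[of "Inr e"] by (simp add: I_def f_def y_def)
  qed
  then have "\<Psi> x \<in> two_sided_orbit g"
    unfolding \<Psi>_def using P(2)[of "fst x"] p(1) by (auto intro!: two_sided_orbit_exp simp: mem_Times_iff)
  moreover have "\<Psi> x \<bullet> b = p0 \<bullet> b" if "b \<in> B" for b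
    using x(2)[of "Inl b"] that by (simp add: I_def f_def y_def)
  ultimately show ?thesis using x(1) by blast
qed

text \<open>Otherwise the orbit meets a slice transversal to it at \<open>p0\<close> in infinitely many points. They lift to
  \<open>A \<times> K\<close>, and the polynomials \<open>W\<close> (coordinates along the tangent space at \<open>p0\<close>) and \<open>t\<close> (a functional
  that separates sufficiently many of the points) satisfy a relation there, which bounds their number.\<close>

lemma orbit_closed_if_minimal:
  assumes g: "invertible g" and cl: "p0 \<in> closure (two_sided_orbit g)"
    and dle: "dim (orbit_tangent A K g) \<le> dim (orbit_tangent A K p0)"
  shows "p0 \<in> two_sided_orbit g"
proof (rule ccontr)
  assume out: "p0 \<notin> two_sided_orbit g"
  let ?O = "two_sided_orbit g"
  obtain B where B0: "B \<subseteq> orbit_tangent A K p0" "pairwise orthogonal B" "\<And>x. x \<in> B \<Longrightarrow> norm x = 1"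
    "independent B" "card B = dim (orbit_tangent A K p0)" "span B = orbit_tangent A K p0"
    using orthonormal_basis_subspace[OF subspace_orbit_tangent] by metis
  have B: "finite B" "B \<subseteq> orbit_tangent A K p0" "\<And>b c. b \<in> B \<Longrightarrow> c \<in> B \<Longrightarrow> b \<bullet> c = (if b = c then 1 else 0)"
    using B0 independent_imp_finite by (auto simp: pairwise_def orthogonal_def norm_eq_1)
  obtain N where N: "open N" "p0 \<in> N"
    and NXY: "\<And>p. p \<in> N \<Longrightarrow> \<exists>X Y. (\<forall>b\<in>B. X b \<in> cLie A \<and> Y b \<in> cLie K) \<and> dual_basis (\<lambda>b x. x \<bullet> b) B (\<lambda>b. X b ** p + p ** Y b)"
    by (rule orbit_tangent_nearby[OF B]) (assumption, assumption, rule that, assumption+)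
  \<comment> \<open>Every orbit point has tangent dimension at most \<open>card B\<close>, and
    inside \<open>N\<close> there are \<open>card B\<close> tangent vectors dual to
    \<open>B\<close>; so the tangent space meets the orthogonal complement of \<open>B\<close>
    trivially.\<close>
  have inj: "Z = 0" if p: "p \<in> ?O" "p \<in> N" and Z: "Z \<in> orbit_tangent A K p" "\<And>b. b \<in> B \<Longrightarrow> Z \<bullet> b = 0" for p Z
  proof -
    have "dim (orbit_tangent A K p) \<le> card B"
      using p(1) dim_orbit_tangent_translate dle B0(5) by (auto simp: two_sided_orbit_def)
    moreover obtain X Y where "\<forall>b\<in>B. X b \<in> cLie A \<and> Y b \<in> cLie K" "dual_basis (\<lambda>b x. x \<bullet> b) B (\<lambda>b. X b ** p + p ** Y b)"
      using NXY[OF p(2)] by blast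
    ultimately show ?thesis using orbit_tangent_transversal[OF B(1) _ _ _ Z, of X Y] by blast
  qed
  define S where "S = {p \<in> ?O \<inter> N. \<forall>b\<in>B. p \<bullet> b = p0 \<bullet> b}"
  \<comment> \<open>A finite \<open>S\<close> could be removed from the neighbourhood
    \<open>N\<close>, and the orbit would have to cross the slice outside \<open>S\<close> once
    more.\<close>
  have infS: "infinite S"
  proof
    assume "finite S"
    then have "open (N - S)" using N by (intro open_Diff finite_imp_closed)
    moreover have "p0 \<in> N - S" using N out by (auto simp: S_def)
    ultimately show False
      using orbit_crosses_transversal[OF B cl, of "N - S"] by (auto simp: S_def)
  qed
  define \<Phi> where "\<Phi> q = fst q ** g ** snd q" for q :: "(complex ^ 'n ^ 'n) \<times> (complex ^ 'n ^ 'n)"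
  obtain nA FA where FA: "finite FA" "FA \<subseteq> vanishing nA A"
    "\<And>q v t m f. q \<in> A \<Longrightarrow> \<forall>k\<in>FA. frechet_derivative k (at q) v = 0 \<Longrightarrow> f \<in> vanishing m A \<Longrightarrow>
       f (matrix_exp (t *\<^sub>R (v ** matrix_inv q))) = 0 \<and> f (matrix_exp (t *\<^sub>R (matrix_inv q ** v))) = 0"
    by (rule zariski_tangent[OF A(1)]) (rule that, assumption+)
  obtain nK FK where FK: "finite FK" "FK \<subseteq> vanishing nK K"
    "\<And>q v t m f. q \<in> K \<Longrightarrow> \<forall>k\<in>FK. frechet_derivative k (at q) v = 0 \<Longrightarrow> f \<in> vanishing m K \<Longrightarrow>
       f (matrix_exp (t *\<^sub>R (v ** matrix_inv q))) = 0 \<and> f (matrix_exp (t *\<^sub>R (matrix_inv q ** v))) = 0"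
    by (rule zariski_tangent[OF K(1)]) (rule that, assumption+)
  \<comment> \<open>\<open>L\<close> holds equations of the two groups, \<open>W\<close> the
    coordinates of the orbit point along \<open>B\<close>, and \<open>C\<close> all linear
    coordinates, from which those along the fibres of \<open>\<Phi>\<close> will be
    selected.\<close>
  define L :: "((complex ^ 'n ^ 'n) \<times> (complex ^ 'n ^ 'n) \<Rightarrow> real) set"
    where "L = (\<lambda>f q. f (fst q)) ` FA \<union> (\<lambda>f q. f (snd q)) ` FK"
  define wf where "wf b = (\<lambda>q. \<Phi> q \<bullet> b)" for b
  define W where "W = wf ` B"
  define C :: "((complex ^ 'n ^ 'n) \<times> (complex ^ 'n ^ 'n) \<Rightarrow> real) set" where "C = (\<lambda>e q. q \<bullet> e) ` Basis"
  \<comment> \<open>A common degree bound: \<open>nA\<close> and \<open>nK\<close> for the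
    equations, 2 for the bilinear \<open>\<Phi>\<close>, with room for the linear
    coordinates.\<close>
  define D where "D = nA + nK + 2"
  define pd where "pd f q = frechet_derivative f (at q)" for f :: "(complex ^ 'n ^ 'n) \<times> (complex ^ 'n ^ 'n) \<Rightarrow> real" and q
  have fin: "finite L" "finite W" "finite C"
    using FA(1) FK(1) B(1) by (auto simp: L_def W_def C_def)
  have bil: "bounded_bilinear (\<lambda>(x :: complex ^ 'n ^ 'n) (y :: complex ^ 'n ^ 'n). (x ** g) ** y)"
    by (rule bounded_bilinear.comp[OF bounded_bilinear_matrix_mult bounded_linear_matrix_mult(2) bounded_linear_ident])
  have deg\<Phi>: "pdeg D (\<lambda>q. \<Phi> q \<bullet> c)" for c
    unfolding \<Phi>_def by (rule pdeg_mono[OF pdeg_bounded_bilinear[OF bil]]) (simp add: D_def)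
  have degFA: "pdeg nA f" if "f \<in> FA" for f using that FA(2) by (auto simp: vanishing_def)
  have degFK: "pdeg nK f" if "f \<in> FK" for f using that FK(2) by (auto simp: vanishing_def)
  have deg: "pdeg D f" if "f \<in> L \<union> W \<union> C" for f
  proof -
    have "(\<exists>h\<in>FA. f = (\<lambda>q. h (fst q))) \<or> (\<exists>h\<in>FK. f = (\<lambda>q. h (snd q))) \<or> (\<exists>b. f = wf b) \<or> (\<exists>e. f = (\<lambda>q. q \<bullet> e))"
      using that unfolding L_def W_def C_def Un_iff image_iff by fast
    then consider (a) h where "h \<in> FA" "f = (\<lambda>q. h (fst q))" | (k) h where "h \<in> FK" "f = (\<lambda>q. h (snd q))"
      | (w) b where "f = wf b" | (c) e where "f = (\<lambda>q. q \<bullet> e)"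
      by fast
    then show ?thesis
    proof cases
      case a
      have "pdeg nA f" unfolding a(2) by (rule pdeg_compose_linear[OF degFA[OF a(1)] bounded_linear_fst])
      then show ?thesis by (rule pdeg_mono) (simp add: D_def)
    next
      case k
      have "pdeg nK f" unfolding k(2) by (rule pdeg_compose_linear[OF degFK[OF k(1)] bounded_linear_snd])
      then show ?thesis by (rule pdeg_mono) (simp add: D_def)
    next
      case w
      then show ?thesis using deg\<Phi> by (simp add: wf_def)
    next
      case c
      have "pdeg (Suc 0) f" unfolding c by (intro pdeg.lin bounded_linear_inner_left)
      then show ?thesis by (rule pdeg_mono) (simp add: D_def)
    qed
  qed
  have lin: "linear (pd f q)" if "f \<in> L \<union> W \<union> C" for f q
    unfolding pd_def using pdeg_has_derivative[OF deg[OF that]] by (rule has_derivative_linear)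
  have cont: "continuous_on UNIV (\<lambda>q. pd f q v)" if "f \<in> L \<union> W \<union> C" for f v
    unfolding pd_def by (rule pdeg_derivative_continuous[OF deg[OF that]])
  have pdA: "pd (\<lambda>q. f (fst q)) q v = frechet_derivative f (at (fst q)) (fst v)" if "f \<in> FA" for f q v
    unfolding pd_def using frechet_derivative_compose_linear[OF degFA[OF that] bounded_linear_fst, of q] by simp
  have pdK: "pd (\<lambda>q. f (snd q)) q v = frechet_derivative f (at (snd q)) (snd v)" if "f \<in> FK" for f q v
    unfolding pd_def using frechet_derivative_compose_linear[OF degFK[OF that] bounded_linear_snd, of q] by simp
  have pdW: "pd (wf b) q v = (fst q ** g ** snd v + fst v ** g ** snd q) \<bullet> b" for b q v
  proof -
    have "((\<lambda>q. fst q ** g ** snd q) has_derivative (\<lambda>v. fst q ** g ** snd v + fst v ** g ** snd q)) (at q)"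
      by (rule bounded_bilinear.FDERIV[OF bil]) (rule bounded_linear_imp_has_derivative[OF bounded_linear_fst]
          bounded_linear_imp_has_derivative[OF bounded_linear_snd])+
    then have "(wf b has_derivative (\<lambda>v. (fst q ** g ** snd v + fst v ** g ** snd q) \<bullet> b)) (at q)"
      unfolding wf_def \<Phi>_def by (rule has_derivative_inner_left)
    from frechet_derivative_at[OF this, symmetric] show ?thesis unfolding pd_def by (rule fun_cong)
  qed
  have pdW': "pd (wf b) q (X ** fst q, snd q ** Y) = (X ** \<Phi> q + \<Phi> q ** Y) \<bullet> b" for b q X Y
    by (simp add: pdW \<Phi>_def matrix_mul_assoc add.commute)
  have pdC: "pd (\<lambda>q. q \<bullet> e) q v = v \<bullet> e" for e q v
  proof -
    have "((\<lambda>q. q \<bullet> e) has_derivative (\<lambda>v. v \<bullet> e)) (at q)"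
      by (rule bounded_linear_imp_has_derivative[OF bounded_linear_inner_left])
    from frechet_derivative_at[OF this, symmetric] show ?thesis unfolding pd_def by (rule fun_cong)
  qed
  \<comment> \<open>Here Zariski-Lie closedness of both groups is used: a vector annihilated by the
    equations, translated to the identity, generates a one-parameter group inside the Zariski
    closure, hence belongs to the Lie algebra.\<close>
  have L_ker: "v \<in> product_tangent q" if q: "q \<in> A \<times> K" and v: "\<And>f. f \<in> L \<Longrightarrow> pd f q v = 0" for q v
  proof -
    have qA: "fst q \<in> A" and qK: "snd q \<in> K" using q by auto
    have "\<forall>k\<in>FA. frechet_derivative k (at (fst q)) (fst v) = 0"
    proof
      fix k assume k: "k \<in> FA"
      have "pd (\<lambda>q. k (fst q)) q v = 0" by (rule v) (use k in \<open>auto simp: L_def\<close>)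
      then show "frechet_derivative k (at (fst q)) (fst v) = 0" unfolding pdA[OF k] .
    qed
    from FA(3)[OF qA this] have "fst v ** matrix_inv (fst q) \<in> cLie A"
      using A(3) unfolding zariski_Lie_closed_def by blast
    moreover have "\<forall>k\<in>FK. frechet_derivative k (at (snd q)) (snd v) = 0"
    proof
      fix k assume k: "k \<in> FK"
      have "pd (\<lambda>q. k (snd q)) q v = 0" by (rule v) (use k in \<open>auto simp: L_def\<close>)
      then show "frechet_derivative k (at (snd q)) (snd v) = 0" unfolding pdK[OF k] .
    qed
    from FK(3)[OF qK this] have "matrix_inv (snd q) ** snd v \<in> cLie K"
      using K(3) unfolding zariski_Lie_closed_def by blast
    ultimately show ?thesis
      unfolding product_tangent_def
      by (intro image_eqI[of _ _ "(fst v ** matrix_inv (fst q), matrix_inv (snd q) ** snd v)"])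
         (simp_all add: invertible_cancel[OF GA(3)[OF qA]] invertible_cancel[OF GK(3)[OF qK]])
  qed
  have L_product_tangent: "pd f q v = 0" if q: "q \<in> A \<times> K" and v: "v \<in> product_tangent q" and f: "f \<in> L" for f q v
  proof -
    obtain X Y where XY: "X \<in> cLie A" "Y \<in> cLie K" "v = (X ** fst q, snd q ** Y)" using v by (auto simp: product_tangent_def)
    have qA: "fst q \<in> A" and qK: "snd q \<in> K" using q by auto
    consider (a) h where "h \<in> FA" "f = (\<lambda>q. h (fst q))" | (k) h where "h \<in> FK" "f = (\<lambda>q. h (snd q))"
      using f by (auto simp: L_def)
    then show ?thesis
    proof cases
      case a
      then have "h \<in> vanishing nA A" using FA(2) by blast
      from vanishing_derivative_along_group(1)[OF A(1) this XY(1) qA] show ?thesis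
        unfolding a(2) pdA[OF a(1)] XY(3) by simp
    next
      case k
      then have "h \<in> vanishing nK K" using FK(2) by blast
      from vanishing_derivative_along_group(2)[OF K(1) this XY(2) qK] show ?thesis
        unfolding k(2) pdK[OF k(1)] XY(3) by simp
    qed
  qed
  have L_zero: "f q = 0" if "q \<in> A \<times> K" "f \<in> L" for f q
    using that FA(2) FK(2) by (auto simp: L_def vanishing_def)
  have wf_inj: "inj_on wf B"
  proof (rule inj_onI)
    fix b c assume "wf b = wf c"
    then have "\<Phi> (p ** matrix_inv g, mat 1) \<bullet> b = \<Phi> (p ** matrix_inv g, mat 1) \<bullet> c" for p
      by (simp add: wf_def fun_eq_iff)
    then have "p \<bullet> b = p \<bullet> c" for p
      by (simp add: \<Phi>_def invertible_cancel[OF g])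
    from this[of "b - c"] have "(b - c) \<bullet> (b - c) = 0" by (simp add: inner_diff_right)
    then show "b = c" by simp
  qed
  define bw where "bw = inv_into B wf"
  have bw: "bw w \<in> B" "wf (bw w) = w" if "w \<in> W" for w
    using that by (auto simp: bw_def W_def inv_into_into f_inv_into_f)
  define e where "e = dim (cLie A \<times> cLie K)"
  define N_of where "N_of = DIM((complex ^ 'n ^ 'n) \<times> (complex ^ 'n ^ 'n))"
  \<comment> \<open>The two counts mention no point and so survive the pigeonhole argument. With a
    dual basis they say that the functions are coordinates of the ambient space, of which at most
    \<open>e\<close>, the dimension of \<open>A \<times> K\<close>, are not equations.\<close>
  define Sel where "Sel U C' \<longleftrightarrow> U \<subseteq> L \<and> C' \<subseteq> C \<and> U \<inter> W = {} \<and> C' \<inter> (U \<union> W) = {} \<and>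
      card (W \<union> C') \<le> e \<and> N_of \<le> card (U \<union> W \<union> C')" for U C'
  have select: "\<exists>q U C'. q \<in> A \<times> K \<and> \<Phi> q = p \<and> Sel U C' \<and> (\<exists>v. dual_basis (\<lambda>f. pd f q) (U \<union> W \<union> C') v)"
    if p: "p \<in> S" for p
  proof -
    obtain a b where ab: "a \<in> A" "b \<in> K" "p = a ** g ** b" using p by (auto simp: S_def two_sided_orbit_def)
    define q where "q = (a, b)"
    have q: "q \<in> A \<times> K" "\<Phi> q = p" using ab by (auto simp: q_def \<Phi>_def)
    obtain X Y where XY: "\<forall>b\<in>B. X b \<in> cLie A \<and> Y b \<in> cLie K" "dual_basis (\<lambda>b x. x \<bullet> b) B (\<lambda>b. X b ** p + p ** Y b)"
      using NXY[of p] p by (auto simp: S_def)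
    define vW where "vW w = (X (bw w) ** fst q, snd q ** Y (bw w))" for w
    have vW: "vW w \<in> product_tangent q" if "w \<in> W" for w
      using XY(1) bw(1)[OF that] unfolding product_tangent_def vW_def by (intro image_eqI[of _ _ "(X (bw w), Y (bw w))"]) auto
    have dW: "dual_basis (\<lambda>f. pd f q) W vW"
      unfolding dual_basis_def
    proof (intro ballI)
      fix w w' assume w: "w \<in> W" "w' \<in> W"
      have "pd w q (vW w') = pd (wf (bw w)) q (vW w')" using bw(2)[OF w(1)] by simp
      also have "\<dots> = (X (bw w') ** p + p ** Y (bw w')) \<bullet> bw w"
        unfolding vW_def pdW' q(2) ..
      also have "\<dots> = (if bw w = bw w' then 1 else 0)"
        using XY(2) bw(1)[OF w(1)] bw(1)[OF w(2)] unfolding dual_basis_def by blast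
      also have "\<dots> = (if w = w' then 1 else 0)" using bw(2)[OF w(1)] bw(2)[OF w(2)] by metis
      finally show "pd w q (vW w') = (if w = w' then 1 else 0)" .
    qed
    have LW: "pd f q (vW w) = 0" if "f \<in> L" "w \<in> W" for f w by (rule L_product_tangent[OF q(1) vW[OF that(2)] that(1)])
    have kerC: "v = 0" if "\<And>c. c \<in> C \<Longrightarrow> pd c q v = 0" for v
    proof (rule euclidean_eqI)
      fix i :: "(complex ^ 'n ^ 'n) \<times> (complex ^ 'n ^ 'n)" assume "i \<in> Basis"
      then show "v \<bullet> i = 0 \<bullet> i" using that[of "\<lambda>q. q \<bullet> i"] pdC by (auto simp: C_def)
    qed
    obtain U C' v where sel: "U \<subseteq> L" "C' \<subseteq> C" "U \<inter> W = {}" "C' \<inter> (U \<union> W) = {}"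
      "dual_basis (\<lambda>f. pd f q) (U \<union> W \<union> C') v"
      "\<And>x u. (\<And>u. u \<in> U \<Longrightarrow> pd u q x = 0) \<Longrightarrow> u \<in> L \<Longrightarrow> pd u q x = 0"
      "\<And>x. (\<And>f. f \<in> U \<union> W \<union> C' \<Longrightarrow> pd f q x = 0) \<Longrightarrow> x = 0"
      using dual_selection[OF fin lin dW LW kerC] by blast
    have fU: "finite (U \<union> W \<union> C')" using sel fin finite_subset by blast
    have linA: "linear (pd f q)" if "f \<in> U \<union> W \<union> C'" for f using lin that sel by blast
    have "N_of \<le> card (U \<union> W \<union> C')"
      unfolding N_of_def dim_UNIV[symmetric]
      by (rule dim_le_card_if_dual_basis[OF sel(5) fU linA subset_refl sel(7)]) auto
    moreover have "card (W \<union> C') \<le> dim (product_tangent q)"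
    proof (rule dual_basis_card_le_dim[OF dual_basis_subset[OF sel(5)]])
      show "v ` (W \<union> C') \<subseteq> product_tangent q"
      proof
        fix x assume "x \<in> v ` (W \<union> C')"
        then obtain f where f: "f \<in> W \<union> C'" "x = v f" by blast
        have "pd u q x = 0" if u: "u \<in> U" for u
          using sel(3,4,5) f u unfolding dual_basis_def by auto
        then show "x \<in> product_tangent q" using sel(6) by (intro L_ker[OF q(1)]) blast
      qed
    qed (use fU linA in auto)
    ultimately have "Sel U C'" using sel dim_product_tangent[OF q(1)] by (simp add: Sel_def e_def)
    then show ?thesis using q sel(5) by blast
  qed
  then obtain lq lU lC where l: "\<And>p. p \<in> S \<Longrightarrow> lq p \<in> A \<times> K" "\<And>p. p \<in> S \<Longrightarrow> \<Phi> (lq p) = p"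
    "\<And>p. p \<in> S \<Longrightarrow> Sel (lU p) (lC p)" "\<And>p. p \<in> S \<Longrightarrow> \<exists>v. dual_basis (\<lambda>f. pd f (lq p)) (lU p \<union> W \<union> lC p) v"
    by metis
  \<comment> \<open>The selected families depend on the point, but they are subsets of fixed finite
    sets; infinitely many points of \<open>S\<close> share one selection.\<close>
  have "finite ((\<lambda>p. (lU p, lC p)) ` S)"
  proof (rule finite_subset)
    show "(\<lambda>p. (lU p, lC p)) ` S \<subseteq> Pow L \<times> Pow C"
    proof
      fix x assume "x \<in> (\<lambda>p. (lU p, lC p)) ` S"
      then obtain p where p: "p \<in> S" "x = (lU p, lC p)" by blast
      show "x \<in> Pow L \<times> Pow C" using l(3)[OF p(1)] unfolding Sel_def p(2) by blast
    qed
  qed (use fin in simp)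
  from pigeonhole_infinite[OF infS this] obtain p1 where
    p1: "p1 \<in> S" "infinite {p \<in> S. (lU p, lC p) = (lU p1, lC p1)}" by blast
  define U where "U = lU p1"
  define C' where "C' = lC p1"
  define S1 where "S1 = {p \<in> S. (lU p, lC p) = (U, C')}"
  have S1: "infinite S1" using p1(2) by (simp add: S1_def U_def C'_def)
  have sel: "U \<subseteq> L" "C' \<subseteq> C" "U \<inter> W = {}" "C' \<inter> (U \<union> W) = {}" "card (W \<union> C') \<le> e" "N_of \<le> card (U \<union> W \<union> C')"
    using l(3)[OF p1(1)] by (auto simp: Sel_def U_def C'_def)
  have finU: "finite U" "finite C'" using finite_subset[OF sel(1) fin(1)] finite_subset[OF sel(2) fin(3)] .
  let ?A = "U \<union> W \<union> C'"
  have finA: "finite ?A" using finU fin by simp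
  have subA': "f \<in> L \<union> W \<union> C" if "f \<in> ?A" for f using that sel by blast
  have linA: "linear (pd f q)" if "f \<in> ?A" for f q by (rule lin[OF subA'[OF that]])
  \<comment> \<open>Lifts of orbit points in \<open>N\<close> at which the fixed selection is still
    independent. These conditions are open in \<open>A \<times> K\<close>, so small moves along the
    group remain in \<open>Good\<close>.\<close>
  define Good where "Good = {q \<in> A \<times> K. \<Phi> q \<in> N \<and> (\<exists>v. dual_basis (\<lambda>f. pd f q) ?A v)}"
  \<comment> \<open>The kernel of \<open>U\<close> contains the tangent space, of dimension
    \<open>e\<close>, and has dimension at most \<open>card (W \<union> C')\<close>, which is at
    most \<open>e\<close>; so the two coincide, away from the point where \<open>U\<close> was
    selected too.\<close>
  have U_ker: "x \<in> product_tangent q" if q: "q \<in> Good" and x: "\<And>u. u \<in> U \<Longrightarrow> pd u q x = 0" for q x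
  proof -
    obtain v where v: "dual_basis (\<lambda>f. pd f q) ?A v" and qAK: "q \<in> A \<times> K" using q by (auto simp: Good_def)
    define T where "T = {x. \<forall>u\<in>U. pd u q x = 0}"
    have "subspace T"
      by (rule subspaceI)
         (auto simp: T_def linear_0[OF linA] linear_add[OF linA] linear_cmul[OF linA])
    moreover have "product_tangent q \<subseteq> T" using L_product_tangent[OF qAK] sel(1) by (auto simp: T_def)
    moreover have "dim T \<le> card (W \<union> C')"
    proof (rule dim_le_card_if_dual_basis[OF v finA linA])
      show "x = 0" if "\<And>f. f \<in> ?A \<Longrightarrow> pd f q x = 0" for x
        by (rule dual_basis_kernel_trivial[OF v finA linA _ that]) (use sel(6) in \<open>simp_all add: N_of_def\<close>)
      show "pd f q x = 0" if "x \<in> T" "f \<in> ?A - (W \<union> C')" for x f using that by (auto simp: T_def)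
    qed auto
    ultimately have "product_tangent q = T"
      using sel(5) dim_product_tangent[OF qAK] by (intro subspace_dim_equal subspace_product_tangent) (auto simp: e_def)
    then show ?thesis using x by (simp add: T_def)
  qed
  have nearby: "\<exists>\<epsilon>>0. \<forall>q'. dist q' q < \<epsilon> \<longrightarrow> (\<exists>v. dual_basis (\<lambda>f. pd f q') ?A v)" if q: "q \<in> Good" for q
  proof -
    obtain v where v: "dual_basis (\<lambda>f. pd f q) ?A v" using q by (auto simp: Good_def)
    obtain M where M: "open M" "q \<in> M" "\<And>q. q \<in> M \<Longrightarrow> \<exists>v. dual_basis (\<lambda>f. pd f q) ?A v"
      by (rule dual_open[OF finA linA cont[OF subA'] v]) (assumption, assumption, rule that, assumption+)
    then show ?thesis unfolding open_dist by blast
  qed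
  have dirs_of_dual: "\<exists>z. \<forall>f\<in>W \<union> C'. z f \<in> cLie A \<times> cLie K \<and> v f = (fst (z f) ** fst q, snd q ** snd (z f))"
    if q: "q \<in> Good" and v: "dual_basis (\<lambda>f. pd f q) ?A v" for q v
  proof -
    have "\<exists>z. z \<in> cLie A \<times> cLie K \<and> v f = (fst z ** fst q, snd q ** snd z)" if f: "f \<in> W \<union> C'" for f
    proof -
      have "v f \<in> product_tangent q"
        by (rule U_ker[OF q]) (use v f sel(3,4) in \<open>auto simp: dual_basis_def\<close>)
      then show ?thesis unfolding product_tangent_def by blast
    qed
    then show ?thesis by metis
  qed
  have \<Phi>_move: "\<Phi> (matrix_exp X ** fst q, snd q ** matrix_exp Y) = matrix_exp X ** \<Phi> q ** matrix_exp Y" for X Y q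
    by (simp add: \<Phi>_def matrix_mul_assoc)
  have AK_move: "(matrix_exp X ** fst q, snd q ** matrix_exp Y) \<in> A \<times> K"
    if "q \<in> A \<times> K" "X \<in> cLie A" "Y \<in> cLie K" for X Y q
    using that GA(2)[OF cLie_exp[of X A], of "fst q"] GK(2)[OF _ cLie_exp[of Y K], of "snd q"]
    by (simp add: mem_Times_iff)
  define s where "s = (D * (card U + card W + card C' + 1) + 1) ^ N_of + 1"
  obtain J0 where J0: "J0 \<subseteq> S1" "finite J0" "card J0 = s"
    using infinite_arbitrarily_large[OF S1, of s] by blast
  obtain u where u: "inj_on (\<lambda>p. p \<bullet> u) J0" using separating_functional[OF J0(2)] by blast
  define t where "t q = \<Phi> q \<bullet> u" for q
  have "\<exists>\<rho>. (\<exists>\<alpha>\<in>exps s W. \<exists>j<s. \<rho> \<alpha> j \<noteq> 0) \<and>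
    (\<forall>q\<in>Good. (\<Sum>j<s. (\<Sum>\<alpha>\<in>exps s W. \<rho> \<alpha> j * (\<Prod>w\<in>W. w q ^ \<alpha> w)) * t q ^ j) = 0)"
  proof (rule ex_relation_eliminating[of U W C' D])
    show "finite U" "finite W" "finite C'" using finU fin by auto
    show "pdeg D f" if "f \<in> ?A" for f by (rule deg[OF subA'[OF that]])
    show "pdeg D t" unfolding t_def by (rule deg\<Phi>)
    have "card ?A = card U + card W + card C'"
      using sel(3,4) finU fin by (subst card_Un_disjoint; (subst card_Un_disjoint)?) auto
    then show "DIM((complex ^ 'n ^ 'n) \<times> (complex ^ 'n ^ 'n)) \<le> card U + card W + card C'"
      using sel(6) by (simp add: N_of_def)
    show "s = (D * (card U + card W + card C' + 1) + 1) ^ DIM((complex ^ 'n ^ 'n) \<times> (complex ^ 'n ^ 'n)) + 1"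
      by (simp add: s_def N_of_def)
    show "u q = 0" if "q \<in> Good" "u \<in> U" for q u
      using that sel(1) by (intro L_zero) (auto simp: Good_def)
  next
    fix q and \<epsilon> :: real assume q: "q \<in> Good" and \<epsilon>: "\<epsilon> > 0"
    obtain v where v: "dual_basis (\<lambda>f. pd f q) ?A v" using q by (auto simp: Good_def)
    \<comment> \<open>Here the point may leave \<open>A \<times> K\<close>: in the ambient space the
      equations \<open>U\<close> take arbitrary small values while \<open>W\<close> and
      \<open>C'\<close> are kept.\<close>
    have "\<exists>\<delta>>0. \<forall>y. (\<forall>i\<in>?A. \<bar>y i - i q\<bar> < \<delta>) \<longrightarrow> (\<exists>x\<in>UNIV. dist x q < \<epsilon> \<and> (\<forall>i\<in>?A. i x = y i))"
    proof (rule open_map_family[OF finA open_UNIV UNIV_I _ _ v \<epsilon>])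
      fix f assume "f \<in> ?A"
      note d = deg[OF subA'[OF this]]
      show "continuous_on UNIV f" by (rule pdeg_continuous_on[OF d])
      show "(f has_derivative pd f q) (at q)" unfolding pd_def by (rule pdeg_has_derivative[OF d])
    qed
    then obtain \<delta> where \<delta>: "\<delta> > 0 \<and> (\<forall>y. (\<forall>i\<in>?A. \<bar>y i - i q\<bar> < \<delta>) \<longrightarrow> (\<exists>x\<in>UNIV. dist x q < \<epsilon> \<and> (\<forall>i\<in>?A. i x = y i)))"
      by (rule exE)
    show "\<exists>\<delta>>0. \<forall>\<eta>. (\<forall>u\<in>U. \<bar>\<eta> u\<bar> < \<delta>) \<longrightarrow>
        (\<exists>x. dist x q < \<epsilon> \<and> (\<forall>u\<in>U. u x = \<eta> u) \<and> (\<forall>w\<in>W \<union> C'. w x = w q))"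
    proof (intro exI[of _ \<delta>] conjI conjunct1[OF \<delta>] allI impI)
      fix \<eta> :: "((complex ^ 'n ^ 'n) \<times> (complex ^ 'n ^ 'n) \<Rightarrow> real) \<Rightarrow> real" assume \<eta>: "\<forall>u\<in>U. \<bar>\<eta> u\<bar> < \<delta>"
      define y where "y f = (if f \<in> U then \<eta> f else f q)" for f
      have "\<forall>i\<in>?A. \<bar>y i - i q\<bar> < \<delta>"
      proof
        fix f assume "f \<in> ?A"
        show "\<bar>y f - f q\<bar> < \<delta>"
        proof (cases "f \<in> U")
          case True
          then have "f q = 0" using q sel(1) by (intro L_zero) (auto simp: Good_def)
          then show ?thesis using True \<eta> by (simp add: y_def)
        qed (use \<delta> in \<open>simp add: y_def\<close>)
      qed
      from mp[OF spec[OF conjunct2[OF \<delta>]] this] obtain x where x: "dist x q < \<epsilon>" "\<forall>i\<in>?A. i x = y i" by blast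
      have "w \<notin> U" if "w \<in> W \<union> C'" for w using that sel(3,4) by blast
      then have "w x = w q" if "w \<in> W \<union> C'" for w using bspec[OF x(2), of w] that by (simp add: y_def)
      moreover have "u x = \<eta> u" if "u \<in> U" for u using bspec[OF x(2), of u] that by (simp add: y_def)
      ultimately show "\<exists>x. dist x q < \<epsilon> \<and> (\<forall>u\<in>U. u x = \<eta> u) \<and> (\<forall>w\<in>W \<union> C'. w x = w q)"
        using x(1) by blast
    qed
  next
    fix q assume q: "q \<in> Good"
    then have qAK: "q \<in> A \<times> K" and qN: "\<Phi> q \<in> N" by (auto simp: Good_def)
    have pO: "\<Phi> q \<in> ?O" using qAK unfolding \<Phi>_def two_sided_orbit_def
      by (intro CollectI exI[of _ "fst q"] exI[of _ "snd q"]) auto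
    obtain v where v: "dual_basis (\<lambda>f. pd f q) ?A v" using q by (auto simp: Good_def)
    obtain z where z: "\<And>f. f \<in> W \<union> C' \<Longrightarrow> z f \<in> cLie A \<times> cLie K"
      "\<And>f. f \<in> W \<union> C' \<Longrightarrow> v f = (fst (z f) ** fst q, snd q ** snd (z f))" using dirs_of_dual[OF q v] by blast
    obtain \<epsilon> where \<epsilon>: "\<epsilon> > 0" "\<And>q'. dist q' q < \<epsilon> \<Longrightarrow> \<exists>v. dual_basis (\<lambda>f. pd f q') ?A v" using nearby[OF q] by blast
    \<comment> \<open>The Lie algebra of the stabiliser of \<open>\<Phi> q\<close>, that is, the
      directions along which the orbit point has velocity 0.\<close>
    define T where "T = {x \<in> cLie A \<times> cLie K. fst x ** \<Phi> q + \<Phi> q ** snd x = 0}"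
    have subT: "subspace T"
    proof -
      have "subspace {x. fst x ** \<Phi> q + \<Phi> q ** snd x = 0}"
        by (rule subspaceI) (simp_all add: matrix_mult_simps algebra_simps flip: scaleR_add_right)
      moreover have "T = (cLie A \<times> cLie K) \<inter> {x. fst x ** \<Phi> q + \<Phi> q ** snd x = 0}" by (auto simp: T_def)
      ultimately show ?thesis by (simp add: subspace_inter subspace_Times subA subK)
    qed
    \<comment> \<open>In the direction dual to \<open>c\<close> the functions in \<open>W\<close>
      have derivative 0, so the velocity of the orbit point is orthogonal to \<open>B\<close>; by
      transversality it is 0. The coordinates in \<open>C'\<close> therefore vary inside the fibres
      of \<open>\<Phi>\<close>.\<close>
    have zT: "z c \<in> T" if c: "c \<in> C'" for c
    proof -
      have zc: "z c \<in> cLie A \<times> cLie K" using z(1) c by blast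
      have "fst (z c) ** \<Phi> q + \<Phi> q ** snd (z c) = 0"
      proof (rule inj[OF pO qN])
        show "fst (z c) ** \<Phi> q + \<Phi> q ** snd (z c) \<in> orbit_tangent A K (\<Phi> q)"
          using zc by (auto simp: orbit_tangent_def mem_Times_iff)
        fix b assume b: "b \<in> B"
        have "(fst (z c) ** \<Phi> q + \<Phi> q ** snd (z c)) \<bullet> b = pd (wf b) q (v c)"
          using z(2)[of c] c by (simp add: pdW')
        also have "\<dots> = 0"
          using v c b sel(4) unfolding dual_basis_def W_def by auto
        finally show "(fst (z c) ** \<Phi> q + \<Phi> q ** snd (z c)) \<bullet> b = 0" .
      qed
      then show ?thesis using zc by (simp add: T_def)
    qed
    have dual: "dual_basis (\<lambda>f. frechet_derivative f (at q)) C' (\<lambda>f. (fst (z f) ** fst q, snd q ** snd (z f)))"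
      unfolding dual_basis_def
    proof (intro ballI)
      fix f k assume fk: "f \<in> C'" "k \<in> C'"
      have "frechet_derivative f (at q) (fst (z k) ** fst q, snd q ** snd (z k)) = pd f q (v k)"
        using z(2)[of k] fk by (simp add: pd_def)
      also have "\<dots> = (if f = k then 1 else 0)"
        using v fk unfolding dual_basis_def by blast
      finally show "frechet_derivative f (at q) (fst (z k) ** fst q, snd q ** snd (z k)) = (if f = k then 1 else 0)" .
    qed
    have degC: "pdeg D f" if "f \<in> C'" for f using deg subA' that by blast
    from move_along_group[OF qAK subT _ finU(2) degC dual zT \<epsilon>(1)]
    obtain \<delta> where \<delta>: "\<delta> > 0 \<and> (\<forall>y. (\<forall>f\<in>C'. \<bar>y f - f q\<bar> < \<delta>) \<longrightarrow>
      (\<exists>x\<in>T. dist (matrix_exp (fst x) ** fst q, snd q ** matrix_exp (snd x)) q < \<epsilon> \<and>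
        (\<forall>f\<in>C'. f (matrix_exp (fst x) ** fst q, snd q ** matrix_exp (snd x)) = y f)))"
      by (auto simp: T_def)
    show "\<exists>\<delta>>0. \<forall>y. (\<forall>c\<in>C'. \<bar>y c - c q\<bar> < \<delta>) \<longrightarrow>
        (\<exists>q'\<in>Good. (\<forall>c\<in>C'. c q' = y c) \<and> (\<forall>w\<in>W. w q' = w q) \<and> t q' = t q)"
    proof (intro exI[of _ \<delta>] conjI conjunct1[OF \<delta>] allI impI)
      fix y assume "\<forall>c\<in>C'. \<bar>y c - c q\<bar> < \<delta>"
      from mp[OF spec[OF conjunct2[OF \<delta>]] this] obtain x where x: "x \<in> T"
        "dist (matrix_exp (fst x) ** fst q, snd q ** matrix_exp (snd x)) q < \<epsilon>"
        "\<forall>f\<in>C'. f (matrix_exp (fst x) ** fst q, snd q ** matrix_exp (snd x)) = y f" by blast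
      define q' where "q' = (matrix_exp (fst x) ** fst q, snd q ** matrix_exp (snd x))"
      have xAK: "fst x \<in> cLie A" "snd x \<in> cLie K" using x(1) by (auto simp: T_def)
      \<comment> \<open>An infinitesimal stabiliser in intertwining form. It passes to exponentials,
        so \<open>\<Phi>\<close>, and with it \<open>W\<close> and \<open>t\<close>, is constant
        along the whole move.\<close>
      have "\<Phi> q ** (- snd x) = fst x ** \<Phi> q"
        using x(1) by (simp add: T_def matrix_mult_simps eq_neg_iff_add_eq_0 add.commute)
          (metis add.commute eq_neg_iff_add_eq_0)
      from matrix_exp_intertwine[OF this]
      have "\<Phi> q' = \<Phi> q ** (matrix_exp (- snd x) ** matrix_exp (snd x))"
        by (simp add: q'_def \<Phi>_move matrix_mul_assoc)
      then have \<Phi>q': "\<Phi> q' = \<Phi> q" by (simp add: matrix_exp_minus_mult)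
      have "q' \<in> Good"
        using AK_move[OF qAK xAK] \<epsilon>(2)[OF x(2)] qN \<Phi>q' by (auto simp: Good_def q'_def)
      moreover have "w q' = w q" if "w \<in> W" for w using that \<Phi>q' by (auto simp: W_def wf_def)
      moreover have "t q' = t q" using \<Phi>q' by (simp add: t_def)
      ultimately show "\<exists>q'\<in>Good. (\<forall>c\<in>C'. c q' = y c) \<and> (\<forall>w\<in>W. w q' = w q) \<and> t q' = t q"
        using x(3) by (intro bexI[of _ q']) (auto simp: q'_def)
    qed
  qed
  then obtain \<rho> where \<rho>: "(\<exists>\<alpha>\<in>exps s W. \<exists>j<s. \<rho> \<alpha> j \<noteq> 0) \<and>
    (\<forall>q\<in>Good. (\<Sum>j<s. (\<Sum>\<alpha>\<in>exps s W. \<rho> \<alpha> j * (\<Prod>w\<in>W. w q ^ \<alpha> w)) * t q ^ j) = 0)" by (rule exE)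
  define J where "J = lq ` J0"
  have J0S: "p \<in> S" "lU p = U" "lC p = C'" if "p \<in> J0" for p using that J0(1) by (auto simp: S1_def)
  have lq_inj: "inj_on lq J0" by (rule inj_onI) (metis J0S(1) l(2))
  have JGood: "lq p \<in> Good" if "p \<in> J0" for p
    using l[OF J0S(1)[OF that]] J0S[OF that] by (auto simp: Good_def S_def)
  have "card J < s"
  proof (rule card_less_if_relation[OF fin(2), of J s \<rho> Good t "\<lambda>w. p0 \<bullet> bw w"])
    show "finite J" using J0(2) by (simp add: J_def)
    show "\<exists>\<alpha>\<in>exps s W. \<exists>j<s. \<rho> \<alpha> j \<noteq> 0" using \<rho> by (rule conjunct1)
    show "(\<Sum>j<s. (\<Sum>\<alpha>\<in>exps s W. \<rho> \<alpha> j * (\<Prod>w\<in>W. w q ^ \<alpha> w)) * t q ^ j) = 0" if "q \<in> Good" for q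
      using conjunct2[OF \<rho>] that by (rule bspec)
    show "inj_on t J"
    proof (rule inj_onI)
      fix x y assume "x \<in> J" "y \<in> J" and eq: "t x = t y"
      then obtain p p' where p: "p \<in> J0" "x = lq p" "p' \<in> J0" "y = lq p'" by (auto simp: J_def)
      have "p \<bullet> u = p' \<bullet> u" using eq l(2)[OF J0S(1)[OF p(1)]] l(2)[OF J0S(1)[OF p(3)]] by (simp add: t_def p)
      then show "x = y" using u p by (auto simp: inj_on_def)
    qed
  next
    fix q and \<epsilon>' :: real assume qJ: "q \<in> J" and \<epsilon>': "\<epsilon>' > 0"
    obtain p where p: "p \<in> J0" "q = lq p" using qJ by (auto simp: J_def)
    have q: "q \<in> Good" using JGood p by simp
    have pS: "p \<in> S" "\<Phi> q = p" using J0S(1)[OF p(1)] l(2) p by auto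
    have qAK: "q \<in> A \<times> K" and qN: "\<Phi> q \<in> N" using q by (auto simp: Good_def)
    obtain v where v: "dual_basis (\<lambda>f. pd f q) ?A v" using q by (auto simp: Good_def)
    obtain z where z: "\<And>f. f \<in> W \<union> C' \<Longrightarrow> z f \<in> cLie A \<times> cLie K"
      "\<And>f. f \<in> W \<union> C' \<Longrightarrow> v f = (fst (z f) ** fst q, snd q ** snd (z f))" using dirs_of_dual[OF q v] by blast
    obtain \<epsilon>1 where \<epsilon>1: "\<epsilon>1 > 0" "\<And>q'. dist q' q < \<epsilon>1 \<Longrightarrow> \<exists>v. dual_basis (\<lambda>f. pd f q') ?A v" using nearby[OF q] by blast
    have c\<Phi>: "continuous_on UNIV \<Phi>" unfolding \<Phi>_def by (intro continuous_intros)
    have "open (\<Phi> -` N \<inter> t -` ball (t q) \<epsilon>')"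
      unfolding t_def by (intro open_Int open_vimage N open_ball c\<Phi> continuous_intros)
    moreover have "q \<in> \<Phi> -` N \<inter> t -` ball (t q) \<epsilon>'" using qN \<epsilon>' by simp
    ultimately obtain \<epsilon>2 where \<epsilon>2: "\<epsilon>2 > 0" "\<And>q'. dist q' q < \<epsilon>2 \<Longrightarrow> q' \<in> \<Phi> -` N \<inter> t -` ball (t q) \<epsilon>'"
      unfolding open_dist by blast
    have \<epsilon>: "min \<epsilon>1 \<epsilon>2 > 0" using \<epsilon>1 \<epsilon>2 by simp
    have dual: "dual_basis (\<lambda>f. frechet_derivative f (at q)) W (\<lambda>f. (fst (z f) ** fst q, snd q ** snd (z f)))"
      unfolding dual_basis_def
    proof (intro ballI)
      fix f k assume fk: "f \<in> W" "k \<in> W"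
      have "frechet_derivative f (at q) (fst (z k) ** fst q, snd q ** snd (z k)) = pd f q (v k)"
        using z(2)[of k] fk by (simp add: pd_def)
      also have "\<dots> = (if f = k then 1 else 0)"
        using v fk unfolding dual_basis_def by blast
      finally show "frechet_derivative f (at q) (fst (z k) ** fst q, snd q ** snd (z k)) = (if f = k then 1 else 0)" .
    qed
    have degW: "pdeg D f" if "f \<in> W" for f using deg that by blast
    have zW: "z w \<in> cLie A \<times> cLie K" if "w \<in> W" for w using z(1) that by blast
    from move_along_group[OF qAK subspace_Times[OF subA subK] subset_refl fin(2) degW dual zW \<epsilon>]
    obtain \<delta> where \<delta>: "\<delta> > 0 \<and> (\<forall>y. (\<forall>f\<in>W. \<bar>y f - f q\<bar> < \<delta>) \<longrightarrow>
      (\<exists>x\<in>cLie A \<times> cLie K. dist (matrix_exp (fst x) ** fst q, snd q ** matrix_exp (snd x)) q < min \<epsilon>1 \<epsilon>2 \<and>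
        (\<forall>f\<in>W. f (matrix_exp (fst x) ** fst q, snd q ** matrix_exp (snd x)) = y f)))"
      by (rule exE)
    \<comment> \<open>All points of \<open>S\<close> have the coordinates of \<open>p0\<close> along
      \<open>B\<close>; these are the values \<open>y0\<close> common to all of
      \<open>J\<close>.\<close>
    have wq: "w q = p0 \<bullet> bw w" if "w \<in> W" for w
    proof -
      have "w q = p \<bullet> bw w" using bw(2)[OF that] pS(2) by (metis wf_def)
      then show ?thesis using pS(1) bw(1)[OF that] by (simp add: S_def)
    qed
    show "\<exists>\<delta>>0. \<forall>y. (\<forall>w\<in>W. \<bar>y w - p0 \<bullet> bw w\<bar> < \<delta>) \<longrightarrow>
        (\<exists>q'\<in>Good. \<bar>t q' - t q\<bar> < \<epsilon>' \<and> (\<forall>w\<in>W. w q' = y w))"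
    proof (intro exI[of _ \<delta>] conjI conjunct1[OF \<delta>] allI impI)
      fix y :: "((complex ^ 'n ^ 'n) \<times> (complex ^ 'n ^ 'n) \<Rightarrow> real) \<Rightarrow> real"
      assume "\<forall>w\<in>W. \<bar>y w - p0 \<bullet> bw w\<bar> < \<delta>"
      then have "\<forall>f\<in>W. \<bar>y f - f q\<bar> < \<delta>" by (simp add: wq)
      from mp[OF spec[OF conjunct2[OF \<delta>]] this] obtain x where x: "x \<in> cLie A \<times> cLie K"
        "dist (matrix_exp (fst x) ** fst q, snd q ** matrix_exp (snd x)) q < min \<epsilon>1 \<epsilon>2"
        "\<forall>f\<in>W. f (matrix_exp (fst x) ** fst q, snd q ** matrix_exp (snd x)) = y f" by blast
      define q' where "q' = (matrix_exp (fst x) ** fst q, snd q ** matrix_exp (snd x))"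
      have "q' \<in> A \<times> K" unfolding q'_def by (rule AK_move[OF qAK]) (use x(1) in auto)
      moreover have "\<exists>v. dual_basis (\<lambda>f. pd f q') ?A v" using \<epsilon>1(2)[of q'] x(2) by (simp add: q'_def)
      moreover have "q' \<in> \<Phi> -` N \<inter> t -` ball (t q) \<epsilon>'" using \<epsilon>2(2)[of q'] x(2) by (simp add: q'_def)
      ultimately show "\<exists>q'\<in>Good. \<bar>t q' - t q\<bar> < \<epsilon>' \<and> (\<forall>w\<in>W. w q' = y w)"
        using x(3) by (intro bexI[of _ q']) (auto simp: Good_def q'_def dist_real_def abs_minus_commute)
    qed
  qed
  then show False using card_image[OF lq_inj] J0(3) by (simp add: J_def)
qed

end

section \<open>Closed orbits of real algebraic groups\<close>

lemma linear_cmat: "linear cmat"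
  by (rule linearI) (simp_all add: vec_eq_iff scaleR_conv_of_real[where 'a = complex])

lemma inj_cmat: "inj cmat"
  by (auto simp: inj_on_def vec_eq_iff)

lemma cmat_mult: "cmat (A ** B) = cmat A ** cmat B"
  by (simp add: vec_eq_iff matrix_matrix_mult_def)

lemma cmat_mat1: "cmat (mat 1) = mat 1"
  by (simp add: vec_eq_iff mat_def)

lemma invertible_cmat_iff: "invertible (cmat A) \<longleftrightarrow> invertible A"
proof
  assume "invertible (cmat A)"
  then obtain B where B: "cmat A ** B = mat 1" by (auto simp: invertible_def)
  \<comment> \<open>As the entries of \<open>cmat A\<close> are real, taking real parts of the
    entries of \<open>B\<close> preserves the equation.\<close>
  have "A ** (\<chi> i j. Re (B $ i $ j)) = mat 1"
  proof (simp only: vec_eq_iff, intro allI)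
    fix i j
    have "Re ((cmat A ** B) $ i $ j) = (A ** (\<chi> i j. Re (B $ i $ j))) $ i $ j"
      by (simp add: matrix_matrix_mult_def)
    then show "(A ** (\<chi> i j. Re (B $ i $ j))) $ i $ j = mat 1 $ i $ j"
      by (cases "i = j") (simp_all add: B mat_def)
  qed
  then show "invertible A" by (auto simp: invertible_right_inverse)
next
  assume "invertible A"
  then show "invertible (cmat A)" unfolding invertible_def by (metis cmat_mult cmat_mat1)
qed

lemma range_cmat_iff: "A \<in> range cmat \<longleftrightarrow> (\<forall>i j. Im (A $ i $ j) = 0)"
proof
  assume "\<forall>i j. Im (A $ i $ j) = 0"
  then have "A = cmat (\<chi> i j. Re (A $ i $ j))" by (simp add: vec_eq_iff complex_eq_iff)
  then show "A \<in> range cmat" by blast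
qed auto

lemma subspace_range_cmat: "subspace (range cmat)"
  by (rule linear_subspace_image[OF linear_cmat subspace_UNIV])

lemma subgroup_cmat:
  assumes "subgroup \<Gamma> GL"
  shows "subgroup (cmat ` \<Gamma>) GL"
proof (rule subgroup.intro)
  note G = subgroup_GL_D[OF assms]
  show "cmat ` \<Gamma> \<subseteq> carrier GL" using G(3) by (auto simp: invertible_cmat_iff)
  show "\<one>\<^bsub>GL\<^esub> \<in> cmat ` \<Gamma>" using imageI[OF G(1), of cmat] by (simp add: cmat_mat1)
  show "x \<otimes>\<^bsub>GL\<^esub> y \<in> cmat ` \<Gamma>" if "x \<in> cmat ` \<Gamma>" "y \<in> cmat ` \<Gamma>" for x y
    using that G(2) by (auto simp flip: cmat_mult)
  show "inv\<^bsub>GL\<^esub> x \<in> cmat ` \<Gamma>" if x: "x \<in> cmat ` \<Gamma>" for x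
  proof -
    obtain y where y: "y \<in> \<Gamma>" "x = cmat y" using x by blast
    have "matrix_inv x = cmat (matrix_inv y)"
      by (rule matrix_inv_eqI) (simp add: y cmat_mat1 matrix_inv_mult[OF G(3)[OF y(1)]] flip: cmat_mult)
    then show ?thesis using G(3,4) y by (simp add: inv_GL invertible_cmat_iff)
  qed
qed

lemma closedin_GL_cmat:
  assumes "closedin (top_of_set (carrier GL)) \<Gamma>"
  shows "closedin (top_of_set (carrier GL)) (cmat ` \<Gamma>)"
proof -
  obtain C where C: "closed C" "\<Gamma> = {A. invertible A} \<inter> C" using assms by (auto simp: closedin_closed)
  have "closed (cmat ` C)"
    by (rule closed_injective_linear_image[OF C(1) linear_cmat inj_cmat])
  moreover have "cmat ` \<Gamma> = {A. invertible A} \<inter> cmat ` C" using C(2) by (auto simp: invertible_cmat_iff)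
  ultimately show ?thesis by (auto simp: closedin_closed)
qed

lemma connected_cmat: "connected \<Gamma> \<Longrightarrow> connected (cmat ` \<Gamma>)"
  by (rule connected_continuous_image) (auto intro: linear_continuous_on linear_conv_bounded_linear[THEN iffD1, OF linear_cmat])

lemma in_range_cmat_if_exp:
  assumes "\<And>t::real. matrix_exp (t *\<^sub>R Y) \<in> range cmat"
  shows "Y \<in> range cmat"
proof (rule subspace_vector_derivative[OF subspace_range_cmat])
  show "matrix_exp (t *\<^sub>R Y) \<in> range cmat" for t by (rule assms)
  show "((\<lambda>t. matrix_exp (t *\<^sub>R Y)) has_vector_derivative Y) (at 0)"
    using matrix_exp_has_vector_derivative[of Y 0 UNIV] by simp
qed

lemma cmat_scaleR: "cmat (t *\<^sub>R X) = t *\<^sub>R cmat X"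
  by (rule linear_cmul[OF linear_cmat])

lemma cLie_cmat: "cLie (cmat ` \<Gamma>) = cmat ` Lie \<Gamma>"
proof (intro equalityI subsetI)
  fix Y assume Y: "Y \<in> cLie (cmat ` \<Gamma>)"
  then have exp: "matrix_exp (t *\<^sub>R Y) \<in> cmat ` \<Gamma>" for t by (simp add: cLie_def)
  have "Y \<in> range cmat" by (rule in_range_cmat_if_exp) (rule subsetD[OF image_mono[OF subset_UNIV] exp])
  then obtain X where X: "Y = cmat X" by blast
  have "matrix_exp (t *\<^sub>R X) \<in> \<Gamma>" for t
  proof -
    have "cmat (matrix_exp (t *\<^sub>R X)) \<in> cmat ` \<Gamma>"
      using exp[of t] by (simp only: X cmat_matrix_exp cmat_scaleR)
    then show ?thesis by (simp only: inj_image_mem_iff[OF inj_cmat])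
  qed
  then show "Y \<in> cmat ` Lie \<Gamma>" by (auto simp: X Lie_def)
next
  fix Y assume "Y \<in> cmat ` Lie \<Gamma>"
  then obtain X where X: "X \<in> Lie \<Gamma>" "Y = cmat X" by blast
  have "cmat (matrix_exp (t *\<^sub>R X)) \<in> cmat ` \<Gamma>" for t using X(1) by (intro imageI) (simp add: Lie_def)
  then show "Y \<in> cLie (cmat ` \<Gamma>)" unfolding cmat_matrix_exp cmat_scaleR by (simp add: cLie_def X(2))
qed

section \<open>The complexified Lie algebra\<close>

lemma mat_commute: "mat c ** X = X ** mat c" for X :: "complex ^ 'n ^ 'n"
  by (simp add: vec_eq_iff matrix_matrix_mult_def mat_def if_distrib[of "\<lambda>x. x * _"] if_distrib[of "\<lambda>x. _ * x"]
      mult.commute cong: if_cong)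

lemma mat_ii_mult: "mat \<i> ** mat \<i> = (- mat 1 :: complex ^ 'n ^ 'n)"
  by (simp add: vec_eq_iff matrix_matrix_mult_def mat_def if_distrib[of "\<lambda>x. x * _"] cong: if_cong)

lemma complexified_Lie_eq:
  "complexified_Lie \<Gamma> = {X + mat \<i> ** Y | X Y. X \<in> cLie (cmat ` \<Gamma>) \<and> Y \<in> cLie (cmat ` \<Gamma>)}"
  unfolding complexified_Lie_def cLie_cmat by blast

lemma complexified_Lie_subspace_bracket:
  assumes \<Gamma>: "subgroup \<Gamma> GL" "closedin (top_of_set (carrier GL)) \<Gamma>"
  shows "subspace (complexified_Lie \<Gamma>)"
    "\<forall>Z\<in>complexified_Lie \<Gamma>. \<forall>Z'\<in>complexified_Lie \<Gamma>. Z ** Z' - Z' ** Z \<in> complexified_Lie \<Gamma>"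
proof -
  let ?l = "cLie (cmat ` \<Gamma>)"
  note S = subspace_cLie[OF subgroup_cmat[OF \<Gamma>(1)] closedin_GL_cmat[OF \<Gamma>(2)]]
  note Br = cLie_bracket[OF subgroup_cmat[OF \<Gamma>(1)] closedin_GL_cmat[OF \<Gamma>(2)]]
  show "subspace (complexified_Lie \<Gamma>)"
  proof (rule subspaceI)
    show "0 \<in> complexified_Lie \<Gamma>"
      unfolding complexified_Lie_eq
      by (intro CollectI exI[of _ 0]) (simp add: subspace_0[OF S] matrix_mult_simps)
  next
    fix x y assume "x \<in> complexified_Lie \<Gamma>" "y \<in> complexified_Lie \<Gamma>"
    then obtain X Y X' Y' where "X \<in> ?l" "Y \<in> ?l" "X' \<in> ?l" "Y' \<in> ?l" "x = X + mat \<i> ** Y" "y = X' + mat \<i> ** Y'"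
      by (auto simp: complexified_Lie_eq)
    then show "x + y \<in> complexified_Lie \<Gamma>"
      unfolding complexified_Lie_eq
      by (intro CollectI exI[of _ "X + X'"] exI[of _ "Y + Y'"]) (simp add: matrix_mult_simps subspace_add[OF S])
  next
    fix c :: real and x assume "x \<in> complexified_Lie \<Gamma>"
    then obtain X Y where "X \<in> ?l" "Y \<in> ?l" "x = X + mat \<i> ** Y" by (auto simp: complexified_Lie_eq)
    then show "c *\<^sub>R x \<in> complexified_Lie \<Gamma>"
      unfolding complexified_Lie_eq
      by (intro CollectI exI[of _ "c *\<^sub>R X"] exI[of _ "c *\<^sub>R Y"])
         (simp add: matrix_mult_simps scaleR_add_right subspace_scale[OF S])
  qed
  show "\<forall>Z\<in>complexified_Lie \<Gamma>. \<forall>Z'\<in>complexified_Lie \<Gamma>. Z ** Z' - Z' ** Z \<in> complexified_Lie \<Gamma>"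
  proof (intro ballI)
    fix x y assume "x \<in> complexified_Lie \<Gamma>" "y \<in> complexified_Lie \<Gamma>"
    then obtain X Y X' Y' where XY: "X \<in> ?l" "Y \<in> ?l" "X' \<in> ?l" "Y' \<in> ?l" "x = X + mat \<i> ** Y" "y = X' + mat \<i> ** Y'"
      by (auto simp: complexified_Lie_eq)
    have i1: "(mat \<i> ** P) ** Q = mat \<i> ** (P ** Q)" for P Q :: "complex ^ 'a ^ 'a" by (simp add: matrix_mul_assoc)
    have i2: "P ** (mat \<i> ** Q) = mat \<i> ** (P ** Q)" for P Q :: "complex ^ 'a ^ 'a"
      by (metis mat_commute matrix_mul_assoc)
    have i3: "mat \<i> ** (mat \<i> ** P) = - P" for P :: "complex ^ 'a ^ 'a"
      by (simp add: matrix_mul_assoc mat_ii_mult matrix_mult_simps)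
    have "x ** y - y ** x = ((X ** X' - X' ** X) - (Y ** Y' - Y' ** Y)) + mat \<i> ** ((X ** Y' - Y' ** X) + (Y ** X' - X' ** Y))"
      by (simp add: XY(5,6) matrix_mult_simps i1 i2[of X] i2[of Y] i2[of X'] i2[of Y'] i3)
    moreover have "(X ** X' - X' ** X) - (Y ** Y' - Y' ** Y) \<in> ?l" "(X ** Y' - Y' ** X) + (Y ** X' - X' ** Y) \<in> ?l"
      using XY by (auto intro!: subspace_diff[OF S] subspace_add[OF S] Br)
    ultimately show "x ** y - y ** x \<in> complexified_Lie \<Gamma>"
      unfolding complexified_Lie_eq by blast
  qed
qed

text \<open>Connectedness enters here: a closed connected group is generated by exponentials of its
  own Lie algebra, which is contained in the complexified one.\<close>

lemma cmat_subset_complexification: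
  assumes \<Gamma>: "subgroup \<Gamma> GL" "closedin (top_of_set (carrier GL)) \<Gamma>" "connected \<Gamma>"
  shows "cmat ` \<Gamma> \<subseteq> complexification \<Gamma>"
proof -
  note S = subspace_cLie[OF subgroup_cmat[OF \<Gamma>(1)] closedin_GL_cmat[OF \<Gamma>(2)]]
  have "cLie (cmat ` \<Gamma>) \<subseteq> complexified_Lie \<Gamma>"
  proof
    fix X assume "X \<in> cLie (cmat ` \<Gamma>)"
    then show "X \<in> complexified_Lie \<Gamma>"
      unfolding complexified_Lie_eq
      by (intro CollectI exI[of _ X] exI[of _ 0]) (simp add: subspace_0[OF S] matrix_mult_simps)
  qed
  then have "generate GL (matrix_exp ` cLie (cmat ` \<Gamma>)) \<subseteq> complexification \<Gamma>"
    unfolding complexification_def connected_Lie_subgroup_def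
    by (intro group.mono_generate[OF group_GL] image_mono)
  with connected_subset_generate_exp[OF subgroup_cmat[OF \<Gamma>(1)] closedin_GL_cmat[OF \<Gamma>(2)] connected_cmat[OF \<Gamma>(3)]]
  show ?thesis by (rule order_trans)
qed

section \<open>Complex polynomial equations as real ones\<close>

lemma polynomial_in_entries_pdeg:
  assumes "polynomial_in_entries p"
  shows "\<exists>n. pdeg n (\<lambda>A. Re (p A)) \<and> pdeg n (\<lambda>A. Im (p A))"
  using assms
proof induction
  case (const c)
  show ?case by (auto intro: pdeg.const)
next
  case (entry i j)
  have "bounded_linear (\<lambda>A :: complex ^ 'a ^ 'a. A $ i $ j)"
    using bounded_linear_compose[OF bounded_linear_vec_nth bounded_linear_vec_nth] .
  then have "bounded_linear (\<lambda>A :: complex ^ 'a ^ 'a. Re (A $ i $ j))" "bounded_linear (\<lambda>A :: complex ^ 'a ^ 'a. Im (A $ i $ j))"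
    by (auto intro: bounded_linear_compose[OF bounded_linear_Re] bounded_linear_compose[OF bounded_linear_Im])
  then show ?case using pdeg.lin by blast
next
  case (add p q)
  then obtain n m where "pdeg n (\<lambda>A. Re (p A))" "pdeg n (\<lambda>A. Im (p A))" "pdeg m (\<lambda>A. Re (q A))" "pdeg m (\<lambda>A. Im (q A))" by blast
  then have "pdeg (max n m) (\<lambda>A. Re (p A))" "pdeg (max n m) (\<lambda>A. Im (p A))"
    "pdeg (max n m) (\<lambda>A. Re (q A))" "pdeg (max n m) (\<lambda>A. Im (q A))" by (auto intro: pdeg_mono)
  then show ?case by (intro exI[of _ "max n m"]) (auto intro: pdeg.add)
next
  case (mult p q)
  then obtain n m where nm: "pdeg n (\<lambda>A. Re (p A))" "pdeg n (\<lambda>A. Im (p A))" "pdeg m (\<lambda>A. Re (q A))" "pdeg m (\<lambda>A. Im (q A))" by blast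
  have "pdeg (n + m) (\<lambda>A. Re (p A) * Re (q A) + (- 1) * (Im (p A) * Im (q A)))"
    by (intro pdeg.add pdeg.mult pdeg_cmult[OF pdeg.mult] nm)
  moreover have "pdeg (n + m) (\<lambda>A. Re (p A) * Im (q A) + Im (p A) * Re (q A))"
    by (intro pdeg.add pdeg.mult nm)
  ultimately show ?case by (intro exI[of _ "n + m"]) simp
qed

lemma polynomial_in_entries_continuous: "polynomial_in_entries p \<Longrightarrow> continuous_on S p"
  by (induction rule: polynomial_in_entries.induct) (auto intro!: continuous_intros)

text \<open>Real and imaginary parts of the complex equations of \<open>K\<close> are real
  polynomials that vanish on \<open>S\<close>, so a common zero of the real ideal of
  \<open>S\<close> satisfies the equations of \<open>K\<close>.\<close>

lemma affine_algebraic_vanishing_mem: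
  assumes K: "affine_algebraic_subgroup K" and S: "S \<subseteq> K" and A: "invertible A"
    and van: "\<And>m f. f \<in> vanishing m S \<Longrightarrow> f A = 0"
  shows "A \<in> K"
proof -
  obtain P where P: "\<forall>p\<in>P. polynomial_in_entries p" "K = {A \<in> carrier GL. \<forall>p\<in>P. p A = 0}"
    using K by (auto simp: affine_algebraic_subgroup_def)
  have "p A = 0" if p: "p \<in> P" for p
  proof -
    obtain n where n: "pdeg n (\<lambda>A. Re (p A))" "pdeg n (\<lambda>A. Im (p A))" using polynomial_in_entries_pdeg P(1) p by blast
    have "p B = 0" if "B \<in> S" for B using that S P(2) p by blast
    then have "(\<lambda>A. Re (p A)) \<in> vanishing n S" "(\<lambda>A. Im (p A)) \<in> vanishing n S" using n by (auto simp: vanishing_def)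
    from van[OF this(1)] van[OF this(2)] show "p A = 0" by (simp add: complex_eq_iff)
  qed
  then show ?thesis using P(2) A by simp
qed

lemma closedin_GL_affine_algebraic:
  assumes "affine_algebraic_subgroup K"
  shows "closedin (top_of_set (carrier GL)) K"
proof -
  obtain P where P: "\<forall>p\<in>P. polynomial_in_entries p" "K = {A \<in> carrier GL. \<forall>p\<in>P. p A = 0}"
    using assms by (auto simp: affine_algebraic_subgroup_def)
  have "closed (\<Inter>p\<in>P. p -` {0})"
    using P(1) by (intro closed_INT ballI closed_vimage polynomial_in_entries_continuous) auto
  moreover have "K = carrier GL \<inter> (\<Inter>p\<in>P. p -` {0})" using P(2) by auto
  ultimately show ?thesis by (auto simp: closedin_closed)
qed

lemma zariski_Lie_closed_affine_algebraic:
  assumes "affine_algebraic_subgroup K"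
  shows "zariski_Lie_closed K"
  unfolding zariski_Lie_closed_def cLie_def
  using affine_algebraic_vanishing_mem[OF assms subset_refl invertible_matrix_exp] by blast

text \<open>The imaginary parts of the entries belong to the ideal, so \<open>X\<close> is real. The
  equations of the complexification do too, so \<open>X\<close> lies in its Lie algebra, which
  \<open>cLie_generate_exp\<close> identifies as the complexified one; being real, \<open>X\<close>
  has no imaginary summand there.\<close>

lemma zariski_Lie_closed_cmat:
  assumes "real_algebraic_group \<Gamma>"
  shows "zariski_Lie_closed (cmat ` \<Gamma>)"
  unfolding zariski_Lie_closed_def
proof (intro allI impI)
  have \<Gamma>: "subgroup \<Gamma> GL" "closedin (top_of_set (carrier GL)) \<Gamma>" "connected \<Gamma>"
    and alg: "affine_algebraic_subgroup (complexification \<Gamma>)" using assms by (auto simp: real_algebraic_group_def)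
  note h = complexified_Lie_subspace_bracket[OF \<Gamma>(1,2)]
  fix X assume van: "\<forall>t m. \<forall>f\<in>vanishing m (cmat ` \<Gamma>). f (matrix_exp (t *\<^sub>R X)) = 0"
  have "matrix_exp (t *\<^sub>R X) \<in> range cmat" for t
    unfolding range_cmat_iff
  proof (intro allI)
    fix i j
    have "bounded_linear (\<lambda>A :: complex ^ 'a ^ 'a. Im (A $ i $ j))"
      by (intro bounded_linear_compose[OF bounded_linear_Im] bounded_linear_compose[OF bounded_linear_vec_nth bounded_linear_vec_nth])
    then have "(\<lambda>A. Im (A $ i $ j)) \<in> vanishing (Suc 0) (cmat ` \<Gamma>)" by (auto simp: vanishing_def intro: pdeg.lin)
    from van[rule_format, OF this] show "Im (matrix_exp (t *\<^sub>R X) $ i $ j) = 0" .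
  qed
  then have real: "X \<in> range cmat" by (rule in_range_cmat_if_exp)
  have "matrix_exp (t *\<^sub>R X) \<in> complexification \<Gamma>" for t
    by (rule affine_algebraic_vanishing_mem[OF alg cmat_subset_complexification[OF \<Gamma>] invertible_matrix_exp]) (use van in blast)
  then have "X \<in> cLie (generate GL (matrix_exp ` complexified_Lie \<Gamma>))"
    by (simp add: cLie_def complexification_def connected_Lie_subgroup_def)
  then have "X \<in> complexified_Lie \<Gamma>" by (rule cLie_generate_exp[OF h])
  then obtain Y Z where YZ: "Y \<in> Lie \<Gamma>" "Z \<in> Lie \<Gamma>" "X = cmat Y + mat \<i> ** cmat Z" by (auto simp: complexified_Lie_def)
  have "Z $ i $ j = 0" for i j
  proof -
    have "Im (X $ i $ j) = 0" using real by (simp add: range_cmat_iff)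
    moreover have "(mat \<i> ** cmat Z) $ i $ j = \<i> * complex_of_real (Z $ i $ j)"
      by (simp add: matrix_matrix_mult_def mat_def if_distrib[of "\<lambda>x. x * _"] cong: if_cong)
    ultimately show ?thesis using YZ(3) by simp
  qed
  then have "Z = 0" by (simp add: vec_eq_iff)
  moreover have "cmat (0 :: real ^ 'a ^ 'a) = 0" by (simp add: vec_eq_iff)
  ultimately have "X = cmat Y" using YZ(3) by (simp add: matrix_mult_simps)
  then show "X \<in> cLie (cmat ` \<Gamma>)" using YZ(1) by (simp add: cLie_cmat)
qed

lemma l_coset_GL: "x <#\<^bsub>GL\<^esub> K = {x ** h | h. h \<in> K}"
  by (auto simp: l_coset_def)

theorem mainTheorem1:
  fixes G H L :: "(real ^ 'n ^ 'n) set"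
    and M :: "(complex ^ 'n ^ 'n) set topology"
    and \<xi>\<^sub>0 :: "(complex ^ 'n ^ 'n) set"
  assumes "real_algebraic_group G"
    and "real_algebraic_subgroup H G"
    and "real_algebraic_subgroup L G"
  defines "M \<equiv> classical_topology (complexification G) (complexification H)"
    and "\<xi>\<^sub>0 \<equiv> \<one>\<^bsub>GL\<^esub> <#\<^bsub>GL\<^esub> complexification H"
  shows "\<exists>g\<in>G. closedin (subtopology M (translation_orbit G \<xi>\<^sub>0))
           (translation_orbit L (cmat g <#\<^bsub>GL\<^esub> \<xi>\<^sub>0))"
proof -
  define K where "K = complexification H"
  have G: "subgroup G GL" "closedin (top_of_set (carrier GL)) G" "connected G"
    using assms(1) by (auto simp: real_algebraic_group_def)
  have L: "subgroup L GL" "closedin (top_of_set (carrier GL)) L" "real_algebraic_group L" "L \<subseteq> G"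
    using assms(3) by (auto simp: real_algebraic_group_def real_algebraic_subgroup_def)
  have K: "affine_algebraic_subgroup K"
    using assms(2) by (simp add: K_def real_algebraic_group_def real_algebraic_subgroup_def)
  have Kg: "subgroup K GL" using K by (simp add: affine_algebraic_subgroup_def)
  interpret closed_subgroup_pair "cmat ` L" K
    by (rule closed_subgroup_pair.intro[OF subgroup_cmat[OF L(1)] closedin_GL_cmat[OF L(2)] zariski_Lie_closed_cmat[OF L(3)]
          Kg closedin_GL_affine_algebraic[OF K] zariski_Lie_closed_affine_algebraic[OF K]])
  note GG = subgroup_GL_D[OF subgroup_cmat[OF G(1)]]
  have G_sub: "cmat ` G \<subseteq> complexification G" by (rule cmat_subset_complexification[OF G])
  define d where "d g = dim (orbit_tangent (cmat ` L) K (cmat g))" for g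
  define g where "g = arg_min d (\<lambda>g. g \<in> G)"
  have "mat 1 \<in> G" using subgroup_GL_D(1)[OF G(1)] .
  then have g: "g \<in> G" "\<And>g'. g' \<in> G \<Longrightarrow> d g \<le> d g'"
    unfolding g_def by (auto intro: arg_min_natI arg_min_nat_le)
  let ?O = "two_sided_orbit (cmat g)"
  have key: "cmat g' \<in> ?O" if "g' \<in> G" "cmat g' \<in> closure ?O" for g'
    using orbit_closed_if_minimal[OF _ that(2)] g(2)[OF that(1)] GG(3) g(1) by (auto simp: d_def)
  have coset: "x <#\<^bsub>GL\<^esub> (y <#\<^bsub>GL\<^esub> K) = (x ** y) <#\<^bsub>GL\<^esub> K" for x y
    unfolding l_coset_GL by (force simp: matrix_mul_assoc)
  have xi: "\<xi>\<^sub>0 = mat 1 <#\<^bsub>GL\<^esub> K" by (simp add: \<xi>\<^sub>0_def K_def)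
  define S where "S = {cmat g' <#\<^bsub>GL\<^esub> K | g'. g' \<in> G}"
  have S: "translation_orbit G \<xi>\<^sub>0 = S"
    unfolding translation_orbit_def orbit_def xi coset by (auto simp: S_def)
  define T where "T = {(cmat l ** cmat g) <#\<^bsub>GL\<^esub> K | l. l \<in> L}"
  have T: "translation_orbit L (cmat g <#\<^bsub>GL\<^esub> \<xi>\<^sub>0) = T"
    unfolding translation_orbit_def orbit_def xi coset by (auto simp: T_def)
  have TS: "T \<subseteq> S"
  proof
    fix \<eta> assume "\<eta> \<in> T"
    then obtain l where l: "l \<in> L" "\<eta> = cmat (l ** g) <#\<^bsub>GL\<^esub> K" by (auto simp: T_def cmat_mult)
    have "l ** g \<in> G" using l L(4) g(1) subgroup_GL_D(2)[OF G(1)] by blast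
    then show "\<eta> \<in> S" using l(2) by (auto simp: S_def)
  qed
  have coset_refl: "x \<in> x <#\<^bsub>GL\<^esub> K" for x
    unfolding l_coset_GL using GK(1) by (force intro: exI[of _ "mat 1"])
  \<comment> \<open>Closedness of the orbit of cosets is reduced to the double orbit of matrices:
    the factor in \<open>K\<close> is absorbed by the coset.\<close>
  have in_T: "cmat g' <#\<^bsub>GL\<^esub> K \<in> T \<longleftrightarrow> cmat g' \<in> ?O" for g'
  proof
    assume "cmat g' <#\<^bsub>GL\<^esub> K \<in> T"
    then obtain l where l: "l \<in> L" "cmat g' <#\<^bsub>GL\<^esub> K = (cmat l ** cmat g) <#\<^bsub>GL\<^esub> K" by (auto simp: T_def)
    then have "cmat g' \<in> (cmat l ** cmat g) <#\<^bsub>GL\<^esub> K" using coset_refl[of "cmat g'"] by (simp only:)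
    then show "cmat g' \<in> ?O" using l(1) unfolding l_coset_GL two_sided_orbit_def by blast
  next
    assume "cmat g' \<in> ?O"
    then obtain l h where l: "l \<in> L" "h \<in> K" "cmat g' = cmat l ** cmat g ** h" by (auto simp: two_sided_orbit_def)
    have hK: "h <#\<^bsub>GL\<^esub> K = K"
    proof (intro equalityI subsetI)
      fix k assume "k \<in> K"
      then have "matrix_inv h ** k \<in> K" "h ** (matrix_inv h ** k) = k"
        using GK l(2) by (auto simp: invertible_cancel)
      then show "k \<in> h <#\<^bsub>GL\<^esub> K" unfolding l_coset_GL by force
    qed (use GK l(2) in \<open>auto simp: l_coset_GL\<close>)
    have "cmat g' <#\<^bsub>GL\<^esub> K = (cmat l ** cmat g) <#\<^bsub>GL\<^esub> (h <#\<^bsub>GL\<^esub> K)"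
      by (simp add: coset l(3))
    then show "cmat g' <#\<^bsub>GL\<^esub> K \<in> T" using l(1) by (auto simp: hK T_def)
  qed
  \<comment> \<open>The open set that witnesses closedness. By \<open>clK\<close> the closure of the
    double orbit is invariant under right multiplication by \<open>K\<close>, so membership does not
    depend on the representative of the coset.\<close>
  define U where "U = {k <#\<^bsub>GL\<^esub> K | k. k \<in> complexification G \<and> k \<notin> closure ?O}"
  have clK: "x ** h \<in> closure ?O" if x: "x \<in> closure ?O" and h: "h \<in> K" for x h
  proof -
    have "(\<lambda>x. x ** h) ` closure ?O \<subseteq> closure ((\<lambda>x. x ** h) ` ?O)"
      by (rule closure_bounded_linear_image_subset[OF bounded_linear_matrix_mult(2)])
    also have "\<dots> \<subseteq> closure ?O"
    proof (rule closure_mono, rule subsetI)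
      fix y assume "y \<in> (\<lambda>x. x ** h) ` ?O"
      then obtain a b where ab: "a \<in> cmat ` L" "b \<in> K" "y = a ** cmat g ** b ** h" by (auto simp: two_sided_orbit_def)
      then have "y = a ** cmat g ** (b ** h)" "b ** h \<in> K" using GK(2) h by (auto simp: matrix_mul_assoc)
      then show "y \<in> ?O" using ab(1) unfolding two_sided_orbit_def by blast
    qed
    finally show ?thesis using x by blast
  qed
  have in_U: "k <#\<^bsub>GL\<^esub> K \<in> U \<longleftrightarrow> k \<notin> closure ?O" if k: "k \<in> complexification G" for k
  proof
    assume "k <#\<^bsub>GL\<^esub> K \<in> U"
    then obtain k' where k': "k' \<notin> closure ?O" "k <#\<^bsub>GL\<^esub> K = k' <#\<^bsub>GL\<^esub> K" by (auto simp: U_def)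
    then have "k' \<in> k <#\<^bsub>GL\<^esub> K" using coset_refl[of k'] by (simp only:)
    then show "k \<notin> closure ?O" using clK k'(1) unfolding l_coset_GL by blast
  qed (use k in \<open>auto simp: U_def\<close>)
  have hom: "homogeneous_space (complexification G) K = {k <#\<^bsub>GL\<^esub> K | k. k \<in> complexification G}"
    by (auto simp: homogeneous_space_def LCOSETS_def l_coset_def)
  have MK: "M = classical_topology (complexification G) K" by (simp add: M_def K_def)
  have "openin M U"
    unfolding MK openin_classical_topology hom
  proof
    have "{k \<in> complexification G. k <#\<^bsub>GL\<^esub> K \<in> U} = complexification G \<inter> (- closure ?O)" using in_U by auto
    then show "openin (top_of_set (complexification G)) {k \<in> complexification G. k <#\<^bsub>GL\<^esub> K \<in> U}"
      by (simp add: openin_open_Int open_Compl)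
  qed (auto simp: U_def)
  \<comment> \<open>The closure may add points of the complexification to the double orbit, but by
    \<open>key\<close> it adds no points of \<open>G\<close>, and only cosets of such points form
    \<open>S\<close>.\<close>
  moreover have "U \<inter> S = S - T"
  proof -
    have "\<eta> \<in> U \<longleftrightarrow> \<eta> \<notin> T" if \<eta>: "\<eta> \<in> S" for \<eta>
    proof -
      obtain g' where g': "g' \<in> G" "\<eta> = cmat g' <#\<^bsub>GL\<^esub> K" using \<eta> unfolding S_def by blast
      have "cmat g' \<in> complexification G" using G_sub g' by blast
      then show ?thesis
        unfolding g'(2) in_U[OF \<open>cmat g' \<in> complexification G\<close>] in_T using key[OF g'(1)] closure_subset by blast
    qed
    then show ?thesis by blast
  qed
  moreover have "topspace (subtopology M S) = S"
  proof -
    have "topspace M = (\<lambda>k. k <#\<^bsub>GL\<^esub> K) ` complexification G"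
      using quotient_imp_surjective_map[OF quotient_map_classical_topology[of "complexification G" K]] by (simp add: MK)
    then show ?thesis using G_sub by (auto simp: S_def)
  qed
  ultimately have "closedin (subtopology M S) T"
    unfolding closedin_def openin_subtopology using TS by (simp, intro exI[of _ U]) simp
  then show ?thesis using g(1) unfolding S[symmetric] T[symmetric] by blast
qed

end
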